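(* Every paracontact Ricci soliton is $H$-paracontact, and is necessarily expanding.
   Context: All manifolds are smooth and connected. A $(2n+1)$-dimensional contact manifold is a manifold $M^{2n+1}$ with a global 1-form $\eta$ such that $\eta\wedge(d\eta)^n\neq 0$ everywhere; its Reeb vector field $\xi$ is the unique vector field with $\eta(\xi)=1$, $d\eta(\xi,\cdot)=0$. A paracontact metric structure $(\varphi,\xi,\eta,g)$ on $M$ consists of such $\eta,\xi$, a semi-Riemannian metric $g$ and a $(1,1)$-tensor $\varphi$ with $\eta=g(\xi,\cdot)$, $d\eta(\cdot,\cdot)=g(\cdot,\varphi\,\cdot)$, $\varphi^2=I-\eta\otimes\xi$ (here $2\,d\eta(X,Y)=X\eta(Y)-Y\eta(X)-\eta([X,Y])$). A Ricci soliton is a semi-Riemannian manifold $(M,g)$ with a vector field $V$ and a real constant $\lambda$ such that $\varrho+\frac12L_Vg=\lambda g$, where $\varrho$ is the (usual) Ricci tensor and $L$ the Lie derivative. It is shrinking, steady or expanding according to whether $\lambda>0$, $\lambda=0$ or $\lambda<0$. A paracontact (metric) Ricci soliton is a paracontact metric manifold $(M,\varphi,\xi,\eta,g)$ for which this equation holds with $V=\xi$ and some real constant $\lambda$. A paracontact metric manifold is $H$-paracontact if $\xi$ is a harmonic vector field. Here the energy of a vector field $V$ is the energy of the map $V:(M,g)\to(TM,g^s)$, $g^s$ the Sasaki metric (over relatively compact domains if $M$ is non-compact); a vector field $V$ of constant length $g(V,V)=r\neq0$ is harmonic if it is a critical point of the energy restricted to vector fields of the same constant length $r$; equivalently, $\bar\Delta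 V$ is collinear to $V$, where $\bar\Delta V=-\mathrm{tr}\,\nabla^2V=\sum_i\varepsilon_i(\nabla_{\nabla_{E_i}E_i}V-\nabla_{E_i}\nabla_{E_i}V)$ for a local pseudo-orthonormal frame $\{E_i\}$, $\varepsilon_i=g(E_i,E_i)=\pm1$, and $\nabla$ is the Levi-Civita connection. *)

theory Defs
  imports "HOL-Analysis.Analysis"
begin

section \<open>Smooth maps between Euclidean spaces\<close>

text \<open>\<open>C_on k S f\<close> says that \<open>f\<close> is \<open>k\<close> times continuously differentiable; it is only used for open \<open>S\<close>.\<close>

primrec C_on :: "nat \<Rightarrow> 'a::euclidean_space set \<Rightarrow> ('a \<Rightarrow> 'b::real_normed_vector) \<Rightarrow> bool" where
  "C_on 0 S f \<longleftrightarrow> continuous_on S f"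
| "C_on (Suc k) S f \<longleftrightarrow> f differentiable_on S \<and>
     (\<forall>b\<in>Basis. C_on k S (\<lambda>x. frechet_derivative f (at x) b))"

definition smooth_on :: "'a::euclidean_space set \<Rightarrow> ('a \<Rightarrow> 'b::real_normed_vector) \<Rightarrow> bool" where
  "smooth_on S f \<longleftrightarrow> (\<forall>k. C_on k S f)"

definition pd :: "'n::finite \<Rightarrow> (real^'n \<Rightarrow> 'b::real_normed_vector) \<Rightarrow> real^'n \<Rightarrow> 'b" where
  "pd i f x = frechet_derivative f (at x) (axis i 1)"

definition jacobian :: "(real^'n::finite \<Rightarrow> real^'n) \<Rightarrow> real^'n \<Rightarrow> real^'n^'n" where
  "jacobian f x = matrix (frechet_derivative f (at x))"


section \<open>Smooth manifolds\<close>

text \<open>A chart is a pair of its domain and its coordinate map; the values of the coordinate map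
  outside the domain are irrelevant. The manifold is the whole type \<open>'m\<close>, whose topology is
  Hausdorff and second countable by its type classes; it is modelled on \<open>real^'n\<close>.\<close>

type_synonym ('m, 'n) chart = "'m set \<times> ('m \<Rightarrow> real^'n)"

definition chart_dom :: "('m, 'n::finite) chart \<Rightarrow> 'm set" where
  "chart_dom c = fst c"

definition chart_map :: "('m, 'n::finite) chart \<Rightarrow> 'm \<Rightarrow> real^'n" where
  "chart_map c = snd c"

definition chart_image :: "('m, 'n::finite) chart \<Rightarrow> (real^'n) set" where
  "chart_image c = chart_map c ` chart_dom c"

definition chart_inv :: "('m, 'n::finite) chart \<Rightarrow> real^'n \<Rightarrow> 'm" where
  "chart_inv c = inv_into (chart_dom c) (chart_map c)"

definition is_chart :: "('m::topological_space, 'n::finite) chart \<Rightarrow> bool" where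
  "is_chart c \<longleftrightarrow> open (chart_dom c) \<and> open (chart_image c) \<and>
     homeomorphism (chart_dom c) (chart_image c) (chart_map c) (chart_inv c)"

definition transition :: "('m, 'n::finite) chart \<Rightarrow> ('m, 'n) chart \<Rightarrow> real^'n \<Rightarrow> real^'n" where
  "transition c d = chart_map d \<circ> chart_inv c"

definition smooth_atlas :: "('m::topological_space, 'n::finite) chart set \<Rightarrow> bool" where
  "smooth_atlas A \<longleftrightarrow> (\<forall>c\<in>A. is_chart c) \<and> (\<Union>c\<in>A. chart_dom c) = UNIV \<and>
     (\<forall>c\<in>A. \<forall>d\<in>A. smooth_on (chart_map c ` (chart_dom c \<inter> chart_dom d)) (transition c d))"

definition connected_smooth_manifold ::
    "('m::{t2_space,second_countable_topology}, 'n::finite) chart set \<Rightarrow> bool" where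
  "connected_smooth_manifold A \<longleftrightarrow> smooth_atlas A \<and> connected (UNIV :: 'm set)"


section \<open>Tensor fields\<close>

text \<open>A tensor field is given by its component functions in every chart of the atlas, related on
  overlaps by the tensor transformation law. The value \<open>X c x\<close> matters only for \<open>x\<close> in the image
  of the chart \<open>c\<close>. Conventions: a vector field has components \<open>X\<^sup>i\<close>, a one-form \<open>\<omega>\<^sub>i\<close>, a bilinear
  form field \<open>T $ i $ j = T(\<partial>\<^sub>i, \<partial>\<^sub>j)\<close>, and an endomorphism field acts by \<open>\<phi> *v X\<close>.\<close>

type_synonym ('m, 'n, 'v) components = "('m, 'n) chart \<Rightarrow> real^'n \<Rightarrow> 'v"

definition tensor_field ::
    "(real^'n^'n \<Rightarrow> 'v \<Rightarrow> 'v \<Rightarrow> bool) \<Rightarrow> ('m::topological_space, 'n::finite) chart set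
      \<Rightarrow> ('m, 'n, 'v::real_normed_vector) components \<Rightarrow> bool" where
  "tensor_field law A T \<longleftrightarrow>
     (\<forall>c\<in>A. smooth_on (chart_image c) (T c)) \<and>
     (\<forall>c\<in>A. \<forall>d\<in>A. \<forall>p \<in> chart_dom c \<inter> chart_dom d.
        law (jacobian (transition c d) (chart_map c p)) (T c (chart_map c p)) (T d (chart_map d p)))"

definition vector_field ::
    "('m::topological_space, 'n::finite) chart set \<Rightarrow> ('m, 'n, real^'n) components \<Rightarrow> bool" where
  "vector_field = tensor_field (\<lambda>J X X'. X' = J *v X)"

definition one_form ::
    "('m::topological_space, 'n::finite) chart set \<Rightarrow> ('m, 'n, real^'n) components \<Rightarrow> bool" where
  "one_form = tensor_field (\<lambda>J w w'. w = transpose J *v w')"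

definition bilinear_field ::
    "('m::topological_space, 'n::finite) chart set \<Rightarrow> ('m, 'n, real^'n^'n) components \<Rightarrow> bool" where
  "bilinear_field = tensor_field (\<lambda>J T T'. T = transpose J ** T' ** J)"

definition endomorphism_field ::
    "('m::topological_space, 'n::finite) chart set \<Rightarrow> ('m, 'n, real^'n^'n) components \<Rightarrow> bool" where
  "endomorphism_field = tensor_field (\<lambda>J F F'. F' ** J = J ** F)"

definition semi_riemannian_metric ::
    "('m::topological_space, 'n::finite) chart set \<Rightarrow> ('m, 'n, real^'n^'n) components \<Rightarrow> bool" where
  "semi_riemannian_metric A g \<longleftrightarrow> bilinear_field A g \<and>
     (\<forall>c\<in>A. \<forall>x\<in>chart_image c. transpose (g c x) = g c x \<and> det (g c x) \<noteq> 0)"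


section \<open>Local differential geometry\<close>

text \<open>The following operators act on component functions in one chart.\<close>

text \<open>The convention is \<open>2 d\<eta>(X, Y) = X \<eta>(Y) - Y \<eta>(X) - \<eta>([X, Y])\<close>.\<close>

definition ext_deriv :: "(real^'n::finite \<Rightarrow> real^'n) \<Rightarrow> real^'n \<Rightarrow> real^'n^'n" where
  "ext_deriv w x = (\<chi> i j. (pd i (\<lambda>y. w y $ j) x - pd j (\<lambda>y. w y $ i) x) / 2)"

definition lie_deriv_form ::
    "(real^'n::finite \<Rightarrow> real^'n) \<Rightarrow> (real^'n \<Rightarrow> real^'n^'n) \<Rightarrow> real^'n \<Rightarrow> real^'n^'n" where
  "lie_deriv_form V T x = (\<chi> i j.
     (\<Sum>k\<in>UNIV. V x $ k * pd k (\<lambda>y. T y $ i $ j) x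
        + T x $ k $ j * pd i (\<lambda>y. V y $ k) x
        + T x $ i $ k * pd j (\<lambda>y. V y $ k) x))"

text \<open>\<open>christoffel g x k i j\<close> is \<open>\<Gamma>\<^sup>k\<^sub>i\<^sub>j\<close>, that is, \<open>\<nabla>\<^bsub>\<partial>i\<^esub> \<partial>\<^sub>j = \<Gamma>\<^sup>k\<^sub>i\<^sub>j \<partial>\<^sub>k\<close> for the Levi-Civita connection.\<close>

definition christoffel ::
    "(real^'n::finite \<Rightarrow> real^'n^'n) \<Rightarrow> real^'n \<Rightarrow> 'n \<Rightarrow> 'n \<Rightarrow> 'n \<Rightarrow> real" where
  "christoffel g x k i j = (\<Sum>l\<in>UNIV. matrix_inv (g x) $ k $ l *
     (pd i (\<lambda>y. g y $ j $ l) x + pd j (\<lambda>y. g y $ i $ l) x - pd l (\<lambda>y. g y $ i $ j) x)) / 2"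

text \<open>\<open>riemann g x l k i j\<close> is the \<open>l\<close>-th component of \<open>R(\<partial>\<^sub>i, \<partial>\<^sub>j) \<partial>\<^sub>k\<close>, where
  \<open>R(X, Y) = [\<nabla>\<^sub>X, \<nabla>\<^sub>Y] - \<nabla>\<^bsub>[X,Y]\<^esub>\<close>, and \<open>\<rho>(X, Y)\<close> is the trace of \<open>Z \<mapsto> R(Z, X) Y\<close>
  (positive on round spheres).\<close>

definition riemann ::
    "(real^'n::finite \<Rightarrow> real^'n^'n) \<Rightarrow> real^'n \<Rightarrow> 'n \<Rightarrow> 'n \<Rightarrow> 'n \<Rightarrow> 'n \<Rightarrow> real" where
  "riemann g x l k i j =
     pd i (\<lambda>y. christoffel g y l j k) x - pd j (\<lambda>y. christoffel g y l i k) x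
     + (\<Sum>m\<in>UNIV. christoffel g x l i m * christoffel g x m j k
                 - christoffel g x l j m * christoffel g x m i k)"

definition ricci :: "(real^'n::finite \<Rightarrow> real^'n^'n) \<Rightarrow> real^'n \<Rightarrow> real^'n^'n" where
  "ricci g x = (\<chi> j k. \<Sum>i\<in>UNIV. riemann g x i k i j)"


section \<open>Contact and paracontact metric structures\<close>

text \<open>Up to a positive constant depending only on normalisation conventions, this is the value of
  \<open>w \<and> \<Omega> \<and> \<dots> \<and> \<Omega>\<close> (\<open>n\<close> factors \<open>\<Omega>\<close>) on the vectors \<open>v 0, \<dots>, v (2 * n)\<close>.\<close>

definition wedge_power :: "nat \<Rightarrow> real^'n::finite \<Rightarrow> real^'n^'n \<Rightarrow> (nat \<Rightarrow> real^'n) \<Rightarrow> real" where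
  "wedge_power n w \<Omega> v = (\<Sum>s | s permutes {..2 * n}. of_int (sign s) * (w \<bullet> v (s 0)) *
     (\<Prod>k<n. v (s (2 * k + 1)) \<bullet> (\<Omega> *v v (s (2 * k + 2)))))"

definition contact_form ::
    "nat \<Rightarrow> ('m::topological_space, 'n::finite) chart set \<Rightarrow> ('m, 'n, real^'n) components \<Rightarrow> bool" where
  "contact_form n A \<eta> \<longleftrightarrow> CARD('n) = 2 * n + 1 \<and> one_form A \<eta> \<and>
     (\<forall>c\<in>A. \<forall>x\<in>chart_image c. \<exists>v. wedge_power n (\<eta> c x) (ext_deriv (\<eta> c) x) v \<noteq> 0)"

definition reeb_field ::
    "('m::topological_space, 'n::finite) chart set \<Rightarrow> ('m, 'n, real^'n) components
      \<Rightarrow> ('m, 'n, real^'n) components \<Rightarrow> bool" where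
  "reeb_field A \<eta> \<xi> \<longleftrightarrow> vector_field A \<xi> \<and>
     (\<forall>c\<in>A. \<forall>x\<in>chart_image c. \<eta> c x \<bullet> \<xi> c x = 1 \<and>
        (\<forall>v. \<xi> c x \<bullet> (ext_deriv (\<eta> c) x *v v) = 0))"

definition paracontact_metric ::
    "nat \<Rightarrow> ('m::topological_space, 'n::finite) chart set \<Rightarrow> ('m, 'n, real^'n^'n) components
      \<Rightarrow> ('m, 'n, real^'n) components \<Rightarrow> ('m, 'n, real^'n) components
      \<Rightarrow> ('m, 'n, real^'n^'n) components \<Rightarrow> bool" where
  "paracontact_metric n A \<phi> \<xi> \<eta> g \<longleftrightarrow>
     contact_form n A \<eta> \<and> reeb_field A \<eta> \<xi> \<and>
     semi_riemannian_metric A g \<and> endomorphism_field A \<phi> \<and>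
     (\<forall>c\<in>A. \<forall>x\<in>chart_image c.
        (\<forall>v. \<eta> c x \<bullet> v = \<xi> c x \<bullet> (g c x *v v)) \<and>
        (\<forall>u v. u \<bullet> (ext_deriv (\<eta> c) x *v v) = u \<bullet> (g c x *v (\<phi> c x *v v))) \<and>
        (\<forall>v. \<phi> c x *v (\<phi> c x *v v) = v - (\<eta> c x \<bullet> v) *\<^sub>R \<xi> c x))"


section \<open>Ricci solitons\<close>

definition ricci_soliton ::
    "('m::topological_space, 'n::finite) chart set \<Rightarrow> ('m, 'n, real^'n^'n) components
      \<Rightarrow> ('m, 'n, real^'n) components \<Rightarrow> real \<Rightarrow> bool" where
  "ricci_soliton A g V lam \<longleftrightarrow> semi_riemannian_metric A g \<and> vector_field A V \<and>
     (\<forall>c\<in>A. \<forall>x\<in>chart_image c.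
        ricci (g c) x + (1/2) *\<^sub>R lie_deriv_form (V c) (g c) x = lam *\<^sub>R g c x)"

definition paracontact_ricci_soliton ::
    "nat \<Rightarrow> ('m::topological_space, 'n::finite) chart set \<Rightarrow> ('m, 'n, real^'n^'n) components
      \<Rightarrow> ('m, 'n, real^'n) components \<Rightarrow> ('m, 'n, real^'n) components
      \<Rightarrow> ('m, 'n, real^'n^'n) components \<Rightarrow> real \<Rightarrow> bool" where
  "paracontact_ricci_soliton n A \<phi> \<xi> \<eta> g lam \<longleftrightarrow>
     paracontact_metric n A \<phi> \<xi> \<eta> g \<and> ricci_soliton A g \<xi> lam"

definition expanding :: "real \<Rightarrow> bool" where
  "expanding lam \<longleftrightarrow> lam < 0"


section \<open>Energy of vector fields and harmonicity\<close>

text \<open>\<open>sasaki g x v (a, b) (a', b')\<close> is the Sasaki metric at the point \<open>(x, v)\<close> of the tangent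
  bundle, in the chart of the tangent bundle induced by a chart of the manifold. The projection
  maps the tangent vector \<open>(a, b)\<close> to \<open>a\<close>, and the connection map sends it to \<open>b + \<Gamma>(a, v)\<close>.\<close>

definition connection_map ::
    "(real^'n::finite \<Rightarrow> real^'n^'n) \<Rightarrow> real^'n \<Rightarrow> real^'n \<Rightarrow> (real^'n) \<times> (real^'n) \<Rightarrow> real^'n" where
  "connection_map g x v w =
     snd w + (\<chi> k. \<Sum>i\<in>UNIV. \<Sum>j\<in>UNIV. christoffel g x k i j * fst w $ i * v $ j)"

definition sasaki ::
    "(real^'n::finite \<Rightarrow> real^'n^'n) \<Rightarrow> real^'n \<Rightarrow> real^'n
      \<Rightarrow> (real^'n) \<times> (real^'n) \<Rightarrow> (real^'n) \<times> (real^'n) \<Rightarrow> real" where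
  "sasaki g x v w w' = fst w \<bullet> (g x *v fst w')
     + connection_map g x v w \<bullet> (g x *v connection_map g x v w')"

text \<open>Half the \<open>g\<close>-trace of the pullback of the Sasaki metric along \<open>x \<mapsto> (x, V x)\<close>, whose
  differential maps \<open>\<partial>\<^sub>i\<close> to \<open>(\<partial>\<^sub>i, \<partial>\<^sub>i V)\<close>.\<close>

definition local_energy_density ::
    "(real^'n::finite \<Rightarrow> real^'n^'n) \<Rightarrow> (real^'n \<Rightarrow> real^'n) \<Rightarrow> real^'n \<Rightarrow> real" where
  "local_energy_density g V x = (\<Sum>i\<in>UNIV. \<Sum>j\<in>UNIV. matrix_inv (g x) $ i $ j *
     sasaki g x (V x) (axis i 1, pd i V x) (axis j 1, pd j V x)) / 2"

text \<open>The density does not depend on the chart chosen around the point.\<close>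

definition energy_density ::
    "('m::topological_space, 'n::finite) chart set \<Rightarrow> ('m, 'n, real^'n^'n) components
      \<Rightarrow> ('m, 'n, real^'n) components \<Rightarrow> 'm \<Rightarrow> real" where
  "energy_density A g V p = (let c = (SOME c. c \<in> A \<and> p \<in> chart_dom c)
     in local_energy_density (g c) (V c) (chart_map c p))"

text \<open>This property characterises the volume measure of \<open>g\<close> uniquely: second countability yields
  countably many charts covering the manifold.\<close>

definition volume_measure ::
    "('m::topological_space, 'n::finite) chart set \<Rightarrow> ('m, 'n, real^'n^'n) components
      \<Rightarrow> 'm measure \<Rightarrow> bool" where
  "volume_measure A g \<mu> \<longleftrightarrow> sets \<mu> = sets borel \<and>
     (\<forall>c\<in>A. \<forall>B\<in>sets borel. B \<subseteq> chart_dom c \<longrightarrow>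
        emeasure \<mu> B = (\<integral>\<^sup>+x\<in>chart_map c ` B. ennreal (sqrt \<bar>det (g c x)\<bar>) \<partial>lborel))"

definition energy ::
    "('m::topological_space, 'n::finite) chart set \<Rightarrow> ('m, 'n, real^'n^'n) components
      \<Rightarrow> 'm measure \<Rightarrow> 'm set \<Rightarrow> ('m, 'n, real^'n) components \<Rightarrow> real" where
  "energy A g \<mu> D V = (LINT p:D|\<mu>. energy_density A g V p)"

definition has_length ::
    "('m::topological_space, 'n::finite) chart set \<Rightarrow> ('m, 'n, real^'n^'n) components
      \<Rightarrow> ('m, 'n, real^'n) components \<Rightarrow> real \<Rightarrow> bool" where
  "has_length A g V r \<longleftrightarrow> (\<forall>c\<in>A. \<forall>x\<in>chart_image c. V c x \<bullet> (g c x *v V c x) = r)"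

definition relatively_compact_domain :: "'m::topological_space set \<Rightarrow> bool" where
  "relatively_compact_domain D \<longleftrightarrow> open D \<and> connected D \<and> compact (closure D)"

text \<open>Smooth one-parameter variations \<open>W\<close> of \<open>V\<close>, defined for \<open>\<bar>t\<bar> < \<epsilon>\<close>, through vector fields of
  the same constant length \<open>r\<close>, and supported in a compact subset of \<open>D\<close>. If the manifold is compact
  then \<open>D = UNIV\<close> is allowed and the support condition is void.\<close>

definition length_preserving_variation ::
    "('m::topological_space, 'n::finite) chart set \<Rightarrow> ('m, 'n, real^'n^'n) components
      \<Rightarrow> ('m, 'n, real^'n) components \<Rightarrow> real \<Rightarrow> 'm set \<Rightarrow> real
      \<Rightarrow> (real \<Rightarrow> ('m, 'n, real^'n) components) \<Rightarrow> bool" where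
  "length_preserving_variation A g V r D \<epsilon> W \<longleftrightarrow>
     (\<forall>t. \<bar>t\<bar> < \<epsilon> \<longrightarrow> vector_field A (W t) \<and> has_length A g (W t) r) \<and>
     (\<forall>c\<in>A. smooth_on ({-\<epsilon><..<\<epsilon>} \<times> chart_image c) (\<lambda>(t, x). W t c x)) \<and>
     (\<forall>c\<in>A. \<forall>x\<in>chart_image c. W 0 c x = V c x) \<and>
     (\<exists>K\<subseteq>D. compact K \<and> (\<forall>t c p. \<bar>t\<bar> < \<epsilon> \<and> c \<in> A \<and> p \<in> chart_dom c - K \<longrightarrow>
        W t c (chart_map c p) = V c (chart_map c p)))"

definition harmonic_vector_field ::
    "('m::topological_space, 'n::finite) chart set \<Rightarrow> ('m, 'n, real^'n^'n) components
      \<Rightarrow> ('m, 'n, real^'n) components \<Rightarrow> bool" where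
  "harmonic_vector_field A g V \<longleftrightarrow> vector_field A V \<and>
     (\<exists>r. r \<noteq> 0 \<and> has_length A g V r \<and>
        (\<forall>\<mu> D \<epsilon> W. volume_measure A g \<mu> \<and> relatively_compact_domain D \<and> \<epsilon> > 0 \<and>
            length_preserving_variation A g V r D \<epsilon> W \<longrightarrow>
          ((\<lambda>t. energy A g \<mu> D (W t)) has_real_derivative 0) (at 0)))"

definition H_paracontact ::
    "nat \<Rightarrow> ('m::topological_space, 'n::finite) chart set \<Rightarrow> ('m, 'n, real^'n^'n) components
      \<Rightarrow> ('m, 'n, real^'n) components \<Rightarrow> ('m, 'n, real^'n) components
      \<Rightarrow> ('m, 'n, real^'n^'n) components \<Rightarrow> bool" where
  "H_paracontact n A \<phi> \<xi> \<eta> g \<longleftrightarrow>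
     paracontact_metric n A \<phi> \<xi> \<eta> g \<and> harmonic_vector_field A g \<xi>"

end

theory Submission
  imports Defs
begin

text \<open>
  Write \<open>S = L\<^sub>\<xi> g / 2\<close>, viewed as an endomorphism, so that \<open>\<nabla>\<xi> = S - \<phi>\<close> and the soliton equation reads
  \<open>Ric = \<lambda> - S\<close>. Since \<open>L\<^sub>\<xi> d\<eta> = 0\<close>, taking Lie derivatives of \<open>d\<eta> = g(\<cdot>, \<phi> \<cdot>)\<close> and of
  \<open>\<phi>\<^sup>2 = 1 - \<eta> \<otimes> \<xi>\<close> yields \<open>tr S = 0\<close>. Hence the scalar curvature is constant, and the contracted second
  Bianchi identity gives \<open>div S = - div Ric = 0\<close>.

  Because \<open>div \<nabla>\<xi> = Ric \<xi> = \<lambda> \<xi>\<close>, the adjoint \<open>S + \<phi>\<close> of \<open>\<nabla>\<xi>\<close> has divergence \<open>- \<lambda> \<xi>\<close>. So the rough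
  Laplacian of \<open>\<xi>\<close> is collinear to \<open>\<xi>\<close>, and the divergence theorem makes the first variation of the
  energy vanish.

  Pairing \<open>div S = 0\<close> with \<open>\<xi>\<close> and using \<open>S \<xi> = 0\<close> gives \<open>tr S\<^sup>2 = 0\<close>. Pairing \<open>div \<nabla>\<xi> = \<lambda> \<xi>\<close> with \<open>\<xi>\<close>
  gives \<open>\<lambda> = - tr (\<nabla>\<xi>)\<^sup>2 = - tr S\<^sup>2 - tr \<phi>\<^sup>2 = - 2 n\<close>.
\<close>

text \<open>Harmonicity is defined here by criticality of the energy, so the Euler-Lagrange equation
  has to be reached by hand. With N = \<nabla>V and adjoint N', the energy density is half of the
  dimension plus tr (N' N), so a variation field U changes it by tr (N' \<nabla>U) = div (N' U) -
  (div N')(U). Constant length makes U orthogonal to \<xi>, and a divergence of N' proportional to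
  \<eta> kills the last term; this is why the divergence of the adjoint is needed and not only that
  of \<nabla>\<xi>. What remains is the divergence of a compactly supported field. Energy density
  and volume are accessible only through charts, so transformation laws and a partition of unity
  come in before it integrates to zero. In indefinite signature tr S^2 = 0 does not force S = 0, but
  only traces enter the value of \<lambda>. The 2 n in it is tr \<phi>^2, the trace of the
  projection along \<xi> onto the kernel of \<eta>.\<close>

abbreviation fderiv :: "('a::real_normed_vector \<Rightarrow> 'b::real_normed_vector) \<Rightarrow> 'a \<Rightarrow> 'a \<Rightarrow> 'b" where
  "fderiv f x \<equiv> frechet_derivative f (at x)"

section \<open>Calculus of continuously differentiable maps\<close>

lemma frechet_derivative_cong:
  assumes "open S" "x \<in> S" "\<And>y. y \<in> S \<Longrightarrow> f y = g y"
  shows "fderiv f x = fderiv g x"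
proof -
  have "(f has_derivative D) (at x) \<longleftrightarrow> (g has_derivative D) (at x)" for D
    using has_derivative_transform_within_open[OF _ assms(1,2), of f D UNIV g]
      has_derivative_transform_within_open[OF _ assms(1,2), of g D UNIV f] assms(3) by auto
  then show ?thesis unfolding frechet_derivative_def by simp
qed

lemma differentiable_at_cong:
  assumes "open S" "x \<in> S" "\<And>y. y \<in> S \<Longrightarrow> f y = g y" "f differentiable (at x)"
  shows "g differentiable (at x)"
  using has_derivative_transform_within_open[OF _ assms(1,2), of f _ UNIV g] assms(3,4)
  unfolding differentiable_def by blast

lemma C_on_cong:
  assumes "open S" "\<And>x. x \<in> S \<Longrightarrow> f x = g x" "C_on k S f"
  shows "C_on k S g"
  using assms(2,3)
proof (induction k arbitrary: f g)
  case 0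
  then show ?case using continuous_on_cong[of S S f g] by simp
next
  case (Suc k)
  have "g differentiable_on S"
    using Suc.prems differentiable_at_cong[OF \<open>open S\<close>, of _ f g] \<open>open S\<close>
    by (auto simp: differentiable_on_eq_differentiable_at)
  moreover have "C_on k S (\<lambda>x. fderiv g x b)" if "b \<in> Basis" for b
    using Suc.IH[of "\<lambda>x. fderiv f x b" "\<lambda>x. fderiv g x b"]
      frechet_derivative_cong[OF \<open>open S\<close>, of _ f g] Suc.prems that by simp
  ultimately show ?case by simp
qed

text \<open>\<open>C_on\<close> recurses through \<open>frechet_derivative\<close>, which is defined
  by choice. On an open set the derivative is unique, so an explicit formula may be supplied
  instead; most closure properties below are inductions through this rule.\<close>

lemma C_on_SucI:
  assumes "open S" "\<And>x. x \<in> S \<Longrightarrow> (f has_derivative f' x) (at x)"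
    "\<And>b. b \<in> Basis \<Longrightarrow> C_on k S (\<lambda>x. f' x b)"
  shows "C_on (Suc k) S f"
proof -
  have "f differentiable_on S"
    using assms(1,2) by (auto simp: differentiable_on_eq_differentiable_at differentiable_def)
  moreover have "C_on k S (\<lambda>x. fderiv f x b)" if "b \<in> Basis" for b
    by (rule C_on_cong[OF \<open>open S\<close> _ assms(3)[OF that]])
      (use frechet_derivative_at[OF assms(2)] in auto)
  ultimately show ?thesis by simp
qed

lemma C_on_SucD:
  assumes "open S" "C_on (Suc k) S f"
  shows "\<And>x. x \<in> S \<Longrightarrow> (f has_derivative fderiv f x) (at x)"
    and "\<And>b. b \<in> Basis \<Longrightarrow> C_on k S (\<lambda>x. fderiv f x b)"
  using assms by (auto simp: differentiable_on_eq_differentiable_at frechet_derivative_works[symmetric])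

lemma C_on_lower: "C_on (Suc k) S f \<Longrightarrow> C_on k S f"
  by (induction k arbitrary: f) (auto simp: differentiable_imp_continuous_on)

lemma C_on_mono: "C_on k S f \<Longrightarrow> j \<le> k \<Longrightarrow> C_on j S f"
  by (induction k) (use C_on_lower in \<open>auto simp del: C_on.simps simp: le_Suc_eq\<close>)

lemma C_on_continuous: "C_on k S f \<Longrightarrow> continuous_on S f"
  using C_on_mono[of k S f 0] by simp

lemma C_on_const: "C_on k S (\<lambda>x. c)"
  by (induction k arbitrary: c) (auto simp: frechet_derivative_const)

lemma C_on_bounded_linear:
  assumes "open S" "bounded_linear h" "C_on k S f"
  shows "C_on k S (\<lambda>x. h (f x))"
  using assms(3)
proof (induction k arbitrary: f)
  case 0
  then show ?case using bounded_linear.continuous_on[OF assms(2)] by simp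
next
  case (Suc k)
  show ?case
    by (rule C_on_SucI[OF \<open>open S\<close>, where f' = "\<lambda>x v. h (fderiv f x v)"])
      (use bounded_linear.has_derivative[OF assms(2) C_on_SucD(1)[OF \<open>open S\<close> Suc.prems]]
        C_on_SucD(2)[OF \<open>open S\<close> Suc.prems] Suc.IH in auto)
qed

lemma C_on_id: "open S \<Longrightarrow> C_on k S (\<lambda>x. x)"
proof (cases k)
  case (Suc j)
  assume "open S"
  then show ?thesis unfolding Suc
    by (intro C_on_SucI[where f' = "\<lambda>x v. v"]) (auto simp: C_on_const intro: derivative_intros)
qed (simp add: continuous_on_id)

lemma C_on_linear: "open S \<Longrightarrow> bounded_linear h \<Longrightarrow> C_on k S h"
  using C_on_bounded_linear[OF _ _ C_on_id] .

lemma C_on_add: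
  assumes "open S" "C_on k S f" "C_on k S g"
  shows "C_on k S (\<lambda>x. f x + g x)"
  using assms(2,3)
proof (induction k arbitrary: f g)
  case 0
  then show ?case by (simp add: continuous_on_add)
next
  case (Suc k)
  show ?case
    by (rule C_on_SucI[OF \<open>open S\<close>,
          where f' = "\<lambda>x v. fderiv f x v + fderiv g x v"])
      (use C_on_SucD[OF \<open>open S\<close> Suc.prems(1)] C_on_SucD[OF \<open>open S\<close> Suc.prems(2)] Suc.IH
        has_derivative_add in auto)
qed

lemma C_on_minus: "open S \<Longrightarrow> C_on k S f \<Longrightarrow> C_on k S (\<lambda>x. - f x)"
  by (rule C_on_bounded_linear[OF _ bounded_linear_minus[OF bounded_linear_ident]])

lemma C_on_diff: "open S \<Longrightarrow> C_on k S f \<Longrightarrow> C_on k S g \<Longrightarrow> C_on k S (\<lambda>x. f x - g x)"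
  using C_on_add[OF _ _ C_on_minus, of S k f g] by simp

lemma C_on_sum: "open S \<Longrightarrow> (\<And>i. i \<in> I \<Longrightarrow> C_on k S (f i)) \<Longrightarrow> C_on k S (\<lambda>x. \<Sum>i\<in>I. f i x)"
  by (induction I rule: infinite_finite_induct) (auto simp: C_on_const C_on_add)

lemma C_on_bounded_bilinear:
  assumes "open S" "bounded_bilinear h" "C_on k S f" "C_on k S g"
  shows "C_on k S (\<lambda>x. h (f x) (g x))"
  using assms(3,4)
proof (induction k arbitrary: f g)
  case 0
  then show ?case using bounded_bilinear.continuous_on[OF assms(2)] by simp
next
  case (Suc k)
  note f = C_on_SucD[OF \<open>open S\<close> Suc.prems(1)] and g = C_on_SucD[OF \<open>open S\<close> Suc.prems(2)]
  show ?case
    by (rule C_on_SucI[OF \<open>open S\<close>, where f' = "\<lambda>x v. h (f x) (fderiv g x v)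
          + h (fderiv f x v) (g x)"])
      (use bounded_bilinear.FDERIV[OF assms(2) f(1) g(1)] Suc.IH f g C_on_lower[OF Suc.prems(1)]
        C_on_lower[OF Suc.prems(2)] in \<open>auto intro!: C_on_add[OF \<open>open S\<close>]\<close>)
qed

lemmas C_on_mult = C_on_bounded_bilinear[OF _ bounded_bilinear_mult]
  and C_on_scaleR = C_on_bounded_bilinear[OF _ bounded_bilinear_scaleR]
  and C_on_inner = C_on_bounded_bilinear[OF _ bounded_bilinear_inner]

lemma C_on_prod:
  fixes f :: "'i \<Rightarrow> 'a::euclidean_space \<Rightarrow> real"
  shows "open S \<Longrightarrow> (\<And>i. i \<in> I \<Longrightarrow> C_on k S (f i)) \<Longrightarrow> C_on k S (\<lambda>x. \<Prod>i\<in>I. f i x)"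
  by (induction I rule: infinite_finite_induct) (auto simp: C_on_const C_on_mult)

lemma has_derivative_Basis_sum:
  assumes "(f has_derivative f') (at x)"
  shows "f' v = (\<Sum>b\<in>Basis. (v \<bullet> b) *\<^sub>R f' b)"
proof -
  interpret bounded_linear f' using assms by (rule has_derivative_bounded_linear)
  have "f' v = f' (\<Sum>b\<in>Basis. (v \<bullet> b) *\<^sub>R b)" by (simp add: euclidean_representation)
  also have "\<dots> = (\<Sum>b\<in>Basis. (v \<bullet> b) *\<^sub>R f' b)" by (simp add: sum scaleR)
  finally show ?thesis .
qed

lemma C_on_compose:
  fixes f :: "'b::euclidean_space \<Rightarrow> 'c::real_normed_vector" and \<psi> :: "'a::euclidean_space \<Rightarrow> 'b"
  assumes "open S" "open T" "\<psi> ` S \<subseteq> T" "C_on k T f" "C_on k S \<psi>"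
  shows "C_on k S (\<lambda>x. f (\<psi> x))"
  using assms(4,5)
proof (induction k arbitrary: f)
  case 0
  then show ?case using continuous_on_compose2[of T f S \<psi>] assms(3) by simp
next
  case (Suc k)
  note f = C_on_SucD[OF \<open>open T\<close> Suc.prems(1)] and p = C_on_SucD[OF \<open>open S\<close> Suc.prems(2)]
  show ?case
  proof (rule C_on_SucI[OF \<open>open S\<close>,
      where f' = "\<lambda>x v. fderiv f (\<psi> x) (fderiv \<psi> x v)"])
    fix x assume "x \<in> S"
    then show "((\<lambda>x. f (\<psi> x)) has_derivative
        (\<lambda>v. fderiv f (\<psi> x) (fderiv \<psi> x v))) (at x)"
      using has_derivative_compose[OF p(1) f(1)] assms(3) by auto
  next
    fix v :: 'a assume v: "v \<in> Basis"
    \<comment> \<open>The chain rule applies a varying linear map to a varying vector, which the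
      induction hypothesis does not cover; expanding the vector in the basis leaves products of
      functions that it does cover.\<close>
    have "C_on k S (\<lambda>x. \<Sum>b\<in>Basis. (fderiv \<psi> x v \<bullet> b) *\<^sub>R
        fderiv f (\<psi> x) b)"
      using p(2)[OF v] f(2) C_on_lower[OF Suc.prems(2)] Suc.IH
      by (intro C_on_sum[OF \<open>open S\<close>] C_on_scaleR[OF \<open>open S\<close>] C_on_inner[OF \<open>open S\<close>] C_on_const) auto
    then show "C_on k S (\<lambda>x. fderiv f (\<psi> x) (fderiv \<psi> x v))"
      by (rule C_on_cong[OF \<open>open S\<close>, rotated])
        (use has_derivative_Basis_sum[OF f(1)] assms(3) in force)
  qed
qed

lemma C_on_subset: "C_on k S f \<Longrightarrow> T \<subseteq> S \<Longrightarrow> C_on k T f"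
  by (induction k arbitrary: f) (auto intro: continuous_on_subset differentiable_on_subset)

lemma C_on_local:
  assumes "open S" "\<And>x. x \<in> S \<Longrightarrow> \<exists>T. open T \<and> x \<in> T \<and> C_on k T f"
  shows "C_on k S f"
  using assms(2)
proof (induction k arbitrary: f)
  case 0
  then have "\<forall>x\<in>S. isCont f x"
    using continuous_on_eq_continuous_at by fastforce
  then show ?case by (simp add: continuous_at_imp_continuous_on)
next
  case (Suc k)
  have "f differentiable at x" if x: "x \<in> S" for x
    using Suc.prems[OF x] by (auto simp: differentiable_on_eq_differentiable_at)
  moreover have "C_on k S (\<lambda>x. fderiv f x b)" if "b \<in> Basis" for b
    using Suc.IH[of "\<lambda>x. fderiv f x b"] Suc.prems that by fastforce
  ultimately show ?case using \<open>open S\<close> by (simp add: differentiable_on_eq_differentiable_at)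
qed

section \<open>Reciprocals, square roots, determinants and matrix inverses\<close>

lemma C_on_inverse: "C_on k (- {0}) (inverse :: real \<Rightarrow> real)"
proof (induction k)
  case 0
  show ?case by (auto intro!: continuous_intros)
next
  case (Suc k)
  have o: "open (- {0::real})" by auto
  show ?case
    by (rule C_on_SucI[OF o, where f' = "\<lambda>x h. - (inverse x * h * inverse x)"])
      (use Suc in \<open>auto intro!: C_on_minus C_on_mult C_on_const has_derivative_inverse' simp: o\<close>)
qed

text \<open>An indefinite metric may have a negative determinant, hence the absolute value. The
  derivative is written with \<open>sqrt \<bar>x\<bar>\<close> and \<open>inverse x\<close> for both
  signs of \<open>x\<close>, so that the induction in \<open>C_on_sqrt_abs\<close> closes
  up.\<close>

lemma DERIV_sqrt_abs:
  fixes x :: real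
  assumes "x \<noteq> 0"
  shows "((\<lambda>x. sqrt \<bar>x\<bar>) has_field_derivative sqrt \<bar>x\<bar> * inverse x / 2) (at x)"
proof (cases "x > 0")
  case True
  have "(sqrt has_field_derivative inverse (sqrt x) / 2) (at x)"
    using DERIV_real_sqrt[OF True] .
  then have "((\<lambda>x. sqrt \<bar>x\<bar>) has_field_derivative inverse (sqrt x) / 2) (at x)"
    by (rule has_field_derivative_transform_within_open[where S = "{0<..}"]) (use True in auto)
  moreover have "inverse (sqrt x) = sqrt x * inverse x"
    using True by (simp add: field_simps)
  ultimately show ?thesis using True by simp
next
  case False
  then have neg: "- x > 0" using assms by simp
  have "((\<lambda>x. sqrt (- x)) has_field_derivative inverse (sqrt (- x)) / 2 * (- 1)) (at x)"
    using DERIV_real_sqrt[OF neg] by (intro DERIV_chain2[where f = sqrt]) (auto intro!: derivative_eq_intros)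
  then have "((\<lambda>x. sqrt \<bar>x\<bar>) has_field_derivative inverse (sqrt (- x)) / 2 * (- 1)) (at x)"
    by (rule has_field_derivative_transform_within_open[where S = "{..<0}"])
      (use neg in auto)
  moreover have "inverse (sqrt (- x)) = - (sqrt (- x) * inverse x)"
    using real_div_sqrt[of "- x"] neg by (simp add: field_simps)
  ultimately show ?thesis using neg by simp
qed

lemma C_on_sqrt_abs: "C_on k (- {0}) (\<lambda>x::real. sqrt \<bar>x\<bar>)"
proof (induction k)
  case 0
  show ?case by (auto intro!: continuous_intros)
next
  case (Suc k)
  have o: "open (- {0::real})" by auto
  show ?case
  proof (rule C_on_SucI[OF o])
    show "((\<lambda>x. sqrt \<bar>x\<bar>) has_derivative (*) (sqrt \<bar>x\<bar> * inverse x / 2)) (at x)" if "x \<in> - {0}" for x :: real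
      using DERIV_sqrt_abs[of x] that by (simp add: has_field_derivative_def)
    show "C_on k (- {0}) (\<lambda>x. sqrt \<bar>x\<bar> * inverse x / 2 * b)" for b :: real
      by (intro C_on_mult C_on_const Suc C_on_inverse o
          C_on_bounded_linear[OF o bounded_linear_divide])
  qed
qed

lemma C_on_vec_nth: "open S \<Longrightarrow> C_on k S f \<Longrightarrow> C_on k S (\<lambda>x. f x $ i)"
  by (rule C_on_bounded_linear[OF _ bounded_linear_vec_nth])

lemma vec_lambda_sum: "(\<chi> i. g i) = (\<Sum>i\<in>UNIV. (\<chi> j. if j = i then g i else 0))"
  for g :: "'n::finite \<Rightarrow> 'b::real_normed_vector"
  by (simp add: vec_eq_iff if_distrib cong: if_cong)

lemma bounded_linear_vec_single:
  "bounded_linear (\<lambda>r::'b::real_normed_vector. (\<chi> j::'n::finite. if j = i then r else 0))"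
proof (rule bounded_linear_intro[where K = 1])
  fix x :: 'b
  have "norm (\<chi> j::'n. if j = i then x else 0) \<le> (\<Sum>j\<in>UNIV. norm ((\<chi> j::'n. if j = i then x else 0) $ j))"
    unfolding norm_vec_def by (rule L2_set_le_sum) simp
  also have "\<dots> = norm x"
    by (simp add: if_distrib cong: if_cong)
  finally show "norm (\<chi> j::'n. if j = i then x else 0) \<le> norm x * 1" by simp
qed (auto simp: vec_eq_iff)

text \<open>A vector is the sum of its coordinates, each inserted by the map of
  \<open>bounded_linear_vec_single\<close>, so closure under sums and bounded linear maps replaces a
  new induction.\<close>

lemma C_on_vec_lambda:
  fixes f :: "'a::euclidean_space \<Rightarrow> 'n::finite \<Rightarrow> 'b::real_normed_vector"
  assumes "open S" "\<And>i. C_on k S (\<lambda>x. f x i)"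
  shows "C_on k S (\<lambda>x. \<chi> i. f x i)"
proof -
  have "C_on k S (\<lambda>x. \<Sum>i\<in>UNIV. (\<chi> j::'n. if j = i then f x i else 0))"
    by (intro C_on_sum C_on_bounded_linear[OF _ bounded_linear_vec_single] assms)
  then show ?thesis by (subst vec_lambda_sum)
qed

lemma C_on_det:
  fixes f :: "'a::euclidean_space \<Rightarrow> real^'n::finite^'n"
  assumes "open S" "C_on k S f"
  shows "C_on k S (\<lambda>x. det (f x))"
  unfolding det_def using assms
  by (intro C_on_sum C_on_mult C_on_const C_on_prod C_on_vec_nth)

lemma matrix_inv_works:
  fixes A :: "real^'n::finite^'n"
  assumes "det A \<noteq> 0"
  shows "A ** matrix_inv A = mat 1" "matrix_inv A ** A = mat 1"
proof -
  have "\<exists>A'. A ** A' = mat 1 \<and> A' ** A = mat 1"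
    using assms invertible_det_nz[of A] unfolding invertible_def by blast
  then show "A ** matrix_inv A = mat 1" "matrix_inv A ** A = mat 1"
    unfolding matrix_inv_def by (auto dest!: someI_ex)
qed

text \<open>Cramer's rule turns the entries of the inverse into quotients of determinants, whose
  differentiability is known.\<close>

lemma matrix_inv_cramer:
  fixes A :: "real^'n::finite^'n"
  assumes "det A \<noteq> 0"
  shows "matrix_inv A = (\<chi> k j. det (\<chi> a b. if b = k then axis j 1 $ a else A $ a $ b) / det A)"
proof -
  have "A *v (matrix_inv A *v axis j 1) = axis j 1" for j
    by (simp add: matrix_vector_mul_assoc matrix_inv_works[OF assms])
  then have "matrix_inv A *v axis j 1 = (\<chi> k. det (\<chi> a b. if b = k then axis j 1 $ a else A $ a $ b) / det A)" for j
    using cramer[OF assms] by blast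
  moreover have "matrix_inv A $ k $ j = (matrix_inv A *v axis j 1) $ k" for k j
    by (simp add: matrix_vector_mult_basis column_def)
  ultimately show ?thesis by (simp add: vec_eq_iff)
qed

lemma C_on_matrix_inv:
  fixes f :: "'a::euclidean_space \<Rightarrow> real^'n::finite^'n"
  assumes "open S" "C_on k S f" "\<And>x. x \<in> S \<Longrightarrow> det (f x) \<noteq> 0"
  shows "C_on k S (\<lambda>x. matrix_inv (f x))"
proof -
  have i: "C_on k S (\<lambda>x. inverse (det (f x)))"
    by (rule C_on_compose[where f = inverse and T = "- {0}"])
      (use assms C_on_det[OF assms(1,2)] C_on_inverse in auto)
  have d: "C_on k S (\<lambda>x. if b = i then c else f x $ a $ b)" for a b i c
    using assms(1,2) by (cases "b = i") (auto intro!: C_on_const C_on_vec_nth)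
  have "C_on k S (\<lambda>x. \<chi> l j. det (\<chi> a b. if b = l then axis j 1 $ a else f x $ a $ b) * inverse (det (f x)))"
    by (intro C_on_vec_lambda C_on_mult C_on_det assms(1) i d)
  then show ?thesis
    by (rule C_on_cong[OF \<open>open S\<close>, rotated]) (simp add: matrix_inv_cramer assms(3) divide_inverse)
qed

section \<open>Symmetry of mixed partial derivatives\<close>

text \<open>Schwarz's theorem. The second difference over a small square does not see the order of
  the two directions, while \<open>key\<close> expresses it by either mixed derivative at some
  nearby point; continuity of both derivatives lets the square shrink to \<open>x\<close>.\<close>

lemma C_on_2_second_derivative:
  fixes f :: "'a::euclidean_space \<Rightarrow> real"
  assumes S: "open S" and f: "C_on 2 S f" and x: "x \<in> S" and b: "b \<in> Basis" and c: "c \<in> Basis"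
  shows "fderiv (\<lambda>y. fderiv f y b) x c
       = fderiv (\<lambda>y. fderiv f y c) x b"
proof -
  define D where "D v w y = fderiv (\<lambda>z. fderiv f z v) y w" for v w y
  have f1: "C_on (Suc 1) S f" using f by (simp add: numeral_2_eq_2)
  note d1 = C_on_SucD[OF S f1]
  have d2: "((\<lambda>z. fderiv f z v) has_derivative (\<lambda>w. D v w y)) (at y)"
    if "v \<in> Basis" "y \<in> S" for v y
    using C_on_SucD(1)[OF S, of 0, OF _ that(2)] d1(2)[OF that(1)] unfolding D_def by auto
  have contD: "continuous_on S (D v w)" if "v \<in> Basis" "w \<in> Basis" for v w
    using d1(2)[OF that(1)] that(2) unfolding D_def by simp
  text \<open>The mean value theorem, applied twice to the second difference along \<open>v\<close> and \<open>w\<close>.\<close>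
  have key: "\<exists>y. norm (y - x) \<le> 2 * h \<and>
      f (x + h *\<^sub>R v + h *\<^sub>R w) - f (x + h *\<^sub>R v) - f (x + h *\<^sub>R w) + f x = h * h * D v w y"
    if h: "h > 0" and hS: "cball x (2 * h) \<subseteq> S" and v: "v \<in> Basis" and w: "w \<in> Basis" for h v w
  proof -
    have nin: "x + s *\<^sub>R v + t *\<^sub>R w \<in> S" "norm (s *\<^sub>R v + t *\<^sub>R w) \<le> 2 * h"
      if "0 \<le> s" "s \<le> h" "0 \<le> t" "t \<le> h" for s t
    proof -
      have "norm (s *\<^sub>R v + t *\<^sub>R w) \<le> s + t"
        using norm_triangle_ineq[of "s *\<^sub>R v" "t *\<^sub>R w"] that v w by simp
      then show "norm (s *\<^sub>R v + t *\<^sub>R w) \<le> 2 * h" using that by simp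
      then have "x + s *\<^sub>R v + t *\<^sub>R w \<in> cball x (2 * h)"
        by (metis add.assoc add_diff_cancel_left' dist_norm mem_cball dist_commute)
      then show "x + s *\<^sub>R v + t *\<^sub>R w \<in> S" using hS by blast
    qed
    define u where "u s = f (x + s *\<^sub>R v + h *\<^sub>R w) - f (x + s *\<^sub>R v)" for s
    define u' where "u' s = fderiv f (x + s *\<^sub>R v + h *\<^sub>R w) v
        - fderiv f (x + s *\<^sub>R v) v" for s
    have "(u has_derivative (\<lambda>r. r * u' s)) (at s)" if "0 \<le> s" "s \<le> h" for s
    proof -
      note d1(1)[OF nin(1)[OF that, of h]] d1(1)[OF nin(1)[OF that, of 0]]
      then have *: "(f has_derivative fderiv f (x + s *\<^sub>R v + h *\<^sub>R w)) (at (x + s *\<^sub>R v + h *\<^sub>R w))"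
        "(f has_derivative fderiv f (x + s *\<^sub>R v)) (at (x + s *\<^sub>R v))"
        using h by auto
      have "((\<lambda>s. x + s *\<^sub>R v + h *\<^sub>R w) has_derivative (\<lambda>r. r *\<^sub>R v)) (at s)"
        "((\<lambda>s. x + s *\<^sub>R v) has_derivative (\<lambda>r. r *\<^sub>R v)) (at s)"
        by (auto intro!: derivative_eq_intros)
      note c = has_derivative_compose[OF this(1), of f] has_derivative_compose[OF this(2), of f]
      have "(u has_derivative (\<lambda>r. fderiv f (x + s *\<^sub>R v + h *\<^sub>R w) (r *\<^sub>R v)
          - fderiv f (x + s *\<^sub>R v) (r *\<^sub>R v))) (at s)"
        unfolding u_def
        by (intro has_derivative_diff c *)
      then show ?thesis
        by (rule has_derivative_eq_rhs)
          (simp add: u'_def linear_cmul[OF has_derivative_linear[OF *(1)]]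
            linear_cmul[OF has_derivative_linear[OF *(2)]] right_diff_distrib)
    qed
    then obtain s where s: "0 < s" "s < h" "u h - u 0 = h * u' s"
      using mvt_simple[OF h, of u "\<lambda>s r. r * u' s"] has_derivative_at_withinI by force
    define q where "q t = fderiv f (x + s *\<^sub>R v + t *\<^sub>R w) v" for t
    have "(q has_derivative (\<lambda>r. r * D v w (x + s *\<^sub>R v + t *\<^sub>R w))) (at t)" if "0 \<le> t" "t \<le> h" for t
    proof -
      have *: "((\<lambda>z. fderiv f z v) has_derivative (\<lambda>w'. D v w' (x + s *\<^sub>R v + t *\<^sub>R w)))
          (at (x + s *\<^sub>R v + t *\<^sub>R w))"
        using d2[OF v nin(1)] s that by auto
      have "((\<lambda>t. x + s *\<^sub>R v + t *\<^sub>R w) has_derivative (\<lambda>r. r *\<^sub>R w)) (at t)"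
        by (auto intro!: derivative_eq_intros)
      from has_derivative_compose[OF this *]
      have "(q has_derivative (\<lambda>r. D v (r *\<^sub>R w) (x + s *\<^sub>R v + t *\<^sub>R w))) (at t)"
        unfolding q_def .
      then show ?thesis
        by (rule has_derivative_eq_rhs) (simp add: linear_cmul[OF has_derivative_linear[OF *]])
    qed
    then obtain t where t: "0 < t" "t < h" "q h - q 0 = h * D v w (x + s *\<^sub>R v + t *\<^sub>R w)"
      using mvt_simple[OF h, of q "\<lambda>t r. r * D v w (x + s *\<^sub>R v + t *\<^sub>R w)"] has_derivative_at_withinI
      by force
    have "u' s = q h - q 0" by (simp add: u'_def q_def)
    then have "u h - u 0 = h * h * D v w (x + s *\<^sub>R v + t *\<^sub>R w)" using s(3) t(3) by simp
    moreover have "u h - u 0 = f (x + h *\<^sub>R v + h *\<^sub>R w) - f (x + h *\<^sub>R v) - f (x + h *\<^sub>R w) + f x"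
      by (simp add: u_def)
    ultimately show ?thesis using nin(2)[of s t] s t
      by (intro exI[of _ "x + s *\<^sub>R v + t *\<^sub>R w"]) (simp add: add.assoc)
  qed
  \<comment> \<open>The squares have side \<open>e/2\<close>, since \<open>key\<close> with side
    \<open>h\<close> controls the distance from \<open>x\<close> only by
    \<open>2 * h\<close>.\<close>
  have close: "\<exists>y z. norm (y - x) \<le> e \<and> norm (z - x) \<le> e \<and> D b c y = D c b z"
    if e: "e > 0" "cball x e \<subseteq> S" for e
  proof -
    obtain y where y: "norm (y - x) \<le> e"
      "f (x + (e/2) *\<^sub>R b + (e/2) *\<^sub>R c) - f (x + (e/2) *\<^sub>R b) - f (x + (e/2) *\<^sub>R c) + f x = (e/2) * (e/2) * D b c y"
      using key[of "e/2" b c] e b c by auto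
    obtain z where z: "norm (z - x) \<le> e"
      "f (x + (e/2) *\<^sub>R c + (e/2) *\<^sub>R b) - f (x + (e/2) *\<^sub>R c) - f (x + (e/2) *\<^sub>R b) + f x = (e/2) * (e/2) * D c b z"
      using key[of "e/2" c b] e b c by auto
    have "x + (e/2) *\<^sub>R b + (e/2) *\<^sub>R c = x + (e/2) *\<^sub>R c + (e/2) *\<^sub>R b" by simp
    then have "(e/2) * (e/2) * D b c y = (e/2) * (e/2) * D c b z"
      using y(2) z(2) by (simp only: diff_right_commute)
    then show ?thesis using y(1) z(1) e by auto
  qed
  have "\<bar>D b c x - D c b x\<bar> \<le> e" if e: "e > 0" for e
  proof -
    obtain r where r: "r > 0" "cball x r \<subseteq> S" using S x open_contains_cball by blast
    obtain d1 where d1: "d1 > 0" "\<And>y. y \<in> S \<Longrightarrow> dist y x < d1 \<Longrightarrow> dist (D b c y) (D b c x) < e / 2"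
      using contD[OF b c] x e unfolding continuous_on_iff by (meson half_gt_zero)
    obtain d2 where d2: "d2 > 0" "\<And>y. y \<in> S \<Longrightarrow> dist y x < d2 \<Longrightarrow> dist (D c b y) (D c b x) < e / 2"
      using contD[OF c b] x e unfolding continuous_on_iff by (meson half_gt_zero)
    define s where "s = min r (min d1 d2 / 2)"
    have s: "s > 0" "cball x s \<subseteq> S" "s < d1" "s < d2" using r d1(1) d2(1) unfolding s_def by auto
    obtain y z where yz: "norm (y - x) \<le> s" "norm (z - x) \<le> s" "D b c y = D c b z"
      using close[OF s(1,2)] by blast
    then have yS: "y \<in> S" and zS: "z \<in> S" using s(2) by (auto simp: dist_norm norm_minus_commute)
    have "dist y x < d1" "dist z x < d2" using yz s by (auto simp: dist_norm)
    then have "dist (D b c y) (D b c x) < e / 2" "dist (D c b z) (D c b x) < e / 2"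
      using d1(2)[OF yS] d2(2)[OF zS] by auto
    then show ?thesis using yz(3) unfolding dist_real_def by linarith
  qed
  then have "\<bar>D b c x - D c b x\<bar> \<le> 0" by (rule dense_ge)
  then have "D b c x = D c b x" by simp
  then show ?thesis unfolding D_def .
qed

lemma C_on_2_second_derivative_vec:
  fixes f :: "'a::euclidean_space \<Rightarrow> 'b::euclidean_space"
  assumes S: "open S" and f: "C_on 2 S f" and x: "x \<in> S" and b: "b \<in> Basis" and c: "c \<in> Basis"
  shows "fderiv (\<lambda>y. fderiv f y b) x c
       = fderiv (\<lambda>y. fderiv f y c) x b"
proof (rule euclidean_eqI)
  fix e :: 'b assume "e \<in> Basis"
  have f1: "C_on (Suc 1) S f" using f by (simp add: numeral_2_eq_2)
  note d1 = C_on_SucD[OF S f1]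
  have lin: "bounded_linear (\<lambda>v. v \<bullet> e)" by (rule bounded_linear_inner_left)
  have fd1: "fderiv (\<lambda>z. f z \<bullet> e) y v = fderiv f y v \<bullet> e" if "y \<in> S" for y v
    using frechet_derivative_at[OF bounded_linear.has_derivative[OF lin d1(1)[OF that]]] by metis
  have fd2: "fderiv (\<lambda>y. fderiv (\<lambda>z. f z \<bullet> e) y v) x w
      = fderiv (\<lambda>y. fderiv f y v) x w \<bullet> e" if v: "v \<in> Basis" for v w
  proof -
    have "fderiv (\<lambda>y. fderiv (\<lambda>z. f z \<bullet> e) y v) x
        = fderiv (\<lambda>y. fderiv f y v \<bullet> e) x"
      by (rule frechet_derivative_cong[OF S x]) (rule fd1)
    moreover have "((\<lambda>y. fderiv f y v) has_derivative
        fderiv (\<lambda>y. fderiv f y v) x) (at x)"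
      using C_on_SucD(1)[OF S, of 0, OF _ x] d1(2)[OF v] by simp
    ultimately show ?thesis
      using frechet_derivative_at[OF bounded_linear.has_derivative[OF lin]] by metis
  qed
  have "C_on 2 S (\<lambda>y. f y \<bullet> e)"
    by (rule C_on_bounded_linear[OF S lin f])
  from C_on_2_second_derivative[OF S this x b c] show
    "fderiv (\<lambda>y. fderiv f y b) x c \<bullet> e
       = fderiv (\<lambda>y. fderiv f y c) x b \<bullet> e"
    by (simp add: fd2 b c)
qed

subsection \<open>Partial derivatives\<close>

lemma pdI: "(f has_derivative f') (at x) \<Longrightarrow> pd i f x = f' (axis i 1)"
  unfolding pd_def using frechet_derivative_at by metis

lemma pd_cong:
  assumes "open S" "x \<in> S" "\<And>y. y \<in> S \<Longrightarrow> f y = g y"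
  shows "pd i f x = pd i g x"
  unfolding pd_def using frechet_derivative_cong[OF assms] by simp

lemma pd_const [simp]: "pd i (\<lambda>x. c) x = 0"
  unfolding pd_def by (simp add: frechet_derivative_const)

lemma pd_bounded_linear:
  "bounded_linear h \<Longrightarrow> f differentiable (at x) \<Longrightarrow> pd i (\<lambda>x. h (f x)) x = h (pd i f x)"
  using bounded_linear.has_derivative[of h f _ "at x"] pdI
  unfolding pd_def frechet_derivative_works by (metis pd_def)

lemma pd_bounded_bilinear:
  assumes "bounded_bilinear h" "f differentiable (at x)" "g differentiable (at x)"
  shows "pd i (\<lambda>x. h (f x) (g x)) x = h (f x) (pd i g x) + h (pd i f x) (g x)"
  using pdI[OF bounded_bilinear.FDERIV[OF assms(1)]] assms(2,3)
  unfolding frechet_derivative_works pd_def by blast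

lemma pd_add:
  "f differentiable (at x) \<Longrightarrow> g differentiable (at x) \<Longrightarrow> pd i (\<lambda>x. f x + g x) x = pd i f x + pd i g x"
  using pdI[OF has_derivative_add] unfolding frechet_derivative_works pd_def by blast

lemma pd_diff:
  "f differentiable (at x) \<Longrightarrow> g differentiable (at x) \<Longrightarrow> pd i (\<lambda>x. f x - g x) x = pd i f x - pd i g x"
  using pdI[OF has_derivative_diff] unfolding frechet_derivative_works pd_def by blast

lemma pd_sum:
  "(\<And>j. j \<in> I \<Longrightarrow> f j differentiable (at x)) \<Longrightarrow> pd i (\<lambda>x. \<Sum>j\<in>I. f j x) x = (\<Sum>j\<in>I. pd i (f j) x)"
  using pdI[OF has_derivative_sum, of I f "\<lambda>j. fderiv (f j) x" x i]
  unfolding frechet_derivative_works pd_def by blast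

lemma pd_vec_nth:
  "f differentiable (at x) \<Longrightarrow> pd i (\<lambda>x. f x $ k) x = pd i f x $ k"
  by (rule pd_bounded_linear[OF bounded_linear_vec_nth])

lemma pd_vec_nth2:
  "f differentiable (at x) \<Longrightarrow> pd i (\<lambda>x. f x $ k $ l) x = pd i f x $ k $ l"
  by (rule pd_bounded_linear[OF bounded_linear_compose[OF bounded_linear_vec_nth bounded_linear_vec_nth]])

lemma frechet_derivative_pd_sum:
  assumes "f differentiable (at x)"
  shows "fderiv f x v = (\<Sum>i\<in>UNIV. v $ i *\<^sub>R pd i f x)"
proof -
  have "fderiv f x v
      = fderiv f x (\<Sum>i\<in>UNIV. v $ i *\<^sub>R axis i 1)"
    by (simp add: basis_expansion scalar_mult_eq_scaleR[symmetric])
  also have "\<dots> = (\<Sum>i\<in>UNIV. v $ i *\<^sub>R fderiv f x (axis i 1))"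
    using assms unfolding frechet_derivative_works
    by (simp add: linear_sum[OF has_derivative_linear] linear_cmul[OF has_derivative_linear])
  finally show ?thesis by (simp add: pd_def)
qed

lemma C_on_differentiable: "open S \<Longrightarrow> C_on (Suc k) S f \<Longrightarrow> x \<in> S \<Longrightarrow> f differentiable (at x)"
  by (auto simp: differentiable_on_eq_differentiable_at)

lemma C_on_pd: "C_on (Suc k) S f \<Longrightarrow> C_on k S (pd i f)"
  by (simp add: pd_def[abs_def])

lemma pd_commute:
  fixes f :: "real^'n::finite \<Rightarrow> 'b::euclidean_space"
  assumes "open S" "C_on 2 S f" "x \<in> S"
  shows "pd i (pd j f) x = pd j (pd i f) x"
  using C_on_2_second_derivative_vec[OF assms, of "axis j 1" "axis i 1"]
  by (simp add: pd_def[abs_def])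

subsection \<open>Smooth maps\<close>

lemma smooth_onD: "smooth_on S f \<Longrightarrow> C_on k S f"
  by (simp add: smooth_on_def)

lemma smooth_on_pd: "smooth_on S f \<Longrightarrow> smooth_on S (pd i f)"
  unfolding smooth_on_def using C_on_pd by blast

lemma smooth_on_differentiable: "smooth_on S f \<Longrightarrow> open S \<Longrightarrow> x \<in> S \<Longrightarrow> f differentiable (at x)"
  using C_on_differentiable smooth_onD by blast

lemma smooth_on_cong: "open S \<Longrightarrow> (\<And>x. x \<in> S \<Longrightarrow> f x = g x) \<Longrightarrow> smooth_on S f \<Longrightarrow> smooth_on S g"
  unfolding smooth_on_def using C_on_cong by blast

lemma smooth_on_pd_commute:
  fixes f :: "real^'n::finite \<Rightarrow> 'b::euclidean_space"
  shows "open S \<Longrightarrow> smooth_on S f \<Longrightarrow> x \<in> S \<Longrightarrow> pd i (pd j f) x = pd j (pd i f) x"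
  using pd_commute smooth_onD by blast

lemma smooth_on_const: "smooth_on S (\<lambda>x. c)"
  by (simp add: smooth_on_def C_on_const)

lemma smooth_on_bounded_linear:
  "open S \<Longrightarrow> bounded_linear h \<Longrightarrow> smooth_on S f \<Longrightarrow> smooth_on S (\<lambda>x. h (f x))"
  by (simp add: smooth_on_def C_on_bounded_linear)

lemma smooth_on_bounded_bilinear:
  "open S \<Longrightarrow> bounded_bilinear h \<Longrightarrow> smooth_on S f \<Longrightarrow> smooth_on S g \<Longrightarrow> smooth_on S (\<lambda>x. h (f x) (g x))"
  by (simp add: smooth_on_def C_on_bounded_bilinear)

lemma smooth_on_add: "open S \<Longrightarrow> smooth_on S f \<Longrightarrow> smooth_on S g \<Longrightarrow> smooth_on S (\<lambda>x. f x + g x)"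
  by (simp add: smooth_on_def C_on_add)

lemma smooth_on_diff: "open S \<Longrightarrow> smooth_on S f \<Longrightarrow> smooth_on S g \<Longrightarrow> smooth_on S (\<lambda>x. f x - g x)"
  by (simp add: smooth_on_def C_on_diff)

lemma smooth_on_sum:
  "open S \<Longrightarrow> (\<And>i. i \<in> I \<Longrightarrow> smooth_on S (f i)) \<Longrightarrow> smooth_on S (\<lambda>x. \<Sum>i\<in>I. f i x)"
  by (simp add: smooth_on_def C_on_sum)

lemma smooth_on_vec_nth: "open S \<Longrightarrow> smooth_on S f \<Longrightarrow> smooth_on S (\<lambda>x. f x $ i)"
  by (simp add: smooth_on_def C_on_vec_nth)

lemma smooth_on_vec_lambda:
  fixes f :: "'a::euclidean_space \<Rightarrow> 'n::finite \<Rightarrow> 'b::real_normed_vector"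
  shows "open S \<Longrightarrow> (\<And>i. smooth_on S (\<lambda>x. f x i)) \<Longrightarrow> smooth_on S (\<lambda>x. \<chi> i. f x i)"
  by (simp add: smooth_on_def C_on_vec_lambda)

lemma smooth_on_matrix_inv:
  fixes f :: "'a::euclidean_space \<Rightarrow> real^'n::finite^'n"
  shows "open S \<Longrightarrow> smooth_on S f \<Longrightarrow> (\<And>x. x \<in> S \<Longrightarrow> det (f x) \<noteq> 0) \<Longrightarrow> smooth_on S (\<lambda>x. matrix_inv (f x))"
  by (simp add: smooth_on_def C_on_matrix_inv)

subsection \<open>Matrix-valued functions\<close>

lemma bounded_bilinear_matrix_matrix_mult:
  "bounded_bilinear ((**) :: real^'n::finite^'m::finite \<Rightarrow> real^'p::finite^'n \<Rightarrow> real^'p^'m)"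
  unfolding bilinear_conv_bounded_bilinear[symmetric] bilinear_def
  by (auto intro!: linearI simp: matrix_matrix_mult_def vec_eq_iff algebra_simps sum.distrib sum_distrib_left)

lemma bounded_bilinear_matrix_vector_mult:
  "bounded_bilinear ((*v) :: real^'n::finite^'m::finite \<Rightarrow> real^'n \<Rightarrow> real^'m)"
  unfolding bilinear_conv_bounded_bilinear[symmetric] bilinear_def
  by (auto intro!: linearI simp: matrix_vector_mult_def vec_eq_iff algebra_simps sum.distrib sum_distrib_left)

interpretation mm: bounded_bilinear "(**) :: real^'n::finite^'m::finite \<Rightarrow> real^'p::finite^'n \<Rightarrow> real^'p^'m"
  by (rule bounded_bilinear_matrix_matrix_mult)

interpretation mv: bounded_bilinear "(*v) :: real^'n::finite^'m::finite \<Rightarrow> real^'n \<Rightarrow> real^'m"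
  by (rule bounded_bilinear_matrix_vector_mult)

lemma bounded_linear_transpose:
  "bounded_linear (transpose :: real^'n::finite^'m::finite \<Rightarrow> real^'m^'n)"
  unfolding linear_conv_bounded_linear[symmetric]
  by (auto intro!: linearI simp: transpose_def vec_eq_iff)

lemma bounded_linear_trace: "bounded_linear (trace :: real^'n::finite^'n \<Rightarrow> real)"
  unfolding linear_conv_bounded_linear[symmetric]
  by (auto intro!: linearI simp: trace_def sum.distrib sum_distrib_left)

lemmas matrix_ring_simps = mm.add_left mm.add_right mm.diff_left mm.diff_right mm.minus_left
  mm.minus_right matrix_mul_assoc mm.zero_left mm.zero_right mm.scaleR_left mm.scaleR_right

lemma transpose_nth [simp]: "transpose A $ i $ j = A $ j $ i"
  by (simp add: transpose_def)

lemma transpose_add: "transpose (A + B) = transpose A + transpose B"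
  and transpose_diff: "transpose (A - B) = transpose A - transpose B"
  and transpose_minus: "transpose (- A) = - transpose A"
  for A B :: "real^'n::finite^'m::finite"
  by (simp_all add: vec_eq_iff)

lemmas transpose_simps = transpose_add transpose_diff transpose_minus matrix_transpose_mul
  transpose_transpose

lemma mm_nth: "(A ** B) $ i $ j = (\<Sum>k\<in>UNIV. A $ i $ k * B $ k $ j)"
  by (simp add: matrix_matrix_mult_def)

lemma mv_nth: "(A *v v) $ i = (\<Sum>k\<in>UNIV. A $ i $ k * v $ k)"
  by (simp add: matrix_vector_mult_def)

lemma trace_mm_commute: "trace (A ** B) = trace (B ** A)" for A :: "real^'n::finite^'m::finite"
  unfolding trace_def mm_nth by (subst sum.swap) (simp add: mult.commute)

lemma trace_transpose: "trace (transpose A) = trace A"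
  by (simp add: trace_def)

lemma matrix_eq_columns: "(\<And>j. A *v axis j 1 = B *v axis j 1) \<Longrightarrow> A = B"
  for A :: "real^'n::finite^'m::finite"
  by (simp add: matrix_vector_mult_basis column_def vec_eq_iff)

section \<open>Semi-Riemannian geometry in a chart\<close>

definition gamma :: "(real^'n::finite \<Rightarrow> real^'n^'n) \<Rightarrow> 'n \<Rightarrow> real^'n \<Rightarrow> real^'n^'n" where
  "gamma g i x = (\<chi> k j. christoffel g x k i j)"

text \<open>\<open>gamma g i\<close> is the connection matrix of \<open>\<nabla>\<^bsub>\<partial>i\<^esub>\<close> and \<open>curv g i j\<close> the matrix of \<open>R(\<partial>\<^sub>i, \<partial>\<^sub>j)\<close>.\<close>

definition curv :: "(real^'n::finite \<Rightarrow> real^'n^'n) \<Rightarrow> 'n \<Rightarrow> 'n \<Rightarrow> real^'n \<Rightarrow> real^'n^'n" where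
  "curv g i j x = pd i (gamma g j) x - pd j (gamma g i) x
     + gamma g i x ** gamma g j x - gamma g j x ** gamma g i x"

section \<open>The Levi-Civita connection of a metric in one chart\<close>

text \<open>Christoffel symbols of the first kind: when \<open>P i\<close> is the partial derivative
  of the metric along the \<open>i\<close>-th coordinate, entry \<open>(l, j)\<close> is the symbol
  of \<open>i\<close> and \<open>j\<close> with lowered index \<open>l\<close>.\<close>

definition koszul :: "('n::finite \<Rightarrow> real^'n^'n) \<Rightarrow> 'n \<Rightarrow> real^'n^'n" where
  "koszul P i = (\<chi> l j. (P i $ j $ l + P j $ i $ l - P l $ i $ j) / 2)"

text \<open>Lowering the index gives \<open>L\<close>, symmetric in direction and column index, with
  each \<open>P i\<close> the sum of \<open>L i\<close> and its transpose; the usual alternating sum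
  over three index orders isolates \<open>L\<close>. Since \<open>B\<close> is arbitrary, this also
  identifies a connection pulled back from another chart.\<close>

lemma koszul_unique:
  fixes G :: "real^'n::finite^'n"
  assumes "transpose G = G" "\<And>i. P i = transpose (B i) ** G + G ** B i"
    "\<And>i j k. B i $ k $ j = B j $ k $ i"
  shows "G ** B i = koszul P i"
proof -
  define L where "L i l j = (G ** B i) $ l $ j" for i l j
  have L: "L i l j = L j l i" for i l j
    unfolding L_def mm_nth by (simp add: assms(3)[of i _ j])
  have "transpose (B i) ** G = transpose (G ** B i)" for i
    by (simp add: matrix_transpose_mul assms(1))
  then have P: "P i $ j $ l = L i l j + L i j l" for i j l
    unfolding assms(2)[of i] L_def by simp
  show ?thesis
    unfolding vec_eq_iff
  proof (intro allI)
    fix l j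
    show "(G ** B i) $ l $ j = koszul P i $ l $ j"
      using L[of i l j] L[of l i j] L[of l j i] L[of j i l] unfolding koszul_def
      by (simp add: P L_def[symmetric])
  qed
qed

locale semi_riemannian_chart =
  fixes S :: "(real^'n::finite) set" and g :: "real^'n \<Rightarrow> real^'n^'n"
  assumes open_S: "open S" and smooth_g: "smooth_on S g"
    and sym_g: "x \<in> S \<Longrightarrow> transpose (g x) = g x" and det_g: "x \<in> S \<Longrightarrow> det (g x) \<noteq> 0"
begin

abbreviation "ginv x \<equiv> matrix_inv (g x)"

lemma ginv: "x \<in> S \<Longrightarrow> g x ** ginv x = mat 1" "x \<in> S \<Longrightarrow> ginv x ** g x = mat 1"
  using matrix_inv_works det_g by auto

lemma sym_ginv: assumes "x \<in> S" shows "transpose (ginv x) = ginv x"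
proof -
  have "transpose (ginv x) ** g x = mat 1"
    using arg_cong[OF ginv(1)[OF assms], of transpose] by (simp add: matrix_transpose_mul sym_g assms)
  then have "transpose (ginv x) ** (g x ** ginv x) = ginv x"
    unfolding matrix_mul_assoc by simp
  then show ?thesis by (simp add: ginv assms)
qed

lemmas smooth_on_S = smooth_on_add[OF open_S] smooth_on_diff[OF open_S] smooth_on_sum[OF open_S] smooth_on_vec_nth[OF open_S]
  smooth_on_vec_lambda[OF open_S]
  smooth_on_bounded_bilinear[OF open_S bounded_bilinear_matrix_matrix_mult]
  smooth_on_bounded_bilinear[OF open_S bounded_bilinear_matrix_vector_mult]
  smooth_on_pd smooth_on_const smooth_g

lemma smooth_diff: "smooth_on S f \<Longrightarrow> x \<in> S \<Longrightarrow> f differentiable (at x)"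
  using smooth_on_differentiable open_S by blast

lemma smooth_ginv: "smooth_on S ginv"
  by (rule smooth_on_matrix_inv[OF open_S smooth_g det_g])

lemma gamma_koszul: "x \<in> S \<Longrightarrow> gamma g i x = ginv x ** koszul (\<lambda>i. pd i g x) i"
  by (simp add: gamma_def christoffel_def koszul_def vec_eq_iff mm_nth pd_vec_nth2
      smooth_diff[OF smooth_g] sum_divide_distrib)

lemma sym_pd_g: assumes x: "x \<in> S" shows "transpose (pd i g x) = pd i g x"
proof -
  have "pd i (\<lambda>y. transpose (g y)) x = pd i g x"
    by (rule pd_cong[OF open_S x]) (rule sym_g)
  then show ?thesis
    by (simp only: pd_bounded_linear[OF bounded_linear_transpose smooth_diff[OF smooth_g x]])
qed

lemma sym_pd_g_nth: assumes x: "x \<in> S" shows "pd i g x $ a $ b = pd i g x $ b $ a"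
proof -
  have "transpose (pd i g x) $ b $ a = pd i g x $ b $ a" by (simp only: sym_pd_g[OF x])
  then show ?thesis by simp
qed

text \<open>Torsion-freeness. Later exchanges of a direction with a column index of a connection
  matrix rest on it.\<close>

lemma gamma_sym:
  assumes x: "x \<in> S"
  shows "gamma g i x $ k $ j = gamma g j x $ k $ i"
proof -
  have "koszul (\<lambda>i. pd i g x) i $ a $ j = koszul (\<lambda>i. pd i g x) j $ a $ i" for a
    unfolding koszul_def using sym_pd_g_nth[OF x, of a i j] by simp
  then show ?thesis by (simp add: gamma_koszul x mm_nth)
qed

lemma g_gamma: "x \<in> S \<Longrightarrow> g x ** gamma g i x = koszul (\<lambda>i. pd i g x) i"
  by (simp add: gamma_koszul matrix_mul_assoc ginv)

text \<open>Metric compatibility, \<nabla>g = 0: two of the three Koszul terms cancel between the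
  matrix and its transpose.\<close>

lemma pd_g: assumes x: "x \<in> S" shows "pd i g x = transpose (gamma g i x) ** g x + g x ** gamma g i x"
proof -
  have "transpose (gamma g i x) ** g x = transpose (g x ** gamma g i x)"
    by (simp add: matrix_transpose_mul sym_g x)
  then have "(transpose (gamma g i x) ** g x + g x ** gamma g i x) $ a $ b
      = koszul (\<lambda>i. pd i g x) i $ b $ a + koszul (\<lambda>i. pd i g x) i $ a $ b" for a b
    by (simp add: g_gamma[OF x])
  also have "koszul (\<lambda>i. pd i g x) i $ b $ a + koszul (\<lambda>i. pd i g x) i $ a $ b = pd i g x $ a $ b" for a b
    by (simp add: koszul_def sym_pd_g_nth[OF x, of i b a] add_divide_distrib diff_divide_distrib)
  finally show ?thesis by (simp add: vec_eq_iff)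
qed

lemma gamma_unique:
  assumes "x \<in> S" "\<And>i. pd i g x = transpose (B i) ** g x + g x ** B i"
    "\<And>i j k. B i $ k $ j = B j $ k $ i"
  shows "B i = gamma g i x"
proof -
  have "g x ** B i = g x ** gamma g i x"
    using koszul_unique[OF sym_g[OF assms(1)] assms(2,3)] g_gamma[OF assms(1)] by simp
  then have "ginv x ** g x ** B i = ginv x ** g x ** gamma g i x"
    by (simp add: matrix_mul_assoc[symmetric])
  then show ?thesis by (simp add: ginv assms(1))
qed

lemma smooth_koszul: "smooth_on S (\<lambda>x. koszul (\<lambda>i. pd i g x) i)"
  unfolding koszul_def
  by (intro smooth_on_vec_lambda[OF open_S] smooth_on_bounded_linear[OF open_S bounded_linear_divide]
      smooth_on_add[OF open_S] smooth_on_diff[OF open_S] smooth_on_vec_nth[OF open_S] smooth_on_pd smooth_g)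

lemma smooth_gamma: "smooth_on S (gamma g i)"
  by (rule smooth_on_cong[OF open_S _ smooth_on_bounded_bilinear[OF open_S
          bounded_bilinear_matrix_matrix_mult smooth_ginv smooth_koszul]]) (simp add: gamma_koszul)

lemma smooth_curv: "smooth_on S (curv g i j)"
  unfolding curv_def[abs_def]
  by (intro smooth_on_S smooth_gamma)

lemma pd_mm:
  fixes A B :: "real^'n \<Rightarrow> real^'n^'n"
  shows "smooth_on S A \<Longrightarrow> smooth_on S B \<Longrightarrow> x \<in> S \<Longrightarrow>
    pd i (\<lambda>x. A x ** B x) x = A x ** pd i B x + pd i A x ** B x"
  by (intro pd_bounded_bilinear bounded_bilinear_matrix_matrix_mult smooth_diff)

lemma pd_mv:
  fixes A :: "real^'n \<Rightarrow> real^'n^'n"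
  shows "smooth_on S A \<Longrightarrow> smooth_on S v \<Longrightarrow> x \<in> S \<Longrightarrow>
    pd i (\<lambda>x. A x *v v x) x = A x *v pd i v x + pd i A x *v v x"
  by (intro pd_bounded_bilinear bounded_bilinear_matrix_vector_mult smooth_diff)

lemma pd_ginv:
  assumes x: "x \<in> S"
  shows "pd m ginv x = - (ginv x ** transpose (gamma g m x)) - gamma g m x ** ginv x"
proof -
  have "pd m (\<lambda>x. g x ** ginv x) x = pd m (\<lambda>x. mat 1) x"
    by (rule pd_cong[OF open_S x]) (simp add: ginv)
  then have "g x ** pd m ginv x = - (pd m g x ** ginv x)"
    using pd_mm[OF smooth_g smooth_ginv x] by (simp add: eq_neg_iff_add_eq_0)
  then have "ginv x ** (g x ** pd m ginv x) = - (ginv x ** (pd m g x ** ginv x))"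
    by (simp add: mm.minus_right)
  then have "pd m ginv x = - (ginv x ** (pd m g x ** ginv x))"
    by (simp add: matrix_mul_assoc ginv x)
  also have "\<dots> = - (ginv x ** transpose (gamma g m x) ** (g x ** ginv x))
      - (ginv x ** g x) ** gamma g m x ** ginv x"
    unfolding pd_g[OF x] by (simp add: matrix_ring_simps)
  finally show ?thesis by (simp add: ginv x)
qed

section \<open>Curvature identities\<close>

lemma pd_curv:
  assumes x: "x \<in> S"
  shows "pd m (curv g i j) x = pd m (pd i (gamma g j)) x - pd m (pd j (gamma g i)) x
    + (gamma g i x ** pd m (gamma g j) x + pd m (gamma g i) x ** gamma g j x)
    - (gamma g j x ** pd m (gamma g i) x + pd m (gamma g j) x ** gamma g i x)"
proof -
  note d = smooth_diff[OF _ x]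
  note s = smooth_gamma smooth_on_pd[OF smooth_gamma]
  have p: "smooth_on S (\<lambda>x. gamma g i x ** gamma g j x)" for i j by (intro smooth_on_S s)
  have q: "smooth_on S (\<lambda>x. pd i (gamma g j) x - pd j (gamma g i) x)" by (intro smooth_on_S s)
  have r: "smooth_on S (\<lambda>x. pd i (gamma g j) x - pd j (gamma g i) x + gamma g i x ** gamma g j x)"
    by (intro smooth_on_S s)
  have "pd m (curv g i j) x = pd m (\<lambda>x. pd i (gamma g j) x - pd j (gamma g i) x + gamma g i x ** gamma g j x) x
      - pd m (\<lambda>x. gamma g j x ** gamma g i x) x"
    unfolding curv_def[abs_def] by (intro pd_diff d r p)
  also have "pd m (\<lambda>x. pd i (gamma g j) x - pd j (gamma g i) x + gamma g i x ** gamma g j x) x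
      = pd m (\<lambda>x. pd i (gamma g j) x - pd j (gamma g i) x) x + pd m (\<lambda>x. gamma g i x ** gamma g j x) x"
    by (intro pd_add d q p)
  also have "pd m (\<lambda>x. pd i (gamma g j) x - pd j (gamma g i) x) x
      = pd m (pd i (gamma g j)) x - pd m (pd j (gamma g i)) x"
    by (intro pd_diff d s)
  finally show ?thesis by (simp only: pd_mm[OF s(1) s(1) x])
qed

text \<open>\<open>DR\<close> differentiates the curvature matrix covariantly but leaves the form
  indices \<open>i\<close> and \<open>j\<close> uncorrected: by torsion-freeness those corrections
  would cancel in the cyclic sum. What remains is settled by commuting partial derivatives and
  associativity of matrix products.\<close>

lemma second_bianchi_curv:
  fixes m i j
  assumes x: "x \<in> S"
  defines "DR \<equiv> \<lambda>m i j. pd m (curv g i j) x + gamma g m x ** curv g i j x - curv g i j x ** gamma g m x"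
  shows "DR m i j + DR i j m + DR j m i = 0"
proof -
  have c: "pd m (pd i (gamma g j)) x = pd i (pd m (gamma g j)) x"
    "pd i (pd j (gamma g m)) x = pd j (pd i (gamma g m)) x"
    "pd j (pd m (gamma g i)) x = pd m (pd j (gamma g i)) x"
    by (rule smooth_on_pd_commute[OF open_S smooth_gamma x])+
  show ?thesis
    unfolding DR_def pd_curv[OF x] unfolding curv_def c
    by (simp add: matrix_ring_simps)
qed

lemma curv_skew: "curv g j i x = - curv g i j x"
  by (simp add: curv_def)

text \<open>The second partial derivatives of \<open>g\<close> commute. Rewriting both orders by
  metric compatibility, their difference is exactly the expression that has to vanish.\<close>

lemma curv_antisym:
  assumes x: "x \<in> S"
  shows "transpose (curv g i j x) ** g x + g x ** curv g i j x = 0"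
proof -
  have eq: "pd i (pd j g) x = transpose (gamma g j x) ** pd i g x + transpose (pd i (gamma g j) x) ** g x
      + (g x ** pd i (gamma g j) x + pd i g x ** gamma g j x)" for i j
  proof -
    have t: "smooth_on S (\<lambda>y. transpose (gamma g j y))"
      by (rule smooth_on_bounded_linear[OF open_S bounded_linear_transpose smooth_gamma])
    have "pd i (pd j g) x = pd i (\<lambda>y. transpose (gamma g j y) ** g y + g y ** gamma g j y) x"
      by (rule pd_cong[OF open_S x]) (rule pd_g)
    also have "\<dots> = pd i (\<lambda>y. transpose (gamma g j y) ** g y) x + pd i (\<lambda>y. g y ** gamma g j y) x"
      by (intro pd_add smooth_diff[OF _ x] smooth_on_S smooth_gamma t)
    also have "pd i (\<lambda>y. transpose (gamma g j y)) x = transpose (pd i (gamma g j) x)"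
      by (rule pd_bounded_linear[OF bounded_linear_transpose smooth_diff[OF smooth_gamma x]])
    then have "pd i (\<lambda>y. transpose (gamma g j y) ** g y) x
        = transpose (gamma g j x) ** pd i g x + transpose (pd i (gamma g j) x) ** g x"
      using pd_mm[OF t smooth_g x] by simp
    finally show ?thesis using pd_mm[OF smooth_g smooth_gamma x] by simp
  qed
  have "pd i (pd j g) x = pd j (pd i g) x"
    by (rule smooth_on_pd_commute[OF open_S smooth_g x])
  then have "pd i (pd j g) x - pd j (pd i g) x = 0" by simp
  moreover have "transpose (curv g i j x) ** g x + g x ** curv g i j x = pd i (pd j g) x - pd j (pd i g) x"
    unfolding eq pd_g[OF x] curv_def
    by (simp add: matrix_ring_simps transpose_simps)
  ultimately show ?thesis by simp
qed

end

section \<open>The contracted second Bianchi identity\<close>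

text \<open>Raising the column index turns skewness with respect to \<open>g\<close> into plain
  antisymmetry of a matrix, so that the contractions in \<open>contracted_bianchi\<close> do not
  involve the metric.\<close>

definition curv_up :: "(real^'n::finite \<Rightarrow> real^'n^'n) \<Rightarrow> 'n \<Rightarrow> 'n \<Rightarrow> real^'n \<Rightarrow> real^'n^'n" where
  "curv_up g i j x = curv g i j x ** matrix_inv (g x)"

text \<open>The Ricci tensor with its second index raised (\<open>ricci_up_ricci\<close>), written
  as a trace of \<open>curv_up\<close> so that it can be differentiated without differentiating
  \<open>g\<close>.\<close>

definition ricci_up :: "(real^'n::finite \<Rightarrow> real^'n^'n) \<Rightarrow> real^'n \<Rightarrow> real^'n^'n" where
  "ricci_up g x = (\<chi> k j. \<Sum>i\<in>UNIV. curv_up g i j x $ i $ k)"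

text \<open>The one-form with components \<open>\<nabla>\<^sub>i T\<^sup>i\<^sub>m\<close>.\<close>

definition div_endo :: "(real^'n::finite \<Rightarrow> real^'n^'n) \<Rightarrow> (real^'n \<Rightarrow> real^'n^'n) \<Rightarrow> real^'n \<Rightarrow> real^'n" where
  "div_endo g T x = (\<chi> m. (\<Sum>i\<in>UNIV. pd i T x $ i $ m)
     + (\<Sum>i\<in>UNIV. (gamma g i x ** T x) $ i $ m) - trace (gamma g m x ** T x))"

text \<open>The \<open>i\<close>-th column of \<open>nab g V x\<close> is \<open>\<nabla>\<^bsub>\<partial>i\<^esub> V\<close>.\<close>

definition nab :: "(real^'n::finite \<Rightarrow> real^'n^'n) \<Rightarrow> (real^'n \<Rightarrow> real^'n) \<Rightarrow> real^'n \<Rightarrow> real^'n^'n" where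
  "nab g V x = (\<chi> k i. pd i V x $ k + (gamma g i x *v V x) $ k)"

context semi_riemannian_chart
begin

lemma christoffel_gamma: "christoffel g x k i j = gamma g i x $ k $ j"
  by (simp add: gamma_def)

lemma ricci_curv: "x \<in> S \<Longrightarrow> ricci g x $ j $ k = (\<Sum>i\<in>UNIV. curv g i j x $ i $ k)"
  by (simp add: ricci_def riemann_def christoffel_gamma pd_vec_nth2 smooth_diff[OF smooth_gamma]
      curv_def mm_nth sum_subtractf sum.distrib)

lemma curv_up_antisym:
  assumes x: "x \<in> S"
  shows "transpose (curv_up g i j x) = - curv_up g i j x"
proof -
  have "transpose (curv g i j x) ** g x = - (g x ** curv g i j x)"
    using curv_antisym[OF x, of i j] by (simp add: eq_neg_iff_add_eq_0)
  then have "ginv x ** (transpose (curv g i j x) ** g x) ** ginv x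
      = ginv x ** (- (g x ** curv g i j x)) ** ginv x"
    by simp
  then have "ginv x ** transpose (curv g i j x) ** (g x ** ginv x)
      = - ((ginv x ** g x) ** curv g i j x ** ginv x)"
    by (simp add: matrix_ring_simps)
  then show ?thesis
    by (simp add: curv_up_def matrix_transpose_mul sym_ginv ginv x)
qed

lemma curv_up_antisym_nth:
  assumes "x \<in> S" shows "curv_up g i j x $ a $ b = - curv_up g i j x $ b $ a"
  using arg_cong[OF curv_up_antisym[OF assms, of i j], of "\<lambda>A. A $ b $ a"] by simp

lemma curv_up_skew: "curv_up g j i x = - curv_up g i j x"
  by (simp add: curv_up_def curv_skew[of j i] mm.minus_left)

lemma smooth_curv_up: "smooth_on S (curv_up g i j)"
  unfolding curv_up_def[abs_def]
  by (rule smooth_on_bounded_bilinear[OF open_S bounded_bilinear_matrix_matrix_mult smooth_curv smooth_ginv])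

lemma ricci_up_ricci: "x \<in> S \<Longrightarrow> ricci_up g x = transpose (ricci g x ** ginv x)"
  by (simp add: vec_eq_iff ricci_up_def curv_up_def mm_nth ricci_curv sum_distrib_right)
    (intro allI sum.swap)

lemma smooth_ricci_up: "smooth_on S (ricci_up g)"
  unfolding ricci_up_def[abs_def]
  by (intro smooth_on_vec_lambda[OF open_S] smooth_on_sum[OF open_S] smooth_on_vec_nth[OF open_S] smooth_curv_up)

lemma pd_ricci_up:
  assumes x: "x \<in> S"
  shows "pd i (ricci_up g) x $ k $ j = (\<Sum>a\<in>UNIV. pd i (curv_up g a j) x $ a $ k)"
proof -
  have "pd i (ricci_up g) x $ k $ j = pd i (\<lambda>y. ricci_up g y $ k $ j) x"
    by (rule pd_vec_nth2[symmetric, OF smooth_diff[OF smooth_ricci_up x]])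
  also have "\<dots> = pd i (\<lambda>y. \<Sum>a\<in>UNIV. curv_up g a j y $ a $ k) x"
    by (simp add: ricci_up_def)
  also have "\<dots> = (\<Sum>a\<in>UNIV. pd i (\<lambda>y. curv_up g a j y $ a $ k) x)"
    by (intro pd_sum smooth_diff[OF _ x] smooth_on_vec_nth[OF open_S] smooth_curv_up)
  finally show ?thesis by (simp add: pd_vec_nth2 smooth_diff[OF smooth_curv_up x])
qed

lemma pd_trace:
  fixes A :: "real^'n \<Rightarrow> real^'n^'n"
  shows "smooth_on S A \<Longrightarrow> x \<in> S \<Longrightarrow> pd i (\<lambda>y. trace (A y)) x = trace (pd i A x)"
  by (rule pd_bounded_linear[OF bounded_linear_trace smooth_diff])

text \<open>Each \<open>DK\<close> is \<open>DR\<close> of \<open>second_bianchi_curv\<close> times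
  the inverse metric: by \<open>pd_ginv\<close> the commutator with the connection matrix becomes
  the correction for two upper indices.\<close>

lemma second_bianchi_curv_up:
  fixes m i j
  assumes x: "x \<in> S"
  defines "DK \<equiv> \<lambda>m i j. pd m (curv_up g i j) x + gamma g m x ** curv_up g i j x
    + curv_up g i j x ** transpose (gamma g m x)"
  shows "DK m i j + DK i j m + DK j m i = 0"
proof -
  define DR where "DR m i j = pd m (curv g i j) x + gamma g m x ** curv g i j x - curv g i j x ** gamma g m x" for m i j
  have "DK m i j = DR m i j ** ginv x" for m i j
    unfolding DK_def DR_def curv_up_def[abs_def] pd_mm[OF smooth_curv smooth_ginv x] pd_ginv[OF x]
    by (simp add: matrix_ring_simps)
  then have "DK m i j + DK i j m + DK j m i = (DR m i j + DR i j m + DR j m i) ** ginv x"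
    by (simp add: matrix_ring_simps)
  also have "\<dots> = 0"
    using second_bianchi_curv[OF x, of m i j] by (simp add: DR_def mm.zero_left)
  finally show ?thesis .
qed

text \<open>The Bianchi identity for \<open>curv_up\<close> is contracted over \<open>i\<close> and
  \<open>j\<close> with the two matrix indices. The term differentiated along \<open>m\<close>
  yields the derivative of the scalar curvature and the trace term of \<open>div_endo\<close>; the
  other two coincide by the two antisymmetries of the curvature, and each yields minus the rest of
  the divergence.\<close>

lemma contracted_bianchi:
  assumes x: "x \<in> S"
  shows "pd m (\<lambda>y. trace (ricci_up g y)) x = 2 * div_endo g (ricci_up g) x $ m"
proof -
  define K where "K i j = curv_up g i j x" for i j
  define dK where "dK m i j = pd m (curv_up g i j) x" for m i j
  define G where "G m = gamma g m x" for m
  define Q where "Q = ricci_up g x"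
  have Ka: "K i j $ a $ b = - K i j $ b $ a" for i j a b
    unfolding K_def by (rule curv_up_antisym_nth[OF x])
  have Ks: "K j i = - K i j" for i j
    unfolding K_def by (rule curv_up_skew)
  have dKa: "dK m i j $ a $ b = - dK m i j $ b $ a" for m i j a b
  proof -
    have "pd m (\<lambda>y. curv_up g i j y $ a $ b) x = pd m (\<lambda>y. - (curv_up g i j y $ b $ a)) x"
      by (rule pd_cong[OF open_S x]) (rule curv_up_antisym_nth)
    also have "\<dots> = - pd m (\<lambda>y. curv_up g i j y $ b $ a) x"
      by (intro pd_bounded_linear bounded_linear_minus bounded_linear_ident smooth_diff[OF _ x]
          smooth_on_vec_nth[OF open_S] smooth_curv_up)
    finally show ?thesis by (simp add: dK_def pd_vec_nth2 smooth_diff[OF smooth_curv_up x])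
  qed
  have dKs: "dK m j i = - dK m i j" for m i j
  proof -
    have "curv_up g j i = (\<lambda>y. - curv_up g i j y)" by (rule ext) (rule curv_up_skew)
    then show ?thesis
      using pd_bounded_linear[OF bounded_linear_minus[OF bounded_linear_ident] smooth_diff[OF smooth_curv_up x]]
      by (simp add: dK_def)
  qed
  have KK: "K i j $ a $ b = K j i $ b $ a" for i j a b
    using Ks[of i j] Ka[of i j a b] by simp
  have dKK: "dK m i j $ a $ b = dK m j i $ b $ a" for m i j a b
    using dKs[of m i j] dKa[of m i j a b] by simp
  have Q: "Q $ k $ j = (\<Sum>i\<in>UNIV. K i j $ i $ k)" for k j
    by (simp add: Q_def K_def ricci_up_def)
  have Q': "Q $ k $ j = (\<Sum>i\<in>UNIV. K j i $ k $ i)" for k j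
    unfolding Q by (intro sum.cong refl) (rule KK)
  have dQ: "pd i (ricci_up g) x $ k $ j = (\<Sum>a\<in>UNIV. dK i a j $ a $ k)" for i k j
    by (simp add: dK_def pd_ricci_up x)
  define D where "D m i j = dK m i j + G m ** K i j + K i j ** transpose (G m)" for m i j
  have cyc: "D m i j + D i j m + D j m i = 0" for i j
    using second_bianchi_curv_up[OF x] unfolding D_def dK_def K_def G_def by blast
  have Dn: "D m i j $ a $ b = dK m i j $ a $ b + (\<Sum>s\<in>UNIV. G m $ a $ s * K i j $ s $ b)
     + (\<Sum>s\<in>UNIV. K i j $ a $ s * G m $ b $ s)" for m i j a b
    by (simp add: D_def mm_nth)
  have Da: "D m j i $ a $ b = D m i j $ b $ a" for m i j a b
    unfolding Dn by (simp add: KK[of j i] dKK[of _ j i] mult.commute)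
  have one: "(\<Sum>i\<in>UNIV. \<Sum>j\<in>UNIV. D m i j $ i $ j) = pd m (\<lambda>y. trace (ricci_up g y)) x + 2 * trace (G m ** Q)"
  proof -
    have "(\<Sum>i\<in>UNIV. \<Sum>j\<in>UNIV. dK m i j $ i $ j) = trace (pd m (ricci_up g) x)"
      unfolding trace_def dQ by (rule sum.swap)
    moreover have "(\<Sum>i\<in>UNIV. \<Sum>j\<in>UNIV. \<Sum>s\<in>UNIV. G m $ i $ s * K i j $ s $ j) = trace (G m ** Q)"
      unfolding trace_def mm_nth Q' sum_distrib_left by (intro sum.cong refl sum.swap)
    moreover have "(\<Sum>i\<in>UNIV. \<Sum>j\<in>UNIV. \<Sum>s\<in>UNIV. K i j $ i $ s * G m $ j $ s) = trace (G m ** Q)"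
    proof -
      have "trace (G m ** Q) = (\<Sum>j\<in>UNIV. \<Sum>s\<in>UNIV. \<Sum>i\<in>UNIV. G m $ j $ s * K i j $ i $ s)"
        unfolding trace_def mm_nth Q sum_distrib_left ..
      also have "\<dots> = (\<Sum>j\<in>UNIV. \<Sum>i\<in>UNIV. \<Sum>s\<in>UNIV. G m $ j $ s * K i j $ i $ s)"
        by (intro sum.cong refl sum.swap)
      also have "\<dots> = (\<Sum>i\<in>UNIV. \<Sum>j\<in>UNIV. \<Sum>s\<in>UNIV. G m $ j $ s * K i j $ i $ s)"
        by (rule sum.swap)
      finally show ?thesis by (simp add: mult.commute)
    qed
    ultimately show ?thesis
      by (simp add: Dn sum.distrib pd_trace[OF smooth_ricci_up x])
  qed
  have two: "(\<Sum>i\<in>UNIV. \<Sum>j\<in>UNIV. D i j m $ i $ j)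
      = - (\<Sum>i\<in>UNIV. pd i (ricci_up g) x $ i $ m) - (\<Sum>i\<in>UNIV. (G i ** Q) $ i $ m)"
  proof -
    have "(\<Sum>j\<in>UNIV. dK i j m $ i $ j) = - pd i (ricci_up g) x $ i $ m" for i
      unfolding dQ sum_negf[symmetric] by (intro sum.cong refl) (rule dKa)
    moreover have "(\<Sum>j\<in>UNIV. \<Sum>s\<in>UNIV. G i $ i $ s * K j m $ s $ j) = - (G i ** Q) $ i $ m" for i
    proof -
      have "(\<Sum>j\<in>UNIV. \<Sum>s\<in>UNIV. G i $ i $ s * K j m $ s $ j)
          = (\<Sum>s\<in>UNIV. \<Sum>j\<in>UNIV. G i $ i $ s * K j m $ s $ j)" by (rule sum.swap)
      also have "\<dots> = (\<Sum>s\<in>UNIV. \<Sum>j\<in>UNIV. - (G i $ i $ s * K j m $ j $ s))"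
        by (intro sum.cong refl) (metis Ka mult_minus_right)
      finally show ?thesis unfolding mm_nth Q sum_distrib_left by (simp add: sum_negf)
    qed
    \<comment> \<open>For fixed \<open>j\<close> the factor \<open>K\<close> is antisymmetric in
      \<open>i\<close> and \<open>s\<close>, while \<open>G\<close> is symmetric in them by
      torsion-freeness.\<close>
    moreover have "(\<Sum>i\<in>UNIV. \<Sum>j\<in>UNIV. \<Sum>s\<in>UNIV. K j m $ i $ s * G i $ j $ s) = 0"
    proof -
      let ?s = "\<lambda>j. \<Sum>i\<in>UNIV. \<Sum>s\<in>UNIV. K j m $ i $ s * G i $ j $ s"
      have "?s j = 0" for j
      proof -
        have "?s j = (\<Sum>s\<in>UNIV. \<Sum>i\<in>UNIV. K j m $ i $ s * G i $ j $ s)" by (rule sum.swap)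
        also have "\<dots> = (\<Sum>s\<in>UNIV. \<Sum>i\<in>UNIV. - (K j m $ s $ i * G s $ j $ i))"
        proof (intro sum.cong refl)
          fix s i show "K j m $ i $ s * G i $ j $ s = - (K j m $ s $ i * G s $ j $ i)"
            using Ka[of j m i s] gamma_sym[OF x, of i j s] unfolding G_def by simp
        qed
        also have "\<dots> = - ?s j" by (simp add: sum_negf)
        finally show ?thesis by simp
      qed
      moreover have "(\<Sum>i\<in>UNIV. \<Sum>j\<in>UNIV. \<Sum>s\<in>UNIV. K j m $ i $ s * G i $ j $ s) = (\<Sum>j\<in>UNIV. ?s j)"
        by (rule sum.swap)
      ultimately show ?thesis by simp
    qed
    ultimately show ?thesis
      by (simp add: Dn sum.distrib sum_negf sum_subtractf)
  qed
  have three: "(\<Sum>i\<in>UNIV. \<Sum>j\<in>UNIV. D j m i $ i $ j) = (\<Sum>i\<in>UNIV. \<Sum>j\<in>UNIV. D i j m $ i $ j)"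
    unfolding Da[of _ i m for i] by (rule sum.swap)
  have "(\<Sum>i\<in>UNIV. \<Sum>j\<in>UNIV. (D m i j + D i j m + D j m i) $ i $ j) = 0"
    unfolding cyc by simp
  then have "(\<Sum>i\<in>UNIV. \<Sum>j\<in>UNIV. D m i j $ i $ j) + (\<Sum>i\<in>UNIV. \<Sum>j\<in>UNIV. D i j m $ i $ j)
      + (\<Sum>i\<in>UNIV. \<Sum>j\<in>UNIV. D j m i $ i $ j) = 0"
    by (simp add: sum.distrib)
  then show ?thesis
    unfolding one three two div_endo_def G_def Q_def by simp
qed

section \<open>Divergence of endomorphism fields\<close>

lemma div_endo_cong:
  assumes x: "x \<in> S" and "\<And>y. y \<in> S \<Longrightarrow> T y = T' y"
  shows "div_endo g T x = div_endo g T' x"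
  using pd_cong[OF open_S x, of T T'] assms by (simp add: div_endo_def)

lemma div_endo_add:
  assumes "smooth_on S T" "smooth_on S T'" "x \<in> S"
  shows "div_endo g (\<lambda>y. T y + T' y) x = div_endo g T x + div_endo g T' x"
  using assms
  by (simp add: div_endo_def vec_eq_iff pd_add smooth_diff sum.distrib matrix_ring_simps trace_add)

lemma div_endo_scaleR:
  assumes "smooth_on S T" "x \<in> S"
  shows "div_endo g (\<lambda>y. c *\<^sub>R T y) x = c *\<^sub>R div_endo g T x"
proof -
  have "pd i (\<lambda>y. c *\<^sub>R T y) x = c *\<^sub>R pd i T x" for i
    by (rule pd_bounded_linear[OF bounded_linear_scaleR_right smooth_diff[OF assms]])
  then show ?thesis
    by (simp add: div_endo_def vec_eq_iff matrix_ring_simps trace_def sum_distrib_left algebra_simps)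
qed

lemma div_endo_id: "x \<in> S \<Longrightarrow> div_endo g (\<lambda>y. mat 1) x = 0"
  by (simp add: div_endo_def vec_eq_iff trace_def gamma_sym[of x _ _ m for m])

lemma smooth_nab: "smooth_on S V \<Longrightarrow> smooth_on S (nab g V)"
  unfolding nab_def[abs_def]
  by (intro smooth_on_vec_lambda[OF open_S] smooth_on_add[OF open_S] smooth_on_vec_nth[OF open_S]
      smooth_on_bounded_bilinear[OF open_S bounded_bilinear_matrix_vector_mult] smooth_on_pd smooth_gamma)

text \<open>The Leibniz rule div (T v) = (div T)(v) + tr (T \<nabla>v), where
  \<open>trace (nab g Y x)\<close> is the divergence of \<open>Y\<close>. It serves twice: to
  evaluate the soliton constant by traces, and to integrate the first variation by parts.\<close>

lemma div_endo_mv: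
  assumes T: "smooth_on S T" and v: "v differentiable (at x)" and x: "x \<in> S"
  shows "div_endo g T x \<bullet> v x = trace (nab g (\<lambda>y. T y *v v y) x) - trace (T x ** nab g v x)"
proof -
  have pd: "pd i (\<lambda>y. T y *v v y) x = T x *v pd i v x + pd i T x *v v x" for i
    by (intro pd_bounded_bilinear bounded_bilinear_matrix_vector_mult smooth_diff[OF T x] v)
  have 1: "trace (nab g (\<lambda>y. T y *v v y) x) = (\<Sum>i\<in>UNIV. (T x *v pd i v x) $ i)
     + (\<Sum>i\<in>UNIV. (pd i T x *v v x) $ i) + (\<Sum>i\<in>UNIV. ((gamma g i x ** T x) *v v x) $ i)"
    by (simp add: trace_def nab_def pd sum.distrib matrix_vector_mul_assoc)
  have 2: "trace (T x ** nab g v x) = (\<Sum>i\<in>UNIV. (T x *v pd i v x) $ i)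
     + (\<Sum>i\<in>UNIV. \<Sum>k\<in>UNIV. T x $ i $ k * (gamma g i x *v v x) $ k)"
    by (simp add: trace_def mm_nth mv_nth nab_def distrib_left sum.distrib)
  \<comment> \<open>By torsion-freeness the trace term of \<open>div_endo\<close> is the connection
    part of tr (T \<nabla>v).\<close>
  have 3: "(\<Sum>m\<in>UNIV. trace (gamma g m x ** T x) * v x $ m)
      = (\<Sum>i\<in>UNIV. \<Sum>k\<in>UNIV. T x $ i $ k * (gamma g i x *v v x) $ k)"
  proof -
    have "(\<Sum>i\<in>UNIV. \<Sum>k\<in>UNIV. T x $ i $ k * (gamma g i x *v v x) $ k)
        = (\<Sum>i\<in>UNIV. \<Sum>k\<in>UNIV. \<Sum>m\<in>UNIV. gamma g m x $ k $ i * T x $ i $ k * v x $ m)"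
      unfolding mv_nth sum_distrib_left
      by (intro sum.cong refl) (simp add: gamma_sym[OF x] mult_ac)
    also have "\<dots> = (\<Sum>i\<in>UNIV. \<Sum>m\<in>UNIV. \<Sum>k\<in>UNIV. gamma g m x $ k $ i * T x $ i $ k * v x $ m)"
      by (intro sum.cong refl sum.swap)
    also have "\<dots> = (\<Sum>m\<in>UNIV. \<Sum>i\<in>UNIV. \<Sum>k\<in>UNIV. gamma g m x $ k $ i * T x $ i $ k * v x $ m)"
      by (rule sum.swap)
    also have "\<dots> = (\<Sum>m\<in>UNIV. \<Sum>k\<in>UNIV. \<Sum>i\<in>UNIV. gamma g m x $ k $ i * T x $ i $ k * v x $ m)"
      by (intro sum.cong refl sum.swap)
    finally show ?thesis by (simp add: trace_def mm_nth sum_distrib_right)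
  qed
  have 4: "(\<Sum>m\<in>UNIV. (\<Sum>i\<in>UNIV. A i $ i $ m) * v x $ m) = (\<Sum>i\<in>UNIV. (A i *v v x) $ i)"
    for A :: "'n \<Rightarrow> real^'n^'n"
    unfolding mv_nth sum_distrib_right by (rule sum.swap)
  have "div_endo g T x \<bullet> v x = (\<Sum>i\<in>UNIV. (pd i T x *v v x) $ i)
      + (\<Sum>i\<in>UNIV. ((gamma g i x ** T x) *v v x) $ i) - (\<Sum>m\<in>UNIV. trace (gamma g m x ** T x) * v x $ m)"
    unfolding 4[symmetric] div_endo_def inner_vec_def
    by (simp add: algebra_simps sum.distrib sum_subtractf)
  then show ?thesis unfolding 1 2 3 by simp
qed

text \<open>This is the trace of the commutator of covariant derivatives. \<open>n i\<close> is the
  derivative of \<open>V\<close> along the \<open>i\<close>-th coordinate field; coordinate fields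
  commute, so \<open>comm\<close> carries no bracket term, and its \<open>i\<close>-th components
  sum to the Ricci tensor.\<close>

lemma ricci_identity:
  assumes V: "smooth_on S V" and x: "x \<in> S"
  shows "div_endo g (nab g V) x $ j - pd j (\<lambda>y. trace (nab g V y)) x = (ricci g x *v V x) $ j"
proof -
  define n where "n i y = pd i V y + gamma g i y *v V y" for i y
  have sn: "smooth_on S (n i)" for i
    unfolding n_def[abs_def]
    by (intro smooth_on_add[OF open_S] smooth_on_bounded_bilinear[OF open_S bounded_bilinear_matrix_vector_mult]
        smooth_on_pd smooth_gamma V)
  have nab_n: "nab g V y $ k $ i = n i y $ k" for y k i
    by (simp add: nab_def n_def)
  have pdn: "pd i (n j) x = pd i (pd j V) x + (gamma g j x *v pd i V x + pd i (gamma g j) x *v V x)" for i j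
  proof -
    have "pd i (n j) x = pd i (pd j V) x + pd i (\<lambda>y. gamma g j y *v V y) x"
      unfolding n_def[abs_def]
      by (intro pd_add smooth_diff[OF _ x] smooth_on_pd V
          smooth_on_bounded_bilinear[OF open_S bounded_bilinear_matrix_vector_mult] smooth_gamma)
    then show ?thesis by (simp add: pd_mv[OF smooth_gamma V x])
  qed
  have comm: "pd i (n j) x + gamma g i x *v n j x - (pd j (n i) x + gamma g j x *v n i x) = curv g i j x *v V x" for i
    unfolding pdn curv_def n_def
    using smooth_on_pd_commute[OF open_S V x, of i j]
    by (simp add: mv.add_left mv.add_right mv.diff_left matrix_vector_mul_assoc)
  have pdnab: "pd i (nab g V) x $ k $ j = pd i (n j) x $ k" for i k j
    using pd_vec_nth2[OF smooth_diff[OF smooth_nab[OF V] x], of i k j]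
      pd_vec_nth[OF smooth_diff[OF sn x], of i j k] by (simp add: nab_n)
  have gn: "(gamma g i x ** nab g V x) $ k $ j = (gamma g i x *v n j x) $ k" for i k j
    by (simp add: mm_nth mv_nth nab_n)
  have tgn: "trace (gamma g j x ** nab g V x) = (\<Sum>i\<in>UNIV. (gamma g j x *v n i x) $ i)"
    by (simp add: trace_def gn)
  have trn: "pd j (\<lambda>y. trace (nab g V y)) x = (\<Sum>i\<in>UNIV. pd j (n i) x $ i)"
  proof -
    have "pd j (\<lambda>y. trace (nab g V y)) x = trace (pd j (nab g V) x)"
      by (rule pd_trace[OF smooth_nab[OF V] x])
    then show ?thesis unfolding trace_def[of "pd j (nab g V) x"] pdnab .
  qed
  have "div_endo g (nab g V) x $ j - pd j (\<lambda>y. trace (nab g V y)) x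
      = (\<Sum>i\<in>UNIV. (pd i (n j) x + gamma g i x *v n j x - (pd j (n i) x + gamma g j x *v n i x)) $ i)"
    by (simp add: div_endo_def trn tgn pdnab gn sum.distrib sum_subtractf)
  also have "\<dots> = (ricci g x *v V x) $ j"
    unfolding comm by (simp add: mv_nth ricci_curv x sum_distrib_right) (rule sum.swap)
  finally show ?thesis .
qed

end

section \<open>Paracontact Ricci solitons in a chart\<close>

definition outer :: "real^'n::finite \<Rightarrow> real^'m::finite \<Rightarrow> real^'m^'n" where
  "outer u v = (\<chi> i j. u $ i * v $ j)"

lemma mm_outer: "A ** outer u v = outer (A *v u) v"
  by (simp add: vec_eq_iff outer_def mm_nth mv_nth sum_distrib_right mult.assoc)

lemma trace_outer: "trace (outer u v) = u \<bullet> v"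
  by (simp add: trace_def outer_def inner_vec_def)

lemma bounded_bilinear_outer: "bounded_bilinear (outer :: real^'n::finite \<Rightarrow> real^'m::finite \<Rightarrow> real^'m^'n)"
  unfolding bilinear_conv_bounded_bilinear[symmetric] bilinear_def
  by (auto intro!: linearI simp: outer_def vec_eq_iff algebra_simps)

lemma outer_mv: "outer u v *v w = (v \<bullet> w) *\<^sub>R u"
  by (simp add: vec_eq_iff outer_def mv_nth inner_vec_def sum_distrib_right sum_distrib_left algebra_simps)

lemma inner_matrix_eq: "(\<And>u v. u \<bullet> (A *v v) = u \<bullet> (B *v v)) \<Longrightarrow> A = B"
  for A B :: "real^'n::finite^'m::finite"
  by (metis matrix_eq vector_eq_rdot inner_commute)

locale paracontact_soliton_chart = semi_riemannian_chart S g
  for S :: "(real^'n::finite) set" and g +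
  fixes phi :: "real^'n \<Rightarrow> real^'n^'n" and xi eta :: "real^'n \<Rightarrow> real^'n" and lam :: real
  assumes smooth_phi: "smooth_on S phi" and smooth_xi: "smooth_on S xi" and smooth_eta: "smooth_on S eta"
    and eta_xi: "x \<in> S \<Longrightarrow> eta x \<bullet> xi x = 1"
    and xi_ext_deriv: "x \<in> S \<Longrightarrow> xi x \<bullet> (ext_deriv eta x *v v) = 0"
    and eta_inner: "x \<in> S \<Longrightarrow> eta x \<bullet> v = xi x \<bullet> (g x *v v)"
    and ext_deriv_inner: "x \<in> S \<Longrightarrow> u \<bullet> (ext_deriv eta x *v v) = u \<bullet> (g x *v (phi x *v v))"
    and phi_phi: "x \<in> S \<Longrightarrow> phi x *v (phi x *v v) = v - (eta x \<bullet> v) *\<^sub>R xi x"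
    and soliton: "x \<in> S \<Longrightarrow> ricci g x + (1/2) *\<^sub>R lie_deriv_form xi g x = lam *\<^sub>R g x"
begin

abbreviation "N \<equiv> nab g xi"
abbreviation "E \<equiv> ext_deriv eta"

text \<open>The \<open>g\<close>-adjoint of \<nabla>\<xi>, which turns out to be
  \<open>T x + phi x\<close>; its divergence is what the first variation of the energy
  tests.\<close>

definition Nadj :: "real^'n \<Rightarrow> real^'n^'n" where
  "Nadj x = ginv x ** transpose (N x) ** g x"

text \<open>The endomorphism called S in the overview; in the code \<open>S\<close> is the open set
  on which the components live.\<close>

definition T :: "real^'n \<Rightarrow> real^'n^'n" where
  "T x = (1/2) *\<^sub>R (N x + Nadj x)"

text \<open>Derivative of the components along \<xi>. For tensors this depends on the chart and
  becomes a Lie derivative only after adding terms in \<open>M\<close>.\<close>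

definition dX :: "(real^'n \<Rightarrow> 'b::real_normed_vector) \<Rightarrow> real^'n \<Rightarrow> 'b" where
  "dX F x = (\<Sum>k\<in>UNIV. xi x $ k *\<^sub>R pd k F x)"

definition M :: "real^'n \<Rightarrow> real^'n^'n" where
  "M x = (\<chi> k i. pd i xi x $ k)"

lemma smooth_N: "smooth_on S N"
  by (rule smooth_nab[OF smooth_xi])

lemma smooth_Nadj: "smooth_on S Nadj"
  unfolding Nadj_def[abs_def]
  by (intro smooth_on_bounded_bilinear[OF open_S bounded_bilinear_matrix_matrix_mult] smooth_ginv smooth_g
      smooth_on_bounded_linear[OF open_S bounded_linear_transpose smooth_N])

lemma smooth_T: "smooth_on S T"
  unfolding T_def[abs_def]
  by (intro smooth_on_bounded_linear[OF open_S bounded_linear_scaleR_right] smooth_on_add[OF open_S] smooth_N smooth_Nadj)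

section \<open>The covariant derivative of the Reeb field\<close>

lemma eta_eq: assumes x: "x \<in> S" shows "eta x = g x *v xi x"
proof -
  have "xi x \<bullet> (g x *v v) = (g x *v xi x) \<bullet> v" for v
    using sym_g[OF x] by (metis dot_lmul_matrix transpose_matrix_vector)
  then show ?thesis
    using eta_inner[OF x] by (metis vector_eq_rdot inner_commute)
qed

lemma E_phi: assumes x: "x \<in> S" shows "E x = g x ** phi x"
  by (rule inner_matrix_eq) (use ext_deriv_inner[OF x] in \<open>simp add: matrix_vector_mul_assoc\<close>)

lemma phi_phi_eq: assumes x: "x \<in> S" shows "phi x ** phi x = mat 1 - outer (xi x) (eta x)"
  by (rule inner_matrix_eq)
    (use phi_phi[OF x] in \<open>simp add: matrix_vector_mul_assoc mv.diff_left outer_mv\<close>)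

lemma E_skew: "transpose (E x) = - E x"
  by (simp add: vec_eq_iff ext_deriv_def field_simps)

lemma E_skew_nth: "E x $ i $ j = - E x $ j $ i"
  by (simp add: ext_deriv_def field_simps)

lemma E_nth: "x \<in> S \<Longrightarrow> E x $ i $ j = (pd i eta x $ j - pd j eta x $ i) / 2"
  by (simp add: ext_deriv_def pd_vec_nth smooth_diff[OF smooth_eta])

lemma transpose_E_xi: assumes x: "x \<in> S" shows "transpose (E x) *v xi x = 0"
proof -
  have "(transpose (E x) *v xi x) \<bullet> v = 0" for v
    using xi_ext_deriv[OF x, of v] by (simp add: dot_lmul_matrix)
  then show ?thesis by (metis inner_eq_zero_iff)
qed

lemma E_xi: assumes x: "x \<in> S" shows "E x *v xi x = 0"
  using transpose_E_xi[OF x] unfolding E_skew by (simp add: mv.minus_left)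

lemma pd_eta: assumes x: "x \<in> S"
  shows "pd i eta x = transpose (gamma g i x) *v eta x + g x *v (N x *v axis i 1)"
proof -
  have N: "N x *v axis i 1 = pd i xi x + gamma g i x *v xi x"
    by (simp add: vec_eq_iff matrix_vector_mult_basis column_def nab_def)
  have "pd i eta x = pd i (\<lambda>y. g y *v xi y) x"
    by (rule pd_cong[OF open_S x eta_eq])
  also have "\<dots> = g x *v pd i xi x + pd i g x *v xi x"
    by (rule pd_mv[OF smooth_g smooth_xi x])
  finally show ?thesis
    unfolding N pd_g[OF x] eta_eq[OF x]
    by (simp add: mv.add_left mv.add_right matrix_vector_mul_assoc del: transpose_matrix_vector)
qed

text \<open>The connection terms of \<open>pd_eta\<close> are symmetric by torsion-freeness, so
  antisymmetrising leaves only \<nabla>\<xi>. The factor 1/2 is that of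
  \<open>ext_deriv\<close>.\<close>

lemma E_N: assumes x: "x \<in> S" shows "E x = (1/2) *\<^sub>R (transpose (g x ** N x) - g x ** N x)"
proof -
  have "(transpose (gamma g i x) *v eta x) $ j = (transpose (gamma g j x) *v eta x) $ i" for i j
    unfolding mv_nth by (simp add: gamma_sym[OF x, of i _ j])
  moreover have "(g x *v (N x *v axis i 1)) $ j = (g x ** N x) $ j $ i" for i j
    by (simp add: matrix_vector_mult_basis column_def mm_nth mv_nth)
  ultimately show ?thesis
    unfolding vec_eq_iff E_nth[OF x] pd_eta[OF x] by (simp del: transpose_matrix_vector)
qed

lemma g_Nadj: assumes x: "x \<in> S" shows "g x ** Nadj x = transpose (g x ** N x)"
  by (simp add: Nadj_def matrix_mul_assoc ginv x matrix_transpose_mul sym_g)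

text \<open>Together with the definition of \<open>T\<close> this is the splitting \<nabla>\<xi> = T
  - \<phi> into self-adjoint and skew part.\<close>

lemma phi_N: assumes x: "x \<in> S" shows "phi x = (1/2) *\<^sub>R (Nadj x - N x)"
proof -
  have "g x ** phi x = (1/2) *\<^sub>R (g x ** Nadj x - g x ** N x)"
    unfolding g_Nadj[OF x] E_phi[OF x, symmetric] E_N[OF x] ..
  then have "ginv x ** (g x ** phi x) = (1/2) *\<^sub>R (ginv x ** (g x ** Nadj x) - ginv x ** (g x ** N x))"
    by (simp add: mm.scaleR_right mm.diff_right)
  then show ?thesis by (simp add: matrix_mul_assoc ginv x)
qed

lemma pd_xi_expand: "N x = M x + (\<Sum>k\<in>UNIV. xi x $ k *\<^sub>R gamma g k x)" if x: "x \<in> S"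
  unfolding vec_eq_iff nab_def M_def
  by (simp add: mv_nth sum_component gamma_sym[OF x, of i _ j for i j] mult.commute)

lemma lie_M: assumes x: "x \<in> S"
  shows "lie_deriv_form xi g x = dX g x + transpose (M x) ** g x + g x ** M x"
  by (simp add: vec_eq_iff lie_deriv_form_def dX_def M_def mm_nth sum_component
      pd_vec_nth2[OF smooth_diff[OF smooth_g x]] pd_vec_nth[OF smooth_diff[OF smooth_xi x]]
      sum.distrib mult.commute)

text \<open>Metric compatibility turns the derivative of \<open>g\<close> along \<xi> into
  connection terms \<open>C\<close>, and these complete the Jacobian \<open>M\<close> to the
  covariant derivative, \<open>N x = M x + C\<close>.\<close>

lemma lie_T: assumes x: "x \<in> S"
  shows "(1/2) *\<^sub>R lie_deriv_form xi g x = g x ** T x"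
proof -
  define C where "C = (\<Sum>k\<in>UNIV. xi x $ k *\<^sub>R gamma g k x)"
  have "transpose C = (\<Sum>k\<in>UNIV. xi x $ k *\<^sub>R transpose (gamma g k x))"
    by (simp add: C_def vec_eq_iff sum_component)
  then have "dX g x = transpose C ** g x + g x ** C"
    unfolding dX_def pd_g[OF x] C_def
    by (simp add: scaleR_add_right sum.distrib mm.sum_left mm.sum_right mm.scaleR_left mm.scaleR_right)
  then have "lie_deriv_form xi g x = transpose (M x + C) ** g x + g x ** (M x + C)"
    unfolding lie_M[OF x] by (simp add: matrix_ring_simps transpose_simps)
  also have "\<dots> = g x ** Nadj x + g x ** N x"
    unfolding g_Nadj[OF x] pd_xi_expand[OF x] C_def[symmetric] by (simp add: matrix_transpose_mul sym_g x)
  finally show ?thesis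
    by (simp add: T_def mm.scaleR_right mm.add_right add.commute)
qed

text \<open>The function g(\<xi>, \<xi>) is constant, and its differential is twice this
  covector.\<close>

lemma transpose_N_eta: assumes x: "x \<in> S" shows "transpose (N x) *v eta x = 0"
proof -
  have "pd i (\<lambda>y. xi y \<bullet> (g y *v xi y)) x = 0" for i
  proof -
    have "pd i (\<lambda>y. xi y \<bullet> (g y *v xi y)) x = pd i (\<lambda>y. 1) x"
      by (rule pd_cong[OF open_S x]) (use eta_xi eta_inner in auto)
    then show ?thesis by simp
  qed
  moreover have "pd i (\<lambda>y. xi y \<bullet> (g y *v xi y)) x = 2 * (eta x \<bullet> (N x *v axis i 1))" for i
  proof -
    have s: "smooth_on S (\<lambda>y. g y *v xi y)"
      by (rule smooth_on_bounded_bilinear[OF open_S bounded_bilinear_matrix_vector_mult smooth_g smooth_xi])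
    have N: "N x *v axis i 1 = pd i xi x + gamma g i x *v xi x"
      by (simp add: vec_eq_iff matrix_vector_mult_basis column_def nab_def)
    have "pd i (\<lambda>y. xi y \<bullet> (g y *v xi y)) x
        = xi x \<bullet> (g x *v pd i xi x + pd i g x *v xi x) + pd i xi x \<bullet> (g x *v xi x)"
      using pd_bounded_bilinear[OF bounded_bilinear_inner smooth_diff[OF smooth_xi x] smooth_diff[OF s x]]
      by (simp add: pd_mv[OF smooth_g smooth_xi x])
    moreover have "pd i g x *v xi x = transpose (gamma g i x) *v eta x + g x *v (gamma g i x *v xi x)"
      unfolding pd_g[OF x] eta_eq[OF x]
      by (simp add: mv.add_left matrix_vector_mul_assoc del: transpose_matrix_vector)
    moreover have "xi x \<bullet> (transpose (gamma g i x) *v eta x) = eta x \<bullet> (gamma g i x *v xi x)"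
      by (simp add: dot_lmul_matrix inner_commute[of "xi x"])
    moreover have "xi x \<bullet> (g x *v v) = eta x \<bullet> v" for v
      by (simp add: eta_inner x)
    ultimately show ?thesis
      unfolding N by (simp add: inner_add_right eta_eq[OF x, symmetric] inner_commute)
  qed
  ultimately have "(transpose (N x) *v eta x) \<bullet> axis i 1 = 0" for i
    by (simp add: dot_lmul_matrix)
  then show ?thesis by (simp add: vec_eq_iff inner_axis)
qed

lemma Nadj_xi: assumes x: "x \<in> S" shows "Nadj x *v xi x = 0"
proof -
  have "Nadj x *v xi x = ginv x *v (transpose (N x) *v eta x)"
    unfolding Nadj_def eta_eq[OF x] by (simp add: matrix_vector_mul_assoc matrix_mul_assoc del: transpose_matrix_vector)
  then show ?thesis unfolding transpose_N_eta[OF x] by simp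
qed

lemma phi_xi: assumes x: "x \<in> S" shows "phi x *v xi x = 0"
proof -
  have "ginv x *v (g x *v (phi x *v xi x)) = 0"
    using E_xi[OF x] unfolding E_phi[OF x] by (simp add: matrix_vector_mul_assoc[symmetric])
  then show ?thesis by (simp add: matrix_vector_mul_assoc matrix_mul_assoc ginv x)
qed

text \<open>\<xi> is geodesic: \<phi> measures the difference between \<nabla>\<xi> and its adjoint,
  and both \<phi> and the adjoint annihilate \<xi>.\<close>

lemma N_xi: assumes x: "x \<in> S" shows "N x *v xi x = 0"
proof -
  have "phi x *v xi x = (1/2) *\<^sub>R (Nadj x *v xi x - N x *v xi x)"
    unfolding phi_N[OF x] by (simp add: mv.scaleR_left mv.diff_left)
  then show ?thesis by (simp add: phi_xi Nadj_xi x)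
qed

lemma T_xi: "x \<in> S \<Longrightarrow> T x *v xi x = 0"
  by (simp add: T_def mv.scaleR_left mv.add_left N_xi Nadj_xi)

lemma trace_Nadj: "x \<in> S \<Longrightarrow> trace (Nadj x) = trace (N x)"
  unfolding Nadj_def
  by (subst trace_mm_commute) (simp add: matrix_mul_assoc ginv trace_transpose)

lemma trace_T: "x \<in> S \<Longrightarrow> trace (T x) = trace (N x)"
  by (simp add: T_def trace_def sum_divide_distrib[symmetric] sum.distrib)
    (use trace_Nadj[of x] in \<open>simp add: trace_def\<close>)

text \<open>\<open>M\<close> is the Jacobian of \<open>xi\<close>; the next three identities say that the Lie derivatives along \<open>xi\<close> of
  \<open>xi\<close>, \<open>eta\<close> and \<open>d eta\<close> vanish.\<close>

lemma dX_xi: "dX xi x = M x *v xi x"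
  by (simp add: vec_eq_iff dX_def M_def mv_nth sum_component mult.commute)

lemma dX_eta: assumes x: "x \<in> S" shows "dX eta x = - (transpose (M x) *v eta x)"
proof -
  have "dX eta x $ i = - (\<Sum>k\<in>UNIV. pd i xi x $ k * eta x $ k)" for i
  proof -
    have "(transpose (E x) *v xi x) $ i = 0" unfolding transpose_E_xi[OF x] by simp
    then have "(\<Sum>k\<in>UNIV. (pd k eta x $ i - pd i eta x $ k) / 2 * xi x $ k) = 0"
      unfolding mv_nth transpose_nth E_nth[OF x] .
    then have 1: "(\<Sum>k\<in>UNIV. pd k eta x $ i * xi x $ k) = (\<Sum>k\<in>UNIV. pd i eta x $ k * xi x $ k)"
      by (simp add: sum_divide_distrib[symmetric] sum_subtractf left_diff_distrib)
    have "pd i (\<lambda>y. eta y \<bullet> xi y) x = pd i (\<lambda>y. 1) x"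
      by (rule pd_cong[OF open_S x]) (use eta_xi in auto)
    then have "eta x \<bullet> pd i xi x + pd i eta x \<bullet> xi x = 0"
      using pd_bounded_bilinear[OF bounded_bilinear_inner smooth_diff[OF smooth_eta x] smooth_diff[OF smooth_xi x]]
      by simp
    then show ?thesis using 1
      by (simp add: dX_def sum_component inner_vec_def mult.commute)
  qed
  then show ?thesis
    by (simp add: vec_eq_iff mv_nth M_def del: transpose_matrix_vector)
qed

lemma smooth_E: "smooth_on S E"
proof (rule smooth_on_cong[OF open_S])
  show "smooth_on S (\<lambda>x. \<chi> i j. (pd i eta x $ j - pd j eta x $ i) / 2)"
    by (intro smooth_on_vec_lambda[OF open_S] smooth_on_bounded_linear[OF open_S bounded_linear_divide]
        smooth_on_diff[OF open_S] smooth_on_vec_nth[OF open_S] smooth_on_pd smooth_eta)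
qed (simp add: E_nth vec_eq_iff)

lemma pd_E: assumes x: "x \<in> S" shows "pd k E x $ i $ j = (pd k (pd i eta) x $ j - pd k (pd j eta) x $ i) / 2"
proof -
  have "pd k E x $ i $ j = pd k (\<lambda>y. E y $ i $ j) x"
    by (simp add: pd_vec_nth2 smooth_diff[OF smooth_E x])
  also have "\<dots> = pd k (\<lambda>y. (pd i eta y $ j - pd j eta y $ i) / 2) x"
    by (rule pd_cong[OF open_S x E_nth])
  also have "\<dots> = pd k (\<lambda>y. pd i eta y $ j - pd j eta y $ i) x / 2"
    by (intro pd_bounded_linear[OF bounded_linear_divide] smooth_diff[OF _ x]
        smooth_on_diff[OF open_S] smooth_on_vec_nth[OF open_S] smooth_on_pd smooth_eta)
  also have "pd k (\<lambda>y. pd i eta y $ j - pd j eta y $ i) x = pd k (\<lambda>y. pd i eta y $ j) x - pd k (\<lambda>y. pd j eta y $ i) x"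
    by (intro pd_diff smooth_diff[OF _ x] smooth_on_vec_nth[OF open_S] smooth_on_pd smooth_eta)
  finally show ?thesis
    by (simp add: pd_vec_nth smooth_diff[OF smooth_on_pd[OF smooth_eta] x])
qed

lemma dX_E: assumes x: "x \<in> S" shows "dX E x = - (transpose (M x) ** E x + E x ** M x)"
proof -
  \<comment> \<open>d(d\<eta>) = 0. With the contraction in \<open>contr\<close> this is Cartan's
    formula for the Lie derivative of d\<eta> along \<xi>, carried out in components.\<close>
  have closed: "pd k E x $ i $ j = - pd i E x $ j $ k - pd j E x $ k $ i" for i j k
    unfolding pd_E[OF x] using smooth_on_pd_commute[OF open_S smooth_eta x, of i j]
      smooth_on_pd_commute[OF open_S smooth_eta x, of j k] smooth_on_pd_commute[OF open_S smooth_eta x, of k i]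
    by (simp add: field_simps)
  have skew: "pd k E x $ i $ j = - pd k E x $ j $ i" for i j k
    unfolding pd_E[OF x] by (simp add: field_simps)
  \<comment> \<open>Differentiating the identity \<open>transpose_E_xi\<close> moves the derivative
    from \<open>E\<close> onto \<xi>, that is, to \<open>M\<close>.\<close>
  have contr: "(\<Sum>k\<in>UNIV. pd j E x $ k $ i * xi x $ k) = - (transpose (M x) ** E x) $ j $ i" for i j
  proof -
    have t: "smooth_on S (\<lambda>y. transpose (E y))"
      by (rule smooth_on_bounded_linear[OF open_S bounded_linear_transpose smooth_E])
    have "pd j (\<lambda>y. transpose (E y) *v xi y) x = pd j (\<lambda>y. 0) x"
      by (rule pd_cong[OF open_S x transpose_E_xi])
    then have "transpose (E x) *v pd j xi x + pd j (\<lambda>y. transpose (E y)) x *v xi x = 0"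
      using pd_mv[OF t smooth_xi x, of j] by (simp del: transpose_matrix_vector)
    then have "transpose (E x) *v pd j xi x + transpose (pd j E x) *v xi x = 0"
      unfolding pd_bounded_linear[OF bounded_linear_transpose smooth_diff[OF smooth_E x]] .
    then have "(transpose (E x) *v pd j xi x + transpose (pd j E x) *v xi x) $ i = 0" by simp
    then have "(\<Sum>k\<in>UNIV. E x $ k $ i * pd j xi x $ k) + (\<Sum>k\<in>UNIV. pd j E x $ k $ i * xi x $ k) = 0"
      unfolding vector_add_component mv_nth transpose_nth .
    then show ?thesis by (simp add: mm_nth M_def mult.commute)
  qed
  have "dX E x $ i $ j = (transpose (M x) ** E x) $ j $ i - (transpose (M x) ** E x) $ i $ j" for i j
  proof -
    have "dX E x $ i $ j = (\<Sum>k\<in>UNIV. (- pd i E x $ j $ k - pd j E x $ k $ i) * xi x $ k)"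
      unfolding dX_def by (simp add: sum_component closed[of _ i j] mult.commute)
    also have "\<dots> = (\<Sum>k\<in>UNIV. pd i E x $ k $ j * xi x $ k) - (\<Sum>k\<in>UNIV. pd j E x $ k $ i * xi x $ k)"
      by (simp add: skew[of i j] sum_subtractf left_diff_distrib)
    finally show ?thesis unfolding contr by simp
  qed
  moreover have "(E x ** M x) $ i $ j = - (transpose (M x) ** E x) $ j $ i" for i j
    by (simp add: mm_nth E_skew_nth[of x i] sum_negf mult.commute)
  ultimately show ?thesis by (simp add: vec_eq_iff)
qed

lemma dX_mm:
  fixes A B :: "real^'n \<Rightarrow> real^'n^'n"
  assumes "smooth_on S A" "smooth_on S B" "x \<in> S"
  shows "dX (\<lambda>y. A y ** B y) x = A x ** dX B x + dX A x ** B x"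
  unfolding dX_def pd_mm[OF assms]
  by (simp add: scaleR_add_right sum.distrib mm.sum_left mm.sum_right mm.scaleR_left mm.scaleR_right)

lemma dX_cong: "x \<in> S \<Longrightarrow> (\<And>y. y \<in> S \<Longrightarrow> A y = B y) \<Longrightarrow> dX A x = dX B x"
  unfolding dX_def using pd_cong[OF open_S, of x A B] by simp

text \<open>The Lie derivatives of \<open>E = g phi\<close> and of \<open>phi\<^sup>2 = 1 - xi \<otimes> eta\<close> combine to
  \<open>T phi\<^sup>2 + phi T phi = 0\<close>; its trace is \<open>2 tr T\<close> because \<open>T xi = 0\<close>.\<close>

lemma trace_N: assumes x: "x \<in> S" shows "trace (N x) = 0"
proof -
  define P where "P = phi x"
  define D where "D = dX phi x"
  define m where "m = M x"
  have gX: "dX g x = 2 *\<^sub>R (g x ** T x) - transpose m ** g x - g x ** m"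
    using lie_T[OF x] unfolding lie_M[OF x] m_def by (simp add: vec_eq_iff field_simps)
  have "dX E x = g x ** D + dX g x ** P"
    using dX_cong[OF x E_phi] dX_mm[OF smooth_g smooth_phi x] by (simp add: D_def P_def)
  then have "g x ** D = dX E x - dX g x ** P" by simp
  also have "\<dots> = - (g x ** P ** m) - 2 *\<^sub>R (g x ** T x ** P) + g x ** m ** P"
    unfolding gX dX_E[OF x] E_phi[OF x] P_def[symmetric] m_def[symmetric]
    by (simp add: matrix_ring_simps)
  finally have "g x ** D = - (g x ** P ** m) - 2 *\<^sub>R (g x ** T x ** P) + g x ** m ** P" .
  then have "ginv x ** (g x ** D) = ginv x ** (- (g x ** P ** m) - 2 *\<^sub>R (g x ** T x ** P) + g x ** m ** P)"
    by simp
  \<comment> \<open>Read invariantly: the Lie derivative \<open>D - m ** P + P ** m\<close> of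
    \<phi> along \<xi> equals \<open>- 2 *\<^sub>R (T x ** P)\<close>.\<close>
  then have D: "D = - (P ** m) - 2 *\<^sub>R (T x ** P) + m ** P"
    by (simp add: matrix_ring_simps ginv x)
  have "dX (\<lambda>y. phi y ** phi y) x = dX (\<lambda>y. mat 1 - outer (xi y) (eta y)) x"
    by (rule dX_cong[OF x phi_phi_eq])
  also have "\<dots> = - (outer (xi x) (dX eta x) + outer (dX xi x) (eta x))"
  proof -
    have so: "smooth_on S (\<lambda>y. outer (xi y) (eta y))"
      by (rule smooth_on_bounded_bilinear[OF open_S bounded_bilinear_outer smooth_xi smooth_eta])
    have "pd k (\<lambda>y. mat 1 - outer (xi y) (eta y)) x = - (outer (xi x) (pd k eta x) + outer (pd k xi x) (eta x))" for k
      using pd_diff[OF smooth_diff[OF smooth_on_const x] smooth_diff[OF so x]]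
        pd_bounded_bilinear[OF bounded_bilinear_outer smooth_diff[OF smooth_xi x] smooth_diff[OF smooth_eta x]]
      by simp
    then show ?thesis
      by (simp add: dX_def scaleR_add_right sum.distrib sum_negf
          bounded_bilinear.sum_left[OF bounded_bilinear_outer] bounded_bilinear.sum_right[OF bounded_bilinear_outer]
          bounded_bilinear.scaleR_left[OF bounded_bilinear_outer] bounded_bilinear.scaleR_right[OF bounded_bilinear_outer]
          scaleR_diff_right sum_subtractf)
  qed
  finally have "P ** D + D ** P = - (outer (xi x) (dX eta x) + outer (dX xi x) (eta x))"
    using dX_mm[OF smooth_phi smooth_phi x] by (simp add: P_def D_def)
  \<comment> \<open>By \<open>dX_xi\<close> and \<open>dX_eta\<close> the two inner products are
    opposite to each other.\<close>
  then have "trace (P ** D + D ** P) = - (xi x \<bullet> dX eta x + dX xi x \<bullet> eta x)"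
    by (simp add: trace_def outer_def inner_vec_def sum.distrib sum_negf sum_subtractf)
  also have "\<dots> = 0"
    unfolding dX_xi dX_eta[OF x]
    by (simp add: dot_lmul_matrix inner_commute[of "xi x"]) (metis dot_lmul_matrix inner_commute)
  finally have "trace (P ** D) = 0"
    unfolding trace_add using trace_mm_commute[of P D] by simp
  moreover have "P ** D = - (P ** P ** m) - 2 *\<^sub>R (P ** T x ** P) + P ** m ** P"
    unfolding D by (simp add: matrix_ring_simps)
  moreover have "trace (P ** m ** P) = trace (P ** P ** m)"
    by (metis trace_mm_commute matrix_mul_assoc)
  moreover have "trace (P ** T x ** P) = trace (T x ** (P ** P))"
    by (metis trace_mm_commute matrix_mul_assoc)
  ultimately have "trace (T x ** (P ** P)) = 0"
    by (simp add: trace_def sum.distrib sum_negf sum_subtractf sum_distrib_left[symmetric])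
  then have "trace (T x) - trace (outer (T x *v xi x) (eta x)) = 0"
    unfolding P_def phi_phi_eq[OF x] by (simp add: mm.diff_right mm_outer trace_sub)
  then show ?thesis by (simp add: T_xi trace_T x trace_outer)
qed

section \<open>Consequences of the soliton equation\<close>

lemma ricci_up_T: assumes x: "x \<in> S" shows "ricci_up g x = lam *\<^sub>R mat 1 - T x"
proof -
  \<comment> \<open>Symmetry of \<open>g x ** T x\<close>, hence of the Ricci tensor, disposes of
    the transpose in \<open>ricci_up_ricci\<close>.\<close>
  have t: "transpose (g x ** T x) = g x ** T x"
    unfolding T_def by (simp add: mm.scaleR_right mm.add_right g_Nadj x transpose_add transpose_scalar add.commute)
  have "ricci g x = lam *\<^sub>R g x - g x ** T x"
    using soliton[OF x] unfolding lie_T[OF x] by (simp add: eq_diff_eq)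
  then have "transpose (ricci g x ** ginv x) = ginv x ** (lam *\<^sub>R g x - g x ** T x)"
    unfolding matrix_transpose_mul by (simp add: transpose_diff transpose_scalar t sym_g sym_ginv x)
  then show ?thesis
    by (simp add: ricci_up_ricci x matrix_ring_simps ginv)
qed

lemma div_T: assumes x: "x \<in> S" shows "div_endo g T x = 0"
proof -
  have "trace (ricci_up g y) = lam * real CARD('n)" if "y \<in> S" for y
    using trace_T[OF that] trace_N[OF that] by (simp add: ricci_up_T[OF that] trace_def sum_subtractf mat_def)
  then have "pd m (\<lambda>y. trace (ricci_up g y)) x = pd m (\<lambda>y. lam * real CARD('n)) x" for m
    by (rule pd_cong[OF open_S x])
  then have r: "div_endo g (ricci_up g) x = 0"
    using contracted_bianchi[OF x] by (simp add: vec_eq_iff)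
  have "div_endo g T x = div_endo g (\<lambda>y. lam *\<^sub>R mat 1 + (-1) *\<^sub>R ricci_up g y) x"
    by (rule div_endo_cong[OF x]) (simp add: ricci_up_T)
  also have "\<dots> = div_endo g (\<lambda>y. lam *\<^sub>R mat 1) x + div_endo g (\<lambda>y. (-1) *\<^sub>R ricci_up g y) x"
    by (intro div_endo_add x smooth_on_const smooth_on_bounded_linear[OF open_S bounded_linear_scaleR_right] smooth_ricci_up)
  also have "\<dots> = 0"
    by (simp only: div_endo_scaleR[OF smooth_on_const x] div_endo_scaleR[OF smooth_ricci_up x] r div_endo_id[OF x])
      simp
  finally show ?thesis .
qed

lemma div_N: assumes x: "x \<in> S" shows "div_endo g N x = lam *\<^sub>R eta x"
proof -
  have "pd j (\<lambda>y. trace (N y)) x = pd j (\<lambda>y. 0) x" for j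
    by (rule pd_cong[OF open_S x trace_N])
  then have "div_endo g N x = ricci g x *v xi x"
    using ricci_identity[OF smooth_xi x] by (simp add: vec_eq_iff)
  also have "ricci g x = lam *\<^sub>R g x - g x ** T x"
    using soliton[OF x] unfolding lie_T[OF x] by (simp add: eq_diff_eq)
  also have "\<dots> *v xi x = lam *\<^sub>R eta x"
    by (simp add: mv.diff_left mv.scaleR_left eta_eq x matrix_vector_mul_assoc[symmetric] T_xi)
  finally show ?thesis .
qed

text \<open>In invariant terms, \<open>tr \<nabla>\<^sup>2 xi = - lam xi\<close>: the vector field \<open>xi\<close> is harmonic.\<close>

lemma div_Nadj: assumes x: "x \<in> S" shows "div_endo g Nadj x = - lam *\<^sub>R eta x"
proof -
  have "div_endo g Nadj x = div_endo g (\<lambda>y. 2 *\<^sub>R T y + (-1) *\<^sub>R N y) x"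
    by (rule div_endo_cong[OF x]) (simp add: T_def)
  also have "\<dots> = div_endo g (\<lambda>y. 2 *\<^sub>R T y) x + div_endo g (\<lambda>y. (-1) *\<^sub>R N y) x"
    by (intro div_endo_add x smooth_on_bounded_linear[OF open_S bounded_linear_scaleR_right] smooth_T smooth_N)
  finally show ?thesis
    by (simp only: div_endo_scaleR[OF smooth_T x] div_endo_scaleR[OF smooth_N x] div_T[OF x] div_N[OF x]) simp
qed

lemma lam_eq: assumes x: "x \<in> S" shows "lam = 1 - real CARD('n)"
proof -
  \<comment> \<open>The field \<open>A y *v xi y\<close> is zero on all of \<open>S\<close>, so its
    divergence drops out of the Leibniz rule \<open>div_endo_mv\<close>.\<close>
  have nab0: "trace (nab g (\<lambda>y. A y *v xi y) x) = 0" if "\<And>y. y \<in> S \<Longrightarrow> A y *v xi y = 0" for A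
    using pd_cong[OF open_S x that] that[OF x] by (simp add: nab_def trace_def)
  note d = smooth_diff[OF smooth_xi x]
  have "lam = div_endo g N x \<bullet> xi x"
    by (simp add: div_N eta_xi x)
  also have "\<dots> = - trace (N x ** N x)"
    using div_endo_mv[OF smooth_N d x] nab0[of N] N_xi by simp
  finally have l: "lam = - trace (N x ** N x)" .
  \<comment> \<open>As \<open>T x\<close> is half the sum of \<open>N x\<close> and
    \<open>Nadj x\<close>, this trades the unknown trace of \<open>Nadj x ** N x\<close> for minus
    that of \<open>N x ** N x\<close>, as the expansion of \<open>phi x ** phi x\<close> below
    requires.\<close>
  have "trace (T x ** N x) = 0"
    using div_endo_mv[OF smooth_T d x] nab0[of T] T_xi div_T[OF x] by simp
  then have 1: "trace (N x ** N x) + trace (Nadj x ** N x) = 0"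
    by (simp add: T_def trace_def mm.scaleR_left mm.add_left sum.distrib sum_divide_distrib[symmetric])
  have 2: "trace (Nadj x ** Nadj x) = trace (N x ** N x)"
  proof -
    have "Nadj x ** Nadj x = ginv x ** transpose (N x) ** (g x ** ginv x) ** transpose (N x) ** g x"
      unfolding Nadj_def by (simp add: matrix_mul_assoc)
    then have "Nadj x ** Nadj x = ginv x ** transpose (N x ** N x) ** g x"
      by (simp add: ginv x matrix_transpose_mul matrix_mul_assoc)
    then have "trace (Nadj x ** Nadj x) = trace (g x ** (ginv x ** transpose (N x ** N x)))"
      using trace_mm_commute by metis
    then show ?thesis by (simp add: matrix_mul_assoc ginv x trace_transpose)
  qed
  have "phi x ** phi x = (1/4) *\<^sub>R (Nadj x ** Nadj x + N x ** N x - Nadj x ** N x - N x ** Nadj x)"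
    unfolding phi_N[OF x] by (simp add: matrix_ring_simps algebra_simps)
  then have "trace (phi x ** phi x) = (trace (Nadj x ** Nadj x) + trace (N x ** N x)
      - trace (Nadj x ** N x) - trace (N x ** Nadj x)) / 4"
    by (simp add: trace_def sum.distrib sum_subtractf sum_divide_distrib[symmetric])
  also have "\<dots> = trace (N x ** N x)"
    using 1 2 trace_mm_commute[of "N x" "Nadj x"] by simp
  finally have "trace (N x ** N x) = trace (mat 1 - outer (xi x) (eta x) :: real^'n^'n)"
    unfolding phi_phi_eq[OF x] by simp
  \<comment> \<open>The subtracted outer product is a projection of rank one, as \<eta>(\<xi>) =
    1.\<close>
  also have "\<dots> = real CARD('n) - 1"
    using eta_xi[OF x] by (simp add: trace_sub trace_outer inner_commute) (simp add: trace_def mat_def)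
  finally show ?thesis using l by simp
qed

end

section \<open>Change of charts\<close>

text \<open>The adjoint of \<open>nab g V x\<close> with respect to \<open>g x\<close>.\<close>

definition nadj :: "(real^'n::finite \<Rightarrow> real^'n^'n) \<Rightarrow> (real^'n \<Rightarrow> real^'n) \<Rightarrow> real^'n \<Rightarrow> real^'n^'n" where
  "nadj g V x = matrix_inv (g x) ** transpose (nab g V x) ** g x"

lemma jacobian_nth: "jacobian f x $ k $ i = pd i f x $ k"
  by (simp add: jacobian_def matrix_def pd_def)

lemma pd_compose:
  fixes \<psi> :: "real^'n::finite \<Rightarrow> real^'m::finite"
  assumes "\<psi> differentiable (at x)" "f differentiable (at (\<psi> x))"
  shows "pd i (\<lambda>y. f (\<psi> y)) x = (\<Sum>a\<in>UNIV. pd i \<psi> x $ a *\<^sub>R pd a f (\<psi> x))"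
proof -
  have "pd i (\<lambda>y. f (\<psi> y)) x = fderiv f (\<psi> x) (pd i \<psi> x)"
    using frechet_derivative_compose[OF assms] by (simp add: pd_def o_def)
  then show ?thesis
    by (simp only: frechet_derivative_pd_sum[OF assms(2)])
qed

lemma smooth_on_subset: "smooth_on S f \<Longrightarrow> T \<subseteq> S \<Longrightarrow> smooth_on T f"
  unfolding smooth_on_def using C_on_subset by blast

lemma matrix_cancel_right:
  fixes A B J :: "real^'n::finite^'n"
  assumes "A ** J = B ** J" "det J \<noteq> 0"
  shows "A = B"
proof -
  have "A ** J ** matrix_inv J = B ** J ** matrix_inv J" using assms(1) by simp
  then show ?thesis by (simp add: matrix_mul_assoc[symmetric] matrix_inv_works assms(2))
qed

lemma trace_conjugate:
  fixes A B J :: "real^'n::finite^'n"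
  assumes "J ** A = B ** J" "det J \<noteq> 0"
  shows "trace A = trace B"
proof -
  have "matrix_inv J ** (J ** A) = A"
    by (simp add: matrix_mul_assoc matrix_inv_works assms(2))
  then have "trace A = trace (matrix_inv J ** (B ** J))"
    by (simp only: assms(1))
  also have "\<dots> = trace ((B ** J) ** matrix_inv J)"
    by (rule trace_mm_commute)
  also have "\<dots> = trace B"
    by (simp add: matrix_mul_assoc[symmetric] matrix_inv_works assms(2))
  finally show ?thesis .
qed

lemma inner_transpose: "u \<bullet> (transpose A *v w) = (A *v u) \<bullet> w" for A :: "real^'n::finite^'m::finite"
  unfolding transpose_matrix_vector inner_commute[of u] dot_lmul_matrix by (rule inner_commute)

lemma nab_column: "nab g V x *v axis i 1 = pd i V x + gamma g i x *v V x"
  by (simp add: vec_eq_iff matrix_vector_mult_basis column_def nab_def)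

context semi_riemannian_chart
begin

text \<open>The horizontal part of the Sasaki metric contributes the trace of the identity, which is
  the dimension. The connection map sends the differential of the section to the columns of
  \<open>nab g V x\<close>, so the vertical part contributes the squared norm of \<nabla>V.\<close>

lemma local_energy_density_eq:
  assumes x: "x \<in> S"
  shows "local_energy_density g V x = (real CARD('n) + trace (nadj g V x ** nab g V x)) / 2"
proof -
  have cm: "connection_map g x (V x) (axis i 1, pd i V x) = nab g V x *v axis i 1" for i
  proof -
    have "(\<Sum>j\<in>UNIV. \<Sum>l\<in>UNIV. christoffel g x k j l * axis i 1 $ j * V x $ l) = (gamma g i x *v V x) $ k" for k
    proof -
      have "(\<Sum>j\<in>UNIV. \<Sum>l\<in>UNIV. christoffel g x k j l * axis i 1 $ j * V x $ l)
          = (\<Sum>j\<in>UNIV. if j = i then \<Sum>l\<in>UNIV. christoffel g x k j l * V x $ l else 0)"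
        by (intro sum.cong refl) (simp add: axis_def)
      then show ?thesis by (simp add: christoffel_gamma mv_nth)
    qed
    then show ?thesis
      unfolding nab_column by (simp add: connection_map_def vec_eq_iff)
  qed
  have el: "(A *v axis i 1) \<bullet> (g x *v (B *v axis j 1)) = (transpose A ** g x ** B) $ i $ j" for i j and A B :: "real^'n^'n"
  proof -
    have "(transpose A ** g x ** B) $ i $ j = axis i 1 \<bullet> ((transpose A ** g x ** B) *v axis j 1)"
      by (simp add: matrix_vector_mult_basis column_def inner_axis')
    also have "\<dots> = axis i 1 \<bullet> (transpose A *v (g x *v (B *v axis j 1)))"
      by (simp only: matrix_vector_mul_assoc matrix_mul_assoc)
    also have "\<dots> = (A *v axis i 1) \<bullet> (g x *v (B *v axis j 1))"
      by (rule inner_transpose)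
    finally show ?thesis ..
  qed
  have tr: "(\<Sum>i\<in>UNIV. \<Sum>j\<in>UNIV. ginv x $ i $ j * A $ i $ j) = trace (ginv x ** A)" for A :: "real^'n^'n"
  proof -
    have "ginv x $ i $ j = ginv x $ j $ i" for i j
      using arg_cong[OF sym_ginv[OF x], of "\<lambda>A. A $ j $ i"] by simp
    then have "(\<Sum>i\<in>UNIV. \<Sum>j\<in>UNIV. ginv x $ i $ j * A $ i $ j) = (\<Sum>i\<in>UNIV. \<Sum>j\<in>UNIV. ginv x $ j $ i * A $ i $ j)"
      by (intro sum.cong refl) simp
    then show ?thesis by (simp add: trace_def mm_nth) (rule sum.swap)
  qed
  have g: "axis i 1 \<bullet> (g x *v axis j 1) = g x $ i $ j" for i j
    by (simp add: matrix_vector_mult_basis column_def inner_axis')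
  have "local_energy_density g V x
      = ((\<Sum>i\<in>UNIV. \<Sum>j\<in>UNIV. ginv x $ i $ j * g x $ i $ j)
        + (\<Sum>i\<in>UNIV. \<Sum>j\<in>UNIV. ginv x $ i $ j * (transpose (nab g V x) ** g x ** nab g V x) $ i $ j)) / 2"
    by (simp add: local_energy_density_def sasaki_def cm el g distrib_left sum.distrib)
  also have "\<dots> = (trace (ginv x ** g x) + trace (nadj g V x ** nab g V x)) / 2"
    unfolding tr nadj_def by (simp add: matrix_mul_assoc)
  finally show ?thesis by (simp add: ginv x trace_I)
qed

end

locale chart_change = c: semi_riemannian_chart U g + d: semi_riemannian_chart S' g'
  for U S' :: "(real^'n::finite) set" and g g' +
  fixes \<psi> :: "real^'n \<Rightarrow> real^'n"
  assumes smooth_psi: "smooth_on U \<psi>" and psi_U: "x \<in> U \<Longrightarrow> \<psi> x \<in> S'"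
    and g_law: "x \<in> U \<Longrightarrow> g x = transpose (jacobian \<psi> x) ** g' (\<psi> x) ** jacobian \<psi> x"
begin

abbreviation "J \<equiv> jacobian \<psi>"

text \<open>The transformation law exhibits the nonzero \<open>det (g x)\<close> as a product with
  \<open>det (J x)\<close> as a factor, so the inverse transition map need not be
  differentiated.\<close>

lemma det_J: assumes x: "x \<in> U" shows "det (J x) \<noteq> 0"
proof -
  have "det (g x) = det (J x) * det (g' (\<psi> x)) * det (J x)"
    by (subst g_law[OF x]) (simp only: det_mul det_transpose)
  then show ?thesis using c.det_g[OF x] by auto
qed

lemma smooth_J: "smooth_on U J"
proof (rule smooth_on_cong[OF c.open_S])
  show "smooth_on U (\<lambda>x. \<chi> k i. pd i \<psi> x $ k)"
    by (intro smooth_on_vec_lambda[OF c.open_S] smooth_on_vec_nth[OF c.open_S] smooth_on_pd smooth_psi)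
qed (simp add: vec_eq_iff jacobian_nth)

lemma pd_J_sym: assumes x: "x \<in> U" shows "pd i J x $ k $ j = pd j J x $ k $ i"
proof -
  have "pd i J x $ k $ j = pd i (pd j \<psi>) x $ k" for i j
  proof -
    have "pd i J x $ k $ j = pd i (\<lambda>y. J y $ k $ j) x"
      by (rule pd_vec_nth2[symmetric, OF c.smooth_diff[OF smooth_J x]])
    then show ?thesis
      by (simp add: jacobian_nth pd_vec_nth[OF c.smooth_diff[OF smooth_on_pd[OF smooth_psi] x]])
  qed
  from this[of i j] this[of j i] show ?thesis
    by (simp only: smooth_on_pd_commute[OF c.open_S smooth_psi x, of i j])
qed

lemma pd_psi_compose:
  assumes "x \<in> U" "f differentiable (at (\<psi> x))"
  shows "pd i (\<lambda>y. f (\<psi> y)) x = (\<Sum>a\<in>UNIV. J x $ a $ i *\<^sub>R pd a f (\<psi> x))"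
  unfolding jacobian_nth by (rule pd_compose[OF c.smooth_diff[OF smooth_psi assms(1)] assms(2)])

text \<open>The connection matrix of \<open>g'\<close> in the direction of the image of the
  \<open>i\<close>-th coordinate vector under \<open>\<psi>\<close>.\<close>

definition "gamma_pull i x = (\<Sum>a\<in>UNIV. J x $ a $ i *\<^sub>R gamma g' a (\<psi> x))"

text \<open>The law for Christoffel symbols is obtained from uniqueness: \<open>B i\<close>, the
  connection matrix that the right-hand side prescribes in the source chart, is torsion-free because
  second derivatives of \<open>\<psi>\<close> commute, and compatible with \<open>g\<close> by the
  product rule on \<open>g_law\<close>. Hence it is \<open>gamma g i x\<close>.\<close>

lemma gamma_change:
  assumes x: "x \<in> U"
  shows "J x ** gamma g i x = pd i J x + gamma_pull i x ** J x"
proof -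
  define G' where "G' = g' (\<psi> x)"
  define L where "L i = pd i J x + gamma_pull i x ** J x" for i
  define B where "B i = matrix_inv (J x) ** L i" for i
  have JB: "J x ** B i = L i" for i
    unfolding B_def by (simp add: matrix_mul_assoc matrix_inv_works det_J x)
  have Lsym: "L i $ k $ j = L j $ k $ i" for i j k
  proof -
    have "(gamma_pull i x ** J x) $ k $ j = (\<Sum>b\<in>UNIV. \<Sum>a\<in>UNIV. J x $ a $ i * gamma g' a (\<psi> x) $ k $ b * J x $ b $ j)" for i j
      by (simp add: gamma_pull_def mm_nth sum_component sum_distrib_right)
    then have "(gamma_pull i x ** J x) $ k $ j = (\<Sum>b\<in>UNIV. \<Sum>a\<in>UNIV. J x $ a $ i * gamma g' a (\<psi> x) $ k $ b * J x $ b $ j)"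
      "(gamma_pull j x ** J x) $ k $ i = (\<Sum>b\<in>UNIV. \<Sum>a\<in>UNIV. J x $ a $ j * gamma g' a (\<psi> x) $ k $ b * J x $ b $ i)"
      by blast+
    moreover have "(\<Sum>b\<in>UNIV. \<Sum>a\<in>UNIV. J x $ a $ j * gamma g' a (\<psi> x) $ k $ b * J x $ b $ i)
        = (\<Sum>a\<in>UNIV. \<Sum>b\<in>UNIV. J x $ a $ j * gamma g' a (\<psi> x) $ k $ b * J x $ b $ i)" by (rule sum.swap)
    moreover have "J x $ a $ j * gamma g' a (\<psi> x) $ k $ b * J x $ b $ i = J x $ b $ i * gamma g' b (\<psi> x) $ k $ a * J x $ a $ j" for a b
      using d.gamma_sym[OF psi_U[OF x], of a k b] by simp
    ultimately have "(gamma_pull i x ** J x) $ k $ j = (gamma_pull j x ** J x) $ k $ i" by simp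
    then show ?thesis using pd_J_sym[OF x, of i k j] by (simp add: L_def)
  qed
  have Bsym: "B i $ k $ j = B j $ k $ i" for i j k
    unfolding B_def mm_nth by (intro sum.cong refl) (simp add: Lsym[of i _ j])
  have G'sym: "transpose G' = G'" unfolding G'_def by (rule d.sym_g[OF psi_U[OF x]])
  have gB: "g x ** B i = transpose (J x) ** G' ** L i" for i
    unfolding g_law[OF x] G'_def[symmetric] by (simp add: matrix_mul_assoc[symmetric] JB)
  have Bg: "transpose (B i) ** g x = transpose (L i) ** G' ** J x" for i
  proof -
    have "transpose (B i) ** g x = transpose (g x ** B i)"
      by (simp add: matrix_transpose_mul c.sym_g x)
    then show ?thesis unfolding gB by (simp add: matrix_transpose_mul G'sym matrix_mul_assoc)
  qed
  have "pd i g x = transpose (B i) ** g x + g x ** B i" for i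
  proof -
    have dg': "g' differentiable (at (\<psi> x))"
      by (rule d.smooth_diff[OF d.smooth_g psi_U[OF x]])
    have dJ: "J differentiable (at x)" by (rule c.smooth_diff[OF smooth_J x])
    have dp: "\<psi> differentiable (at x)" by (rule c.smooth_diff[OF smooth_psi x])
    have dc: "(\<lambda>y. g' (\<psi> y)) differentiable (at x)"
      using differentiable_chain_at[OF dp dg'] by (simp add: o_def)
    have dt: "(\<lambda>y. transpose (J y)) differentiable (at x)"
      by (rule c.smooth_diff[OF smooth_on_bounded_linear[OF c.open_S bounded_linear_transpose smooth_J] x])
    have db: "(\<lambda>y. transpose (J y) ** g' (\<psi> y)) differentiable (at x)"
      using bounded_bilinear.FDERIV[OF bounded_bilinear_matrix_matrix_mult] dt dc
      unfolding differentiable_def by blast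
    have "pd i (\<lambda>y. g' (\<psi> y)) x = (\<Sum>a\<in>UNIV. J x $ a $ i *\<^sub>R (transpose (gamma g' a (\<psi> x)) ** G' + G' ** gamma g' a (\<psi> x)))"
      unfolding pd_psi_compose[OF x dg'] d.pd_g[OF psi_U[OF x]] G'_def ..
    also have "\<dots> = transpose (gamma_pull i x) ** G' + G' ** gamma_pull i x"
    proof -
      have "transpose (gamma_pull i x) = (\<Sum>a\<in>UNIV. J x $ a $ i *\<^sub>R transpose (gamma g' a (\<psi> x)))"
        by (simp add: gamma_pull_def vec_eq_iff sum_component)
      then show ?thesis unfolding gamma_pull_def
        by (simp add: scaleR_add_right sum.distrib mm.sum_left mm.sum_right mm.scaleR_left mm.scaleR_right)
    qed
    finally have p: "pd i (\<lambda>y. g' (\<psi> y)) x = transpose (gamma_pull i x) ** G' + G' ** gamma_pull i x" .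
    have "pd i g x = pd i (\<lambda>y. transpose (J y) ** g' (\<psi> y) ** J y) x"
      by (rule pd_cong[OF c.open_S x g_law])
    also have "\<dots> = transpose (J x) ** g' (\<psi> x) ** pd i J x + pd i (\<lambda>y. transpose (J y) ** g' (\<psi> y)) x ** J x"
      by (rule pd_bounded_bilinear[OF bounded_bilinear_matrix_matrix_mult db dJ])
    also have "pd i (\<lambda>y. transpose (J y) ** g' (\<psi> y)) x
        = transpose (J x) ** pd i (\<lambda>y. g' (\<psi> y)) x + pd i (\<lambda>y. transpose (J y)) x ** g' (\<psi> x)"
      by (rule pd_bounded_bilinear[OF bounded_bilinear_matrix_matrix_mult dt dc])
    also have "pd i (\<lambda>y. transpose (J y)) x = transpose (pd i J x)"
      by (rule pd_bounded_linear[OF bounded_linear_transpose dJ])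
    finally show ?thesis
      unfolding p Bg gB L_def G'_def by (simp add: matrix_ring_simps transpose_simps)
  qed
  then have "B i = gamma g i x"
    by (intro c.gamma_unique[OF x _ Bsym])
  then show ?thesis using JB[of i] by (simp add: L_def)
qed

text \<open>The derivative of the Jacobian produced by the product rule is the inhomogeneous term of
  \<open>gamma_change\<close>, so only the tensorial part survives.\<close>

lemma nab_change:
  assumes x: "x \<in> U" and v: "v differentiable (at x)" and v': "v' differentiable (at (\<psi> x))"
    and law: "\<And>y. y \<in> U \<Longrightarrow> v' (\<psi> y) = J y *v v y"
  shows "nab g' v' (\<psi> x) ** J x = J x ** nab g v x"
proof (rule matrix_eq_columns)
  fix i
  have dJ: "J differentiable (at x)" by (rule c.smooth_diff[OF smooth_J x])
  have Ji: "J x *v axis i 1 = (\<Sum>a\<in>UNIV. J x $ a $ i *\<^sub>R axis a 1)"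
    unfolding matrix_vector_mult_basis
    by (simp add: vec_eq_iff column_def sum_component axis_def if_distrib cong: if_cong)
  have "nab g' v' (\<psi> x) *v (J x *v axis i 1) = (\<Sum>a\<in>UNIV. J x $ a $ i *\<^sub>R (pd a v' (\<psi> x) + gamma g' a (\<psi> x) *v v' (\<psi> x)))"
    unfolding Ji by (simp add: mv.sum_right mv.scaleR_right nab_column)
  also have "\<dots> = (\<Sum>a\<in>UNIV. J x $ a $ i *\<^sub>R pd a v' (\<psi> x)) + gamma_pull i x *v v' (\<psi> x)"
    by (simp add: gamma_pull_def scaleR_add_right sum.distrib mv.sum_left mv.scaleR_left)
  also have "(\<Sum>a\<in>UNIV. J x $ a $ i *\<^sub>R pd a v' (\<psi> x)) = pd i (\<lambda>y. v' (\<psi> y)) x"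
    by (rule pd_psi_compose[OF x v', symmetric])
  also have "\<dots> = pd i (\<lambda>y. J y *v v y) x"
    by (rule pd_cong[OF c.open_S x law])
  also have "\<dots> = J x *v pd i v x + pd i J x *v v x"
    by (rule pd_bounded_bilinear[OF bounded_bilinear_matrix_vector_mult dJ v])
  also have "J x *v pd i v x + pd i J x *v v x + gamma_pull i x *v v' (\<psi> x)
      = J x *v pd i v x + (pd i J x + gamma_pull i x ** J x) *v v x"
    unfolding law[OF x] by (simp add: mv.add_left matrix_vector_mul_assoc)
  also have "\<dots> = J x *v (nab g v x *v axis i 1)"
    unfolding gamma_change[OF x, symmetric] nab_column by (simp add: mv.add_right matrix_vector_mul_assoc)
  finally show "(nab g' v' (\<psi> x) ** J x) *v axis i 1 = (J x ** nab g v x) *v axis i 1"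
    by (simp add: matrix_vector_mul_assoc)
qed

lemma ginv_change:
  assumes x: "x \<in> U"
  shows "J x ** c.ginv x ** transpose (J x) = d.ginv (\<psi> x)"
proof -
  have "(J x ** c.ginv x ** transpose (J x) ** g' (\<psi> x)) ** J x = J x ** (c.ginv x ** g x)"
    by (subst (2) g_law[OF x]) (simp only: matrix_mul_assoc)
  also have "\<dots> = mat 1 ** J x"
    unfolding c.ginv(2)[OF x] by simp
  finally have "J x ** c.ginv x ** transpose (J x) ** g' (\<psi> x) = mat 1"
    by (rule matrix_cancel_right[OF _ det_J[OF x]])
  then have "J x ** c.ginv x ** transpose (J x) ** g' (\<psi> x) = d.ginv (\<psi> x) ** g' (\<psi> x)"
    by (simp add: d.ginv psi_U x)
  then show ?thesis
    by (rule matrix_cancel_right) (rule d.det_g[OF psi_U[OF x]])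
qed

lemma nadj_change:
  assumes x: "x \<in> U" and v: "v differentiable (at x)" and v': "v' differentiable (at (\<psi> x))"
    and law: "\<And>y. y \<in> U \<Longrightarrow> v' (\<psi> y) = J y *v v y"
  shows "J x ** nadj g v x = nadj g' v' (\<psi> x) ** J x"
proof -
  have nc: "nab g' v' (\<psi> x) ** J x = J x ** nab g v x"
    by (rule nab_change[OF x v v' law])
  have "J x ** nadj g v x = J x ** c.ginv x ** transpose (nab g v x) ** (transpose (J x) ** g' (\<psi> x) ** J x)"
    unfolding nadj_def g_law[OF x, symmetric] by (simp add: matrix_mul_assoc)
  also have "\<dots> = J x ** c.ginv x ** transpose (J x ** nab g v x) ** g' (\<psi> x) ** J x"
    by (simp add: matrix_mul_assoc matrix_transpose_mul)
  also have "\<dots> = (J x ** c.ginv x ** transpose (J x)) ** transpose (nab g' v' (\<psi> x)) ** g' (\<psi> x) ** J x"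
    unfolding nc[symmetric] matrix_transpose_mul by (simp only: matrix_mul_assoc)
  finally show ?thesis unfolding ginv_change[OF x] nadj_def .
qed

lemma local_energy_density_change:
  assumes x: "x \<in> U" and v: "v differentiable (at x)" and v': "v' differentiable (at (\<psi> x))"
    and law: "\<And>y. y \<in> U \<Longrightarrow> v' (\<psi> y) = J y *v v y"
  shows "local_energy_density g v x = local_energy_density g' v' (\<psi> x)"
proof -
  have nc: "nab g' v' (\<psi> x) ** J x = J x ** nab g v x"
    by (rule nab_change[OF x v v' law])
  have ac: "J x ** nadj g v x = nadj g' v' (\<psi> x) ** J x"
    by (rule nadj_change[OF x v v' law])
  have "J x ** (nadj g v x ** nab g v x) = nadj g' v' (\<psi> x) ** J x ** nab g v x"
    unfolding ac[symmetric] by (simp add: matrix_mul_assoc)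
  also have "\<dots> = nadj g' v' (\<psi> x) ** (nab g' v' (\<psi> x) ** J x)"
    unfolding nc by (simp add: matrix_mul_assoc)
  finally have "J x ** (nadj g v x ** nab g v x) = nadj g' v' (\<psi> x) ** nab g' v' (\<psi> x) ** J x"
    by (simp add: matrix_mul_assoc)
  then have "trace (nadj g v x ** nab g v x) = trace (nadj g' v' (\<psi> x) ** nab g' v' (\<psi> x))"
    by (rule trace_conjugate) (rule det_J[OF x])
  then show ?thesis
    by (simp add: c.local_energy_density_eq x d.local_energy_density_eq psi_U)
qed

end

section \<open>The divergence theorem for compactly supported fields\<close>

text \<open>Jacobi's formula at the identity matrix, where the Leibniz expansion collapses to one
  permutation; \<open>pd_det\<close> reduces the general case to it.\<close>

lemma has_derivative_det_at_id:
  fixes f :: "'a::real_normed_vector \<Rightarrow> real^'n::finite^'n"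
  assumes f: "(f has_derivative f') (at x)" and fx: "f x = mat 1"
  shows "((\<lambda>y. det (f y)) has_derivative (\<lambda>h. trace (f' h))) (at x)"
proof -
  have d: "((\<lambda>y. f y $ i $ j) has_derivative (\<lambda>h. f' h $ i $ j)) (at x)" for i j
    by (rule bounded_linear.has_derivative[OF bounded_linear_compose[OF bounded_linear_vec_nth bounded_linear_vec_nth] f])
  have "((\<lambda>y. det (f y)) has_derivative (\<lambda>h. \<Sum>p | p permutes (UNIV::'n set). of_int (sign p) *
      (\<Sum>i\<in>UNIV. f' h $ i $ p i * (\<Prod>j\<in>UNIV - {i}. f x $ j $ p j)))) (at x)"
    unfolding det_def by (intro has_derivative_sum has_derivative_mult_right has_derivative_prod d)
  moreover have "(\<Sum>p | p permutes (UNIV::'n set). of_int (sign p) *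
      (\<Sum>i\<in>UNIV. f' h $ i $ p i * (\<Prod>j\<in>UNIV - {i}. f x $ j $ p j))) = trace (f' h)" for h
  proof -
    have "(\<Sum>i\<in>UNIV. f' h $ i $ p i * (\<Prod>j\<in>UNIV - {i}. f x $ j $ p j)) = (if p = id then trace (f' h) else 0)"
      if p: "p permutes (UNIV::'n set)" for p
    proof (cases "p = id")
      case True
      then show ?thesis by (simp add: fx mat_def trace_def)
    next
      case False
      then obtain a where a: "p a \<noteq> a" by (metis eq_id_iff)
      have pp: "p (p a) \<noteq> p a" using a p by (metis permutes_inj inj_eq)
      \<comment> \<open>A permutation other than the identity moves at least two indices,
        \<open>a\<close> and \<open>p a\<close>; deleting one factor still leaves an off-diagonal
        zero.\<close>
      have z: "(\<Prod>j\<in>UNIV - {i}. f x $ j $ p j) = 0" for i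
      proof -
        obtain j where "j \<noteq> i" "p j \<noteq> j" using a pp by metis
        then have "j \<in> UNIV - {i}" "f x $ j $ p j = 0" by (auto simp: fx mat_def)
        then show ?thesis by (intro prod_zero) auto
      qed
      show ?thesis unfolding z using False by simp
    qed
    then have "(\<Sum>p | p permutes (UNIV::'n set). of_int (sign p) *
      (\<Sum>i\<in>UNIV. f' h $ i $ p i * (\<Prod>j\<in>UNIV - {i}. f x $ j $ p j)))
      = (\<Sum>p | p permutes (UNIV::'n set). if p = id then trace (f' h) else 0)"
      by (intro sum.cong refl) (auto simp: sign_id)
    also have "\<dots> = trace (f' h)"
      using permutes_id[of "UNIV::'n set"] finite_permutations[of "UNIV::'n set"] by simp
    finally show ?thesis .
  qed
  ultimately show ?thesis by simp
qed

context semi_riemannian_chart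
begin

section \<open>The volume density and the coordinate divergence\<close>

definition vol :: "real^'n \<Rightarrow> real" where
  "vol x = sqrt \<bar>det (g x)\<bar>"

lemma smooth_vol: "smooth_on S vol"
  unfolding smooth_on_def vol_def[abs_def]
proof
  show "C_on k S (\<lambda>x. sqrt \<bar>det (g x)\<bar>)" for k
    by (rule C_on_compose[OF open_S _ _ C_on_sqrt_abs C_on_det[OF open_S smooth_onD[OF smooth_g]]])
      (auto simp: det_g)
qed

lemma pd_det: assumes x: "x \<in> S" shows "pd i (\<lambda>y. det (g y)) x = 2 * det (g x) * trace (gamma g i x)"
proof -
  have "(g has_derivative fderiv g x) (at x)"
    using smooth_diff[OF smooth_g x] by (simp add: frechet_derivative_works)
  \<comment> \<open>Multiplying by the inverse at the fixed point \<open>x\<close> makes the matrix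
    equal to the identity at \<open>x\<close>.\<close>
  then have "((\<lambda>y. ginv x ** g y) has_derivative (\<lambda>h. ginv x ** fderiv g x h)) (at x)"
    by (rule bounded_linear.has_derivative[OF mm.bounded_linear_right])
  from has_derivative_det_at_id[OF this] have
    "((\<lambda>y. det (ginv x ** g y)) has_derivative (\<lambda>h. trace (ginv x ** fderiv g x h))) (at x)"
    by (simp add: ginv x)
  then have "((\<lambda>y. det (g x) * det (ginv x ** g y)) has_derivative
      (\<lambda>h. det (g x) * trace (ginv x ** fderiv g x h))) (at x)"
    by (rule has_derivative_mult_right)
  moreover have "det (g x) * det (ginv x ** g y) = det (g y)" for y
  proof -
    have "det (g x) * det (ginv x ** g y) = det ((g x ** ginv x) ** g y)"
      by (simp only: det_mul mult.assoc)
    then show ?thesis by (simp add: ginv x)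
  qed
  ultimately have "((\<lambda>y. det (g y)) has_derivative
      (\<lambda>h. det (g x) * trace (ginv x ** fderiv g x h))) (at x)"
    by simp
  then have "pd i (\<lambda>y. det (g y)) x = det (g x) * trace (ginv x ** fderiv g x (axis i 1))"
    by (rule pdI)
  also have "fderiv g x (axis i 1) = transpose (gamma g i x) ** g x + g x ** gamma g i x"
    using pd_g[OF x, of i] by (simp only: pd_def)
  also have "trace (ginv x ** (transpose (gamma g i x) ** g x + g x ** gamma g i x))
      = trace (ginv x ** (transpose (gamma g i x) ** g x)) + trace (gamma g i x)"
    by (simp add: mm.add_right matrix_mul_assoc ginv x trace_add)
  also have "trace (ginv x ** (transpose (gamma g i x) ** g x)) = trace ((transpose (gamma g i x) ** g x) ** ginv x)"
    by (rule trace_mm_commute)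
  also have "(transpose (gamma g i x) ** g x) ** ginv x = transpose (gamma g i x)"
    by (simp add: matrix_mul_assoc[symmetric] ginv x)
  finally show ?thesis by (simp add: trace_transpose)
qed

lemma pd_vol: assumes x: "x \<in> S" shows "pd i vol x = vol x * trace (gamma g i x)"
proof -
  have "C_on 1 S (\<lambda>y. det (g y))" by (intro C_on_det open_S smooth_onD smooth_g)
  then have "((\<lambda>y. det (g y)) has_derivative fderiv (\<lambda>y. det (g y)) x) (at x)"
    using C_on_SucD(1)[OF open_S _ x, of 0] by simp
  from has_derivative_compose[OF this, of "\<lambda>s. sqrt \<bar>s\<bar>"]
  have "((\<lambda>y. sqrt \<bar>det (g y)\<bar>) has_derivative
      (\<lambda>h. sqrt \<bar>det (g x)\<bar> * inverse (det (g x)) / 2 * fderiv (\<lambda>y. det (g y)) x h)) (at x)"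
    using DERIV_sqrt_abs[OF det_g[OF x]] unfolding has_field_derivative_def by blast
  from pdI[OF this, of i] have "pd i vol x = sqrt \<bar>det (g x)\<bar> * inverse (det (g x)) / 2 * pd i (\<lambda>y. det (g y)) x"
    unfolding vol_def[abs_def] pd_def .
  then show ?thesis by (simp add: pd_det[OF x] det_g[OF x] vol_def)
qed

text \<open>By \<open>pd_vol\<close> the density absorbs the connection terms. This turns the
  covariant divergence into a sum of partial derivatives, to which ordinary integration by parts
  applies.\<close>

lemma divergence_vol:
  assumes x: "x \<in> S" and Y: "Y differentiable (at x)"
  shows "(\<Sum>i\<in>UNIV. pd i (\<lambda>y. vol y *\<^sub>R Y y) x $ i) = vol x * trace (nab g Y x)"
proof -
  have "pd i (\<lambda>y. vol y *\<^sub>R Y y) x = vol x *\<^sub>R pd i Y x + (vol x * trace (gamma g i x)) *\<^sub>R Y x" for i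
    using pd_bounded_bilinear[OF bounded_bilinear_scaleR smooth_diff[OF smooth_vol x] Y, of i]
    by (simp add: pd_vol[OF x])
  moreover have "(\<Sum>i\<in>UNIV. (gamma g i x *v Y x) $ i) = (\<Sum>k\<in>UNIV. trace (gamma g k x) * Y x $ k)"
  proof -
    have "(\<Sum>i\<in>UNIV. (gamma g i x *v Y x) $ i) = (\<Sum>i\<in>UNIV. \<Sum>k\<in>UNIV. gamma g k x $ i $ i * Y x $ k)"
      unfolding mv_nth by (intro sum.cong refl arg_cong2[where f = "(*)"] gamma_sym[OF x])
    also have "\<dots> = (\<Sum>k\<in>UNIV. \<Sum>i\<in>UNIV. gamma g k x $ i $ i * Y x $ k)" by (rule sum.swap)
    finally show ?thesis by (simp add: trace_def sum_distrib_right)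
  qed
  moreover have "trace (nab g Y x) = (\<Sum>i\<in>UNIV. pd i Y x $ i) + (\<Sum>i\<in>UNIV. (gamma g i x *v Y x) $ i)"
    by (simp add: trace_def nab_def sum.distrib)
  ultimately show ?thesis
    by (simp add: sum.distrib sum_distrib_left distrib_left mult.assoc)
qed

end

text \<open>Translating \<open>f\<close> along \<open>e\<close> does not change its integral;
  differentiating under the integral sign at time 0 therefore gives zero, without iterated
  integrals.\<close>

lemma integral_pd_compact_support:
  fixes f :: "real^'n::finite \<Rightarrow> real"
  assumes f: "C_on 1 UNIV f" and supp: "\<And>x. x \<notin> cbox a b \<Longrightarrow> f x = 0"
  shows "integral (cbox a b) (pd i f) = 0"
proof -
  define e :: "real^'n" where "e = axis i 1"
  \<comment> \<open>The box grows by 1 on every side, so it still contains the support of every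
    translate by \<open>t *\<^sub>R e\<close> with \<open>\<bar>t\<bar> < 1\<close>.\<close>
  define a' b' where "a' = a - One" and "b' = b + One"
  have f1: "C_on (Suc 0) UNIV f" using f by simp
  note d = C_on_SucD(1)[OF open_UNIV f1, simplified]
  have cf: "continuous_on UNIV f" by (rule C_on_continuous[OF f])
  have cp: "continuous_on UNIV (pd i f)"
    using C_on_pd[OF f1, of i] by simp
  have pd0: "pd i f x = 0" if "x \<notin> cbox a b" for x
  proof -
    have "pd i f x = pd i (\<lambda>x. 0) x"
      by (rule pd_cong[of "- cbox a b"]) (use that supp in \<open>auto simp: closed_cbox\<close>)
    then show ?thesis by simp
  qed
  have int_UNIV: "integral T h = integral UNIV h"
    if "cbox a b \<subseteq> T" "\<And>x. x \<notin> cbox a b \<Longrightarrow> h x = 0" for T and h :: "real^'n \<Rightarrow> real"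
  proof -
    have "integral T h = integral UNIV (\<lambda>x. if x \<in> T then h x else 0)"
      by (rule integral_restrict_UNIV[symmetric])
    also have "(\<lambda>x. if x \<in> T then h x else 0) = h"
    proof
      fix x show "(if x \<in> T then h x else 0) = h x"
        using that(1) that(2)[of x] by (cases "x \<in> cbox a b") auto
    qed
    finally show ?thesis .
  qed
  have const: "integral (cbox a' b') (\<lambda>x. f (x + t *\<^sub>R e)) = integral UNIV f" if t: "\<bar>t\<bar> < 1" for t
  proof -
    have "integral (cbox a' b') (\<lambda>x. f (x + t *\<^sub>R e)) = integral (cbox (a' + t *\<^sub>R e) (b' + t *\<^sub>R e)) f"
      using integral_shift_cbox[of "a' + t *\<^sub>R e" "t *\<^sub>R e" "b' + t *\<^sub>R e" f] by simp
    also have "\<dots> = integral UNIV f"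
    proof (rule int_UNIV[OF _ supp])
      have "\<bar>(t *\<^sub>R e) \<bullet> j\<bar> \<le> 1" if "j \<in> Basis" for j
      proof -
        have "\<bar>e \<bullet> j\<bar> \<le> 1" using Basis_le_norm[OF that, of e] by (simp add: e_def)
        then show ?thesis using t by (simp add: abs_mult mult_le_one)
      qed
      then have lim: "\<And>j. j \<in> Basis \<Longrightarrow> (t *\<^sub>R e) \<bullet> j \<le> 1 \<and> -1 \<le> (t *\<^sub>R e) \<bullet> j"
        by (simp add: abs_le_iff minus_le_iff)
      have "(a' + t *\<^sub>R e) \<bullet> j \<le> a \<bullet> j" "b \<bullet> j \<le> (b' + t *\<^sub>R e) \<bullet> j" if "j \<in> Basis" for j
        using lim[OF that] that unfolding a'_def b'_def by (auto simp: inner_add_left inner_diff_left inner_sum_left_Basis)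
      then show "cbox a b \<subseteq> cbox (a' + t *\<^sub>R e) (b' + t *\<^sub>R e)"
        by (meson mem_box(2) order_trans subsetI)
    qed
    finally show ?thesis .
  qed
  have "((\<lambda>t. integral (cbox a' b') (\<lambda>x. f (x + t *\<^sub>R e))) has_field_derivative
      integral (cbox a' b') (\<lambda>x. pd i f (x + 0 *\<^sub>R e))) (at 0 within {-1<..<1})"
  proof (rule leibniz_rule_field_derivative)
    fix t :: real and x :: "real^'n"
    have "((\<lambda>t. x + t *\<^sub>R e) has_derivative (\<lambda>h. h *\<^sub>R e)) (at t within {-1<..<1})"
      by (auto intro!: derivative_eq_intros)
    from has_derivative_compose[OF this d]
    have "((\<lambda>t. f (x + t *\<^sub>R e)) has_derivative (\<lambda>h. fderiv f (x + t *\<^sub>R e) (h *\<^sub>R e)))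
        (at t within {-1<..<1})" .
    then show "((\<lambda>t. f (x + t *\<^sub>R e)) has_field_derivative pd i f (x + t *\<^sub>R e)) (at t within {-1<..<1})"
      unfolding has_field_derivative_def
      by (rule has_derivative_eq_rhs) (simp add: linear_cmul[OF has_derivative_linear[OF d]] pd_def e_def fun_eq_iff)
  next
    fix t :: real
    show "(\<lambda>x. f (x + t *\<^sub>R e)) integrable_on cbox a' b'"
      by (intro integrable_continuous continuous_on_compose2[OF cf] continuous_intros) auto
  next
    show "continuous_on ({-1<..<1} \<times> cbox a' b') (\<lambda>(t, x). pd i f (x + t *\<^sub>R e))"
      unfolding split_beta by (intro continuous_on_compose2[OF cp] continuous_intros) auto
  qed auto
  then have "((\<lambda>t. integral (cbox a' b') (\<lambda>x. f (x + t *\<^sub>R e))) has_field_derivative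
      integral (cbox a' b') (pd i f)) (at 0)"
    using at_within_open[of 0 "{-1<..<1::real}"] by simp
  moreover have "((\<lambda>t. integral (cbox a' b') (\<lambda>x. f (x + t *\<^sub>R e))) has_field_derivative 0) (at 0)"
    by (rule has_field_derivative_transform_within_open[where S = "{-1<..<1}" and f = "\<lambda>t. integral UNIV f"])
      (auto simp: const)
  ultimately have "integral (cbox a' b') (pd i f) = 0" by (rule DERIV_unique)
  moreover have "integral (cbox a b) (pd i f) = integral UNIV (pd i f)"
    by (rule int_UNIV) (use pd0 in auto)
  moreover have "integral (cbox a' b') (pd i f) = integral UNIV (pd i f)"
  proof (rule int_UNIV)
    have "a' \<bullet> j \<le> a \<bullet> j" "b \<bullet> j \<le> b' \<bullet> j" if "j \<in> Basis" for j
      using that unfolding a'_def b'_def by (auto simp: inner_add_left inner_diff_left inner_sum_left_Basis)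
    then show "cbox a b \<subseteq> cbox a' b'" by (meson mem_box(2) order_trans subsetI)
  qed (use pd0 in auto)
  ultimately show ?thesis by simp
qed

subsection \<open>Bump functions\<close>

text \<open>A cutoff of class C1, but not C2: one derivative is all that the integrations by parts
  below use.\<close>

definition ramp :: "real \<Rightarrow> real" where
  "ramp s = (max 0 s)\<^sup>2"

lemma DERIV_ramp: "(ramp has_field_derivative 2 * max 0 s) (at s)"
proof (cases "s = 0")
  case True
  have "((\<lambda>h. (ramp (0 + h) - ramp 0) / h) \<longlongrightarrow> 0) (at 0)"
  proof (rule tendsto_rabs_zero_cancel, rule tendsto_sandwich[where f = "\<lambda>_. 0" and h = "\<lambda>h. \<bar>h\<bar>"])
    show "\<forall>\<^sub>F h in at 0. \<bar>(ramp (0 + h) - ramp 0) / h\<bar> \<le> \<bar>h\<bar>"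
      by (rule always_eventually) (auto simp: ramp_def max_def power2_eq_square)
    show "((\<lambda>h::real. \<bar>h\<bar>) \<longlongrightarrow> 0) (at 0)"
      by (rule tendsto_rabs_zero) (rule tendsto_ident_at)
  qed auto
  then show ?thesis using True by (simp add: DERIV_def)
next
  case False
  then consider "s > 0" | "s < 0" by linarith
  then show ?thesis
  proof cases
    case 1
    have "((\<lambda>s. s\<^sup>2) has_field_derivative 2 * max 0 s) (at s)"
      using 1 by (auto intro!: derivative_eq_intros)
    then show ?thesis
      by (rule has_field_derivative_transform_within_open[where S = "{0<..}"]) (use 1 in \<open>auto simp: ramp_def\<close>)
  next
    case 2
    have "((\<lambda>s. 0) has_field_derivative 2 * max 0 s) (at s)"
      using 2 by (auto intro!: derivative_eq_intros)
    then show ?thesis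
      by (rule has_field_derivative_transform_within_open[where S = "{..<0}"]) (use 2 in \<open>auto simp: ramp_def\<close>)
  qed
qed

lemma C_on_ramp: "C_on 1 UNIV ramp"
  unfolding One_nat_def
proof (rule C_on_SucI[OF open_UNIV])
  show "(ramp has_derivative (*) (2 * max 0 s)) (at s)" for s
    using DERIV_ramp[of s] by (simp add: has_field_derivative_def)
  show "C_on 0 UNIV (\<lambda>s. 2 * max 0 s * b)" for b :: real
    by (auto intro!: continuous_intros)
qed

text \<open>The inner \<open>ramp\<close> is at least 1 up to radius \<open>r\<close> and 0 from
  radius \<open>2 * r\<close> on; the outer one flattens it to the constant 1 wherever it exceeds
  1.\<close>

definition bump :: "real^'n::finite \<Rightarrow> real \<Rightarrow> real^'n \<Rightarrow> real" where
  "bump a r x = 1 - ramp (1 - ramp (2 - (x - a) \<bullet> (x - a) / r\<^sup>2))"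

lemma C_on_bump: "C_on 1 UNIV (bump a r)"
proof -
  note diff = C_on_diff[OF open_UNIV] and comp = C_on_compose[OF open_UNIV open_UNIV subset_UNIV C_on_ramp]
  have 1: "C_on 1 UNIV (\<lambda>x. x - a)" by (rule diff[OF C_on_id[OF open_UNIV] C_on_const])
  have 2: "C_on 1 UNIV (\<lambda>x. (x - a) \<bullet> (x - a) / r\<^sup>2)"
    by (rule C_on_bounded_linear[OF open_UNIV bounded_linear_divide C_on_inner[OF open_UNIV 1 1]])
  show ?thesis
    unfolding bump_def[abs_def]
    by (rule diff[OF C_on_const comp[OF diff[OF C_on_const comp[OF diff[OF C_on_const 2]]]]])
qed

lemma bump_inside: "r > 0 \<Longrightarrow> dist a x \<le> r \<Longrightarrow> bump a r x = 1"
proof -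
  assume r: "r > 0" and x: "dist a x \<le> r"
  have "(norm (x - a))\<^sup>2 \<le> r\<^sup>2" using x by (intro power_mono) (auto simp: dist_norm norm_minus_commute)
  then have "(x - a) \<bullet> (x - a) / r\<^sup>2 \<le> 1" using r by (simp add: power2_norm_eq_inner)
  then have 1: "1 \<le> 2 - (x - a) \<bullet> (x - a) / r\<^sup>2" by simp
  then have "1 \<le> ramp (2 - (x - a) \<bullet> (x - a) / r\<^sup>2)"
    using power_mono[OF 1, of 2] by (simp add: ramp_def max_def)
  then show ?thesis by (simp add: bump_def ramp_def[of "1 - _"])
qed

lemma bump_outside: "r > 0 \<Longrightarrow> dist a x \<ge> 2 * r \<Longrightarrow> bump a r x = 0"
proof -
  assume r: "r > 0" and x: "dist a x \<ge> 2 * r"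
  have "(2 * r)\<^sup>2 \<le> (norm (x - a))\<^sup>2" using x r by (intro power_mono) (auto simp: dist_norm norm_minus_commute)
  then have "4 \<le> (x - a) \<bullet> (x - a) / r\<^sup>2" using r by (simp add: power2_norm_eq_inner field_simps)
  then have "2 - (x - a) \<bullet> (x - a) / r\<^sup>2 \<le> 0" by linarith
  then have "ramp (2 - (x - a) \<bullet> (x - a) / r\<^sup>2) = 0" by (simp add: ramp_def max_def)
  then show ?thesis by (simp add: bump_def) (simp add: ramp_def)
qed

text \<open>The summands will be the weights of a partition of unity: they add up to 1 as soon as
  one of the bumps equals 1.\<close>

lemma sum_telescoping_prod:
  fixes b :: "nat \<Rightarrow> real"
  shows "(\<Sum>k<N. b k * (\<Prod>j<k. 1 - b j)) = 1 - (\<Prod>j<N. 1 - b j)"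
  by (induction N) (auto simp: algebra_simps)

subsection \<open>Charts\<close>

lemma chart_inv_map [simp]: "is_chart c \<Longrightarrow> p \<in> chart_dom c \<Longrightarrow> chart_inv c (chart_map c p) = p"
  by (simp add: is_chart_def homeomorphism_def)

lemma chart_map_inv [simp]: "is_chart c \<Longrightarrow> x \<in> chart_image c \<Longrightarrow> chart_map c (chart_inv c x) = x"
  by (simp add: is_chart_def homeomorphism_def)

lemma chart_inv_in [simp]: "is_chart c \<Longrightarrow> x \<in> chart_image c \<Longrightarrow> chart_inv c x \<in> chart_dom c"
  unfolding is_chart_def homeomorphism_def by blast

lemma chart_map_in [simp]: "p \<in> chart_dom c \<Longrightarrow> chart_map c p \<in> chart_image c"
  by (simp add: chart_image_def)

lemma open_chart_image: "is_chart c \<Longrightarrow> open (chart_image c)"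
  and open_chart_dom: "is_chart c \<Longrightarrow> open (chart_dom c)"
  and continuous_chart_map: "is_chart c \<Longrightarrow> continuous_on (chart_dom c) (chart_map c)"
  and continuous_chart_inv: "is_chart c \<Longrightarrow> continuous_on (chart_image c) (chart_inv c)"
  unfolding is_chart_def homeomorphism_def by blast+

lemma open_chart_map_image:
  assumes c: "is_chart c" and B: "open B" "B \<subseteq> chart_dom c"
  shows "open (chart_map c ` B)"
proof -
  have "chart_map c ` B = chart_image c \<inter> chart_inv c -` B"
    using B c by (force simp: chart_image_def)
  then show ?thesis
    using continuous_open_preimage[OF continuous_chart_inv[OF c] open_chart_image[OF c] B(1)] by simp
qed

lemma open_chart_inv_image:
  assumes c: "is_chart c" and B: "open B" "B \<subseteq> chart_image c"
  shows "open (chart_inv c ` B)"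
proof -
  have "chart_inv c ` B = chart_dom c \<inter> chart_map c -` B"
  proof (intro equalityI subsetI)
    fix p assume "p \<in> chart_dom c \<inter> chart_map c -` B"
    then have "p = chart_inv c (chart_map c p)" "chart_map c p \<in> B" using c by auto
    then show "p \<in> chart_inv c ` B" by (rule image_eqI)
  qed (use B c in auto)
  then show ?thesis
    using continuous_open_preimage[OF continuous_chart_map[OF c] open_chart_dom[OF c] B(1)] by simp
qed

lemma compact_chart_inv_image:
  "is_chart c \<Longrightarrow> compact B \<Longrightarrow> B \<subseteq> chart_image c \<Longrightarrow> compact (chart_inv c ` B)"
  by (rule compact_continuous_image[OF continuous_on_subset[OF continuous_chart_inv]])

text \<open>\<open>volume_measure\<close> prescribes the measure of Borel sets inside a chart
  domain. Rephrased in \<open>eq\<close> as equality of the restriction of \<open>\<mu>\<close> with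
  a push-forward of weighted Lebesgue measure, it evaluates integrals of functions supported in a
  box of the chart.\<close>

lemma chart_integral:
  fixes A :: "('m::{t2_space,second_countable_topology}, 'n::finite) chart set" and f :: "'m \<Rightarrow> real"
  assumes vol: "volume_measure A g \<mu>" and cA: "c \<in> A" and c: "is_chart c"
    and det: "continuous_on (chart_image c) (\<lambda>x. sqrt \<bar>det (g c x)\<bar>)"
    and box: "cbox a b \<subseteq> chart_image c"
    and supp: "\<And>p. f p \<noteq> 0 \<Longrightarrow> p \<in> chart_dom c \<and> chart_map c p \<in> cbox a b"
    and cont: "continuous_on (cbox a b) (\<lambda>x. f (chart_inv c x))"
  shows "integrable \<mu> f"
    and "integral\<^sup>L \<mu> f = integral (cbox a b) (\<lambda>x. f (chart_inv c x) * sqrt \<bar>det (g c x)\<bar>)"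
proof -
  define S where "S = chart_image c"
  define D where "D = chart_dom c"
  define w where "w x = sqrt \<bar>det (g c x)\<bar>" for x
  define k where "k x = indicator S x * w x" for x
  \<comment> \<open>\<open>chart_inv\<close> is extended by an arbitrary point to a Borel map on the
    whole space; the density \<open>k\<close> vanishes where the extension matters.\<close>
  define h where "h x = (if x \<in> S then chart_inv c x else (SOME p. True))" for x
  have sets: "sets \<mu> = sets borel" using vol by (simp add: volume_measure_def)
  have SB: "S \<in> sets borel" using open_chart_image[OF c] by (simp add: S_def)
  have DB: "D \<in> sets borel" using open_chart_dom[OF c] by (simp add: D_def)
  have k0: "k x \<ge> 0" for x by (simp add: k_def w_def)
  have km[measurable]: "k \<in> borel_measurable borel"
    using borel_measurable_continuous_on_indicator[OF SB det[folded S_def w_def]] by (simp add: k_def[abs_def])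
  have hm[measurable]: "h \<in> borel_measurable borel"
    unfolding h_def[abs_def]
    by (rule borel_measurable_continuous_on_if[OF SB continuous_chart_inv[OF c, folded S_def] continuous_on_const])
  define \<nu> where "\<nu> = density lborel (\<lambda>x. ennreal (k x))"
  \<comment> \<open>\<open>f\<close> is continuous on the compact set \<open>C\<close> and zero
    elsewhere.\<close>
  have fm: "f \<in> borel_measurable borel"
  proof -
    define C where "C = chart_inv c ` cbox a b"
    have CB: "C \<in> sets borel"
      unfolding C_def by (rule borel_closed[OF compact_imp_closed[OF compact_chart_inv_image[OF c compact_cbox box]]])
    have inv: "chart_map c (chart_inv c x) = x" "chart_inv c x \<in> D" if "x \<in> cbox a b" for x
      using that box c by (auto simp: D_def)
    have CD: "C \<subseteq> D" using inv(2) unfolding C_def by blast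
    have "continuous_on C (\<lambda>p. f (chart_inv c (chart_map c p)))"
      by (rule continuous_on_compose2[OF cont continuous_on_subset[OF continuous_chart_map[OF c] CD[unfolded D_def]]])
        (auto simp: C_def inv(1))
    moreover have "f (chart_inv c (chart_map c p)) = f p" if "p \<in> C" for p
      using that CD c by (auto simp: D_def)
    ultimately have "continuous_on C f"
      by (simp cong: continuous_on_cong)
    from borel_measurable_continuous_on_indicator[OF CB this]
    have "(\<lambda>p. indicator C p *\<^sub>R f p) \<in> borel_measurable borel" .
    moreover have "(\<lambda>p. indicator C p *\<^sub>R f p) = f"
    proof
      fix p
      show "indicator C p *\<^sub>R f p = f p"
      proof (cases "f p = 0")
        case False
        then have p: "p \<in> chart_dom c" "chart_map c p \<in> cbox a b" using supp by auto
        then have "chart_inv c (chart_map c p) \<in> C" unfolding C_def by blast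
        then have "p \<in> C" using p(1) c by simp
        then show ?thesis by simp
      qed simp
    qed
    ultimately show ?thesis by simp
  qed
  have fm': "f \<in> borel_measurable \<mu>" using fm sets measurable_cong_sets by blast
  have hS: "h x \<in> D" if "x \<in> S" for x using that c by (simp add: h_def D_def S_def)
  have eq: "density \<mu> (\<lambda>p. ennreal (indicator D p)) = distr \<nu> borel h"
  proof (rule measure_eqI)
    show "sets (density \<mu> (\<lambda>p. ennreal (indicator D p))) = sets (distr \<nu> borel h)"
      by (simp add: sets)
    fix B assume "B \<in> sets (density \<mu> (\<lambda>p. ennreal (indicator D p)))"
    then have B: "B \<in> sets borel" by (simp add: sets)
    have "emeasure (density \<mu> (\<lambda>p. ennreal (indicator D p))) B = (\<integral>\<^sup>+p. ennreal (indicator D p) * indicator B p \<partial>\<mu>)"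
      by (rule emeasure_density) (use B DB sets in auto)
    also have "\<dots> = (\<integral>\<^sup>+p. indicator (D \<inter> B) p \<partial>\<mu>)"
      by (intro nn_integral_cong) (auto simp: indicator_def)
    also have "\<dots> = emeasure \<mu> (D \<inter> B)" using B DB sets by simp
    also have "\<dots> = (\<integral>\<^sup>+x\<in>chart_map c ` (D \<inter> B). ennreal (w x) \<partial>lborel)"
      using vol cA B DB unfolding volume_measure_def w_def by (simp add: D_def)
    also have "\<dots> = (\<integral>\<^sup>+x. ennreal (k x) * indicator (h -` B) x \<partial>lborel)"
    proof (rule nn_integral_cong)
      fix x
      have "x \<in> chart_map c ` (D \<inter> B) \<longleftrightarrow> x \<in> S \<and> h x \<in> B"
      proof
        assume "x \<in> chart_map c ` (D \<inter> B)"
        then show "x \<in> S \<and> h x \<in> B" using c by (auto simp: D_def S_def h_def)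
      next
        assume "x \<in> S \<and> h x \<in> B"
        then have "x = chart_map c (h x)" "h x \<in> D \<inter> B" using c hS by (auto simp: S_def h_def)
        then show "x \<in> chart_map c ` (D \<inter> B)" by blast
      qed
      then show "ennreal (w x) * indicator (chart_map c ` (D \<inter> B)) x = ennreal (k x) * indicator (h -` B) x"
        by (auto simp: indicator_def k_def)
    qed
    also have "\<dots> = emeasure \<nu> (h -` B)"
      unfolding \<nu>_def by (rule emeasure_density[symmetric]) (use measurable_sets_borel[OF hm B] in auto)
    also have "\<dots> = emeasure (distr \<nu> borel h) B"
      by (subst emeasure_distr) (use B in \<open>auto simp: \<nu>_def\<close>)
    finally show "emeasure (density \<mu> (\<lambda>p. ennreal (indicator D p))) B = emeasure (distr \<nu> borel h) B" .
  qed
  have fD: "(\<lambda>p. indicator D p *\<^sub>R f p) = f"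
    by (rule ext) (use supp in \<open>auto simp: indicator_def D_def\<close>)
  have kf: "k x *\<^sub>R f (h x) = indicator (cbox a b) x *\<^sub>R (f (chart_inv c x) * w x)" for x
  proof (cases "x \<in> cbox a b")
    case True
    then show ?thesis using box by (auto simp: k_def h_def S_def)
  next
    case False
    have "f (chart_inv c x) = 0" if "x \<in> S"
      using supp[of "chart_inv c x"] that False c by (auto simp: S_def)
    then show ?thesis using False by (auto simp: k_def h_def indicator_def)
  qed
  have cbox_cont: "continuous_on (cbox a b) (\<lambda>x. f (chart_inv c x) * w x)"
    using cont continuous_on_subset[OF det box] by (auto simp: w_def intro!: continuous_intros)
  have si: "set_integrable lborel (cbox a b) (\<lambda>x. f (chart_inv c x) * w x)"
    unfolding set_integrable_def by (rule borel_integrable_compact[OF compact_cbox cbox_cont])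
  have Dm: "indicator D \<in> borel_measurable \<mu>" using DB sets by simp
  have hm': "h \<in> measurable \<nu> borel" using hm by (simp add: \<nu>_def)
  have fh: "(\<lambda>x. f (h x)) \<in> borel_measurable lborel" using measurable_compose[OF hm fm] by simp
  have "integrable \<mu> f \<longleftrightarrow> integrable (density \<mu> (\<lambda>p. ennreal (indicator D p))) f"
    using integrable_density[OF fm' Dm] unfolding fD by simp
  also have "\<dots> \<longleftrightarrow> integrable \<nu> (\<lambda>x. f (h x))"
    unfolding eq by (rule integrable_distr_eq[OF hm' fm])
  also have "\<dots> \<longleftrightarrow> integrable lborel (\<lambda>x. k x *\<^sub>R f (h x))"
    unfolding \<nu>_def by (rule integrable_density[OF fh]) (use k0 in auto)
  also have "\<dots>" unfolding kf using si by (simp add: set_integrable_def)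
  finally show "integrable \<mu> f" .
  have "integral\<^sup>L \<mu> f = integral\<^sup>L (density \<mu> (\<lambda>p. ennreal (indicator D p))) f"
    using integral_density[OF fm' Dm] unfolding fD by simp
  also have "\<dots> = integral\<^sup>L \<nu> (\<lambda>x. f (h x))"
    unfolding eq by (rule integral_distr[OF hm' fm])
  also have "\<dots> = integral\<^sup>L lborel (\<lambda>x. k x *\<^sub>R f (h x))"
    unfolding \<nu>_def by (rule integral_density[OF fh]) (use k0 in auto)
  also have "\<dots> = integral (cbox a b) (\<lambda>x. f (chart_inv c x) * w x)"
    unfolding kf using set_borel_integral_eq_integral(2)[OF si] by (simp add: set_lebesgue_integral_def)
  finally show "integral\<^sup>L \<mu> f = integral (cbox a b) (\<lambda>x. f (chart_inv c x) * sqrt \<bar>det (g c x)\<bar>)"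
    unfolding w_def .
qed

section \<open>Variations of a vector field in a chart\<close>

locale chart_variation = semi_riemannian_chart S g
  for S :: "(real^'n::finite) set" and g +
  fixes \<epsilon> :: real and W :: "real \<Rightarrow> real^'n \<Rightarrow> real^'n"
  assumes eps: "\<epsilon> > 0" and smooth_W: "smooth_on ({-\<epsilon><..<\<epsilon>} \<times> S) (\<lambda>z. W (fst z) (snd z))"
begin

abbreviation "IS \<equiv> {-\<epsilon><..<\<epsilon>} \<times> S"
abbreviation "Wh z \<equiv> W (fst z) (snd z)"

text \<open>The variation field at time 0. As a directional derivative on time times space it can be
  exchanged with space derivatives by \<open>C_on_2_second_derivative_vec\<close>.\<close>

definition U :: "real^'n \<Rightarrow> real^'n" where
  "U x = fderiv (\<lambda>z. Wh z) (0, x) (1, 0)"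

lemma open_IS: "open IS"
  by (intro open_Times open_S) auto

lemma smooth_on_fd:
  fixes F :: "'b::euclidean_space \<Rightarrow> 'c::real_normed_vector"
  shows "smooth_on T F \<Longrightarrow> b \<in> Basis \<Longrightarrow> smooth_on T (\<lambda>z. fderiv F z b)"
  unfolding smooth_on_def using C_on.simps(2) by blast

lemma Basis_time: "(1::real, 0::real^'n) \<in> Basis"
  by (simp add: Basis_prod_def)

lemma Basis_space: "(0::real, axis i (1::real) :: real^'n) \<in> Basis"
  by (simp add: Basis_prod_def)

lemma time_derivative:
  fixes F :: "real \<times> (real^'n) \<Rightarrow> 'c::real_normed_vector"
  assumes F: "F differentiable (at (t, x))"
  shows "((\<lambda>t. F (t, x)) has_vector_derivative fderiv F (t, x) (1, 0)) (at t)"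
proof -
  have d: "(F has_derivative fderiv F (t, x)) (at (t, x))"
    using F by (simp add: frechet_derivative_works)
  have "((\<lambda>t. (t, x)) has_derivative (\<lambda>h. (h, 0))) (at t)"
    by (auto intro!: derivative_eq_intros)
  from has_derivative_compose[OF this d]
  have "((\<lambda>t. F (t, x)) has_derivative (\<lambda>h. fderiv F (t, x) (h, 0))) (at t)" .
  moreover have "(\<lambda>h. fderiv F (t, x) (h, 0)) = (\<lambda>h. h *\<^sub>R fderiv F (t, x) (1, 0))"
  proof
    fix h
    show "fderiv F (t, x) (h, 0) = h *\<^sub>R fderiv F (t, x) (1, 0)"
      using linear_cmul[OF has_derivative_linear[OF d], of h "(1, 0)"] by (simp only: scaleR_Pair) simp
  qed
  ultimately show ?thesis by (simp only: has_vector_derivative_def)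
qed

lemma space_derivative:
  fixes F :: "real \<times> (real^'n) \<Rightarrow> 'c::real_normed_vector"
  assumes F: "F differentiable (at (t, x))"
  shows "pd i (\<lambda>x. F (t, x)) x = fderiv F (t, x) (0, axis i 1)"
proof -
  have d: "(F has_derivative fderiv F (t, x)) (at (t, x))"
    using F by (simp add: frechet_derivative_works)
  have "((\<lambda>x. (t, x)) has_derivative (\<lambda>h. (0, h))) (at x)"
    by (auto intro!: derivative_eq_intros)
  from has_derivative_compose[OF this d] show ?thesis by (rule pdI)
qed

lemma IS_differentiable: "smooth_on IS F \<Longrightarrow> \<bar>t\<bar> < \<epsilon> \<Longrightarrow> x \<in> S \<Longrightarrow> F differentiable (at (t, x))"
  by (rule smooth_on_differentiable[OF _ open_IS]) auto

lemma smooth_on_snd: "smooth_on S f \<Longrightarrow> smooth_on IS (\<lambda>z. f (snd z))"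
proof -
  assume f: "smooth_on S f"
  have "C_on k IS (\<lambda>z. f (snd z))" for k
    by (rule C_on_compose[OF open_IS open_S _ smooth_onD[OF f] C_on_linear[OF open_IS bounded_linear_snd]]) auto
  then show ?thesis by (simp add: smooth_on_def)
qed

lemma smooth_on_slice: "smooth_on IS f \<Longrightarrow> smooth_on S (\<lambda>x. f (0, x))"
proof -
  assume f: "smooth_on IS f"
  have l: "bounded_linear (\<lambda>x::real^'n. (0::real, x))"
    by (intro bounded_linear_Pair bounded_linear_zero bounded_linear_ident)
  have "C_on k S (\<lambda>x. f (0, x))" for k
    by (rule C_on_compose[OF open_S open_IS _ smooth_onD[OF f] C_on_linear[OF open_S l]]) (use eps in auto)
  then show ?thesis by (simp add: smooth_on_def)
qed

lemma U_derivative: "x \<in> S \<Longrightarrow> ((\<lambda>t. W t x) has_vector_derivative U x) (at 0)"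
  using time_derivative[OF IS_differentiable[OF smooth_W, of 0 x]] eps by (simp add: U_def)

lemma smooth_U: "smooth_on S U"
  unfolding U_def[abs_def]
  by (rule smooth_on_slice[OF smooth_on_fd[OF smooth_W Basis_time]])

text \<open>The covariant derivative of \<open>W t\<close>, built on the product so that it is
  smooth in time and space jointly; \<open>Nh_nab\<close> recovers the slices.\<close>

definition Nh :: "real \<times> (real^'n) \<Rightarrow> real^'n^'n" where
  "Nh z = (\<chi> k i. fderiv (\<lambda>z. Wh z) z (0, axis i 1) $ k + (gamma g i (snd z) *v Wh z) $ k)"

lemma smooth_Nh: "smooth_on IS Nh"
  unfolding Nh_def[abs_def]
  by (intro smooth_on_vec_lambda[OF open_IS] smooth_on_add[OF open_IS] smooth_on_vec_nth[OF open_IS]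
      smooth_on_bounded_bilinear[OF open_IS bounded_bilinear_matrix_vector_mult] smooth_W
      smooth_on_fd[OF smooth_W Basis_space] smooth_on_snd[OF smooth_gamma])

lemma Nh_nab: "\<bar>t\<bar> < \<epsilon> \<Longrightarrow> x \<in> S \<Longrightarrow> Nh (t, x) = nab g (W t) x"
  using space_derivative[OF IS_differentiable[OF smooth_W]] by (simp add: Nh_def nab_def)

definition eh :: "real \<times> (real^'n) \<Rightarrow> real" where
  "eh z = (real CARD('n) + trace (ginv (snd z) ** transpose (Nh z) ** g (snd z) ** Nh z)) / 2"

lemma eh_eq: "\<bar>t\<bar> < \<epsilon> \<Longrightarrow> x \<in> S \<Longrightarrow> local_energy_density g (W t) x = eh (t, x)"
  by (simp add: local_energy_density_eq eh_def nadj_def Nh_nab)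

lemma smooth_eh: "smooth_on IS eh"
proof -
  note mm = smooth_on_bounded_bilinear[OF open_IS bounded_bilinear_matrix_matrix_mult]
  have "smooth_on IS (\<lambda>z. trace (ginv (snd z) ** transpose (Nh z) ** g (snd z) ** Nh z))"
    by (rule smooth_on_bounded_linear[OF open_IS bounded_linear_trace mm[OF mm[OF mm[OF
      smooth_on_snd[OF smooth_ginv] smooth_on_bounded_linear[OF open_IS bounded_linear_transpose smooth_Nh]]
      smooth_on_snd[OF smooth_g]] smooth_Nh]])
  from smooth_on_bounded_linear[OF open_IS bounded_linear_divide smooth_on_add[OF open_IS smooth_on_const this]]
  show ?thesis unfolding eh_def[abs_def] .
qed

definition eh' :: "real \<times> (real^'n) \<Rightarrow> real" where
  "eh' z = fderiv eh z (1, 0)"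

lemma eh_derivative: "\<bar>t\<bar> < \<epsilon> \<Longrightarrow> x \<in> S \<Longrightarrow> ((\<lambda>t. eh (t, x)) has_real_derivative eh' (t, x)) (at t)"
  using time_derivative[OF IS_differentiable[OF smooth_eh]]
  by (simp add: has_real_derivative_iff_has_vector_derivative eh'_def)

lemma continuous_eh: "continuous_on IS eh" and continuous_eh': "continuous_on IS eh'"
  using C_on_continuous[OF smooth_onD[OF smooth_eh]]
    C_on_continuous[OF smooth_onD[OF smooth_on_fd[OF smooth_eh Basis_time]]]
  unfolding eh'_def[abs_def] by auto

text \<open>Time and space derivatives commute and the connection matrices do not depend on
  time.\<close>

lemma Nh_derivative:
  assumes x: "x \<in> S"
  shows "fderiv Nh (0, x) (1, 0) = nab g U x"
proof (rule matrix_eq_columns)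
  fix i
  define P where "P z = fderiv (\<lambda>z. Wh z) z (0, axis i 1)" for z
  have e0: "\<bar>0::real\<bar> < \<epsilon>" using eps by simp
  have sP: "smooth_on IS P"
    unfolding P_def[abs_def] by (rule smooth_on_fd[OF smooth_W Basis_space])
  have a: "((\<lambda>t. Nh (t, x) *v axis i 1) has_vector_derivative
      fderiv Nh (0, x) (1, 0) *v axis i 1) (at 0)"
    by (rule bounded_linear.has_vector_derivative[OF mv.bounded_linear_left
          time_derivative[OF IS_differentiable[OF smooth_Nh e0 x]]])
  have b: "(\<lambda>t. Nh (t, x) *v axis i 1) = (\<lambda>t. P (t, x) + gamma g i x *v W t x)"
    by (simp add: Nh_def P_def vec_eq_iff matrix_vector_mult_basis column_def fun_eq_iff)
  have c: "((\<lambda>t. P (t, x) + gamma g i x *v W t x) has_vector_derivative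
      fderiv P (0, x) (1, 0) + gamma g i x *v U x) (at 0)"
    by (intro has_vector_derivative_add time_derivative[OF IS_differentiable[OF sP e0 x]]
        bounded_linear.has_vector_derivative[OF mv.bounded_linear_right U_derivative[OF x]])
  have 1: "fderiv Nh (0, x) (1, 0) *v axis i 1
      = fderiv P (0, x) (1, 0) + gamma g i x *v U x"
    by (rule vector_derivative_unique_at[OF a[unfolded b] c])
  have "fderiv P (0, x) (1, 0)
      = fderiv (\<lambda>z. fderiv (\<lambda>z. Wh z) z (1, 0)) (0, x) (0, axis i 1)"
    unfolding P_def[abs_def]
    by (rule C_on_2_second_derivative_vec[OF open_IS smooth_onD[OF smooth_W] _ Basis_space Basis_time])
      (use x eps in auto)
  also have "\<dots> = pd i U x"
    unfolding U_def[abs_def]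
    by (rule space_derivative[symmetric, OF IS_differentiable[OF smooth_on_fd[OF smooth_W Basis_time] e0 x]])
  finally show "fderiv Nh (0, x) (1, 0) *v axis i 1 = nab g U x *v axis i 1"
    unfolding 1 nab_column by simp
qed

lemma eh'_0:
  assumes x: "x \<in> S"
  shows "eh' (0, x) = trace (nadj g (W 0) x ** nab g U x)"
proof -
  have e0: "\<bar>0::real\<bar> < \<epsilon>" using eps by simp
  define N where "N = nab g (W 0) x"
  define N' where "N' = nab g U x"
  have dN: "((\<lambda>t. Nh (t, x)) has_derivative (\<lambda>h. h *\<^sub>R N')) (at 0)"
    using time_derivative[OF IS_differentiable[OF smooth_Nh e0 x]]
    by (simp add: has_vector_derivative_def Nh_derivative[OF x] N'_def)
  have N0: "Nh (0, x) = N" using Nh_nab[OF e0 x] by (simp add: N_def)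
  have l: "bounded_linear (\<lambda>X. ginv x ** transpose X ** g x)"
    by (rule bounded_linear_compose[OF mm.bounded_linear_left bounded_linear_compose[OF mm.bounded_linear_right bounded_linear_transpose]])
  have "((\<lambda>t. (ginv x ** transpose (Nh (t, x)) ** g x) ** Nh (t, x)) has_derivative
      (\<lambda>h. (ginv x ** transpose (Nh (0, x)) ** g x) ** (h *\<^sub>R N') + (ginv x ** transpose (h *\<^sub>R N') ** g x) ** Nh (0, x))) (at 0)"
    by (rule mm.FDERIV[OF bounded_linear.has_derivative[OF l dN] dN])
  from bounded_linear.has_derivative[OF bounded_linear_trace this]
  have "((\<lambda>t. trace ((ginv x ** transpose (Nh (t, x)) ** g x) ** Nh (t, x))) has_derivative
      (\<lambda>h. trace ((ginv x ** transpose N ** g x) ** (h *\<^sub>R N') + (ginv x ** transpose (h *\<^sub>R N') ** g x) ** N))) (at 0)"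
    unfolding N0 .
  \<comment> \<open>The two terms of the product rule agree after a transposition and a cyclic
    shift; the resulting factor 2 cancels the half in \<open>eh\<close>.\<close>
  moreover have "trace ((ginv x ** transpose N ** g x) ** (h *\<^sub>R N') + (ginv x ** transpose (h *\<^sub>R N') ** g x) ** N)
      = h * (2 * trace (nadj g (W 0) x ** N'))" for h
  proof -
    have "trace ((ginv x ** transpose N' ** g x) ** N) = trace (transpose ((ginv x ** transpose N' ** g x) ** N))"
      by (simp only: trace_transpose)
    also have "\<dots> = trace ((transpose N ** g x ** N') ** ginv x)"
      by (simp add: matrix_transpose_mul sym_g sym_ginv x matrix_mul_assoc)
    also have "\<dots> = trace (ginv x ** (transpose N ** g x ** N'))" by (rule trace_mm_commute)
    finally have "trace ((ginv x ** transpose N' ** g x) ** N) = trace (nadj g (W 0) x ** N')"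
      by (simp add: nadj_def N_def matrix_mul_assoc)
    moreover have "trace (h *\<^sub>R X) = h * trace X" for X :: "real^'n^'n"
      by (simp add: trace_def sum_distrib_left)
    ultimately show ?thesis
      by (simp add: transpose_scalar mm.scaleR_left mm.scaleR_right trace_add nadj_def N_def[symmetric])
  qed
  ultimately have "((\<lambda>t. trace ((ginv x ** transpose (Nh (t, x)) ** g x) ** Nh (t, x))) has_vector_derivative
      2 * trace (nadj g (W 0) x ** N')) (at 0)"
    by (simp add: has_vector_derivative_def)
  then have "((\<lambda>t. trace ((ginv x ** transpose (Nh (t, x)) ** g x) ** Nh (t, x))) has_real_derivative
      2 * trace (nadj g (W 0) x ** N')) (at 0)"
    by (simp only: has_real_derivative_iff_has_vector_derivative)
  then have "((\<lambda>t. (real CARD('n) + trace ((ginv x ** transpose (Nh (t, x)) ** g x) ** Nh (t, x))) / 2) has_real_derivative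
      trace (nadj g (W 0) x ** N')) (at 0)"
    by (auto intro!: derivative_eq_intros)
  then have "((\<lambda>t. eh (t, x)) has_real_derivative trace (nadj g (W 0) x ** N')) (at 0)"
    by (simp add: eh_def)
  then show ?thesis
    unfolding N'_def by (rule DERIV_unique[OF eh_derivative[OF e0 x]])
qed

text \<open>The length is constant in time, and by symmetry of \<open>g\<close> its time derivative
  is twice this product.\<close>

lemma U_orthogonal:
  assumes x: "x \<in> S" and len: "\<And>t. \<bar>t\<bar> < \<epsilon> \<Longrightarrow> W t x \<bullet> (g x *v W t x) = r"
  shows "U x \<bullet> (g x *v W 0 x) = 0"
proof -
  have dW: "((\<lambda>t. W t x) has_derivative (\<lambda>h. h *\<^sub>R U x)) (at 0)"
    using U_derivative[OF x] by (simp add: has_vector_derivative_def)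
  have "((\<lambda>t. W t x \<bullet> (g x *v W t x)) has_derivative
      (\<lambda>h. W 0 x \<bullet> (g x *v (h *\<^sub>R U x)) + (h *\<^sub>R U x) \<bullet> (g x *v W 0 x))) (at 0)"
    by (rule has_derivative_inner[OF dW bounded_linear.has_derivative[OF mv.bounded_linear_right dW]])
  moreover have "((\<lambda>t. W t x \<bullet> (g x *v W t x)) has_derivative (\<lambda>h. 0)) (at 0)"
    by (rule has_derivative_transform_within_open[where s = "{-\<epsilon><..<\<epsilon>}" and f = "\<lambda>t. r"])
      (use eps len in auto)
  ultimately have "(\<lambda>h. W 0 x \<bullet> (g x *v (h *\<^sub>R U x)) + (h *\<^sub>R U x) \<bullet> (g x *v W 0 x)) = (\<lambda>h. 0)"
    by (rule has_derivative_unique)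
  from fun_cong[OF this, of 1] have "W 0 x \<bullet> (g x *v U x) + U x \<bullet> (g x *v W 0 x) = 0" by simp
  moreover have "W 0 x \<bullet> (g x *v U x) = U x \<bullet> (g x *v W 0 x)"
    using inner_transpose[of "W 0 x" "g x" "U x"] by (simp only: sym_g[OF x] inner_commute)
  ultimately show ?thesis by simp
qed

lemma U_zero:
  assumes x: "x \<in> S" and const: "\<And>t. \<bar>t\<bar> < \<epsilon> \<Longrightarrow> W t x = v"
  shows "U x = 0"
proof -
  have "((\<lambda>t. W t x) has_vector_derivative 0) (at 0)"
    by (rule has_vector_derivative_transform_within_open[where S = "{-\<epsilon><..<\<epsilon>}" and f = "\<lambda>t. v"])
      (use eps const in auto)
  then show ?thesis by (rule vector_derivative_unique_at[OF U_derivative[OF x]])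
qed

end

section \<open>Semi-Riemannian manifolds\<close>

locale semi_riemannian_manifold =
  fixes A :: "('m::{t2_space,second_countable_topology}, 'n::finite) chart set"
    and g :: "('m, 'n, real^'n^'n) components"
  assumes atlas: "smooth_atlas A" and metric: "semi_riemannian_metric A g"
begin

lemma chart: "c \<in> A \<Longrightarrow> is_chart c"
  using atlas by (simp add: smooth_atlas_def)

lemma chart_at: obtains c where "c \<in> A" "p \<in> chart_dom c"
  using atlas unfolding smooth_atlas_def by blast

lemma chart_metric:
  assumes "c \<in> A" shows "semi_riemannian_chart (chart_image c) (g c)"
  using assms metric open_chart_image[OF chart[OF assms]]
  by unfold_locales (auto simp: semi_riemannian_metric_def bilinear_field_def tensor_field_def)

abbreviation "overlap c d \<equiv> chart_map c ` (chart_dom c \<inter> chart_dom d)"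

lemma open_overlap: "c \<in> A \<Longrightarrow> d \<in> A \<Longrightarrow> open (overlap c d)"
  by (intro open_chart_map_image chart open_Int open_chart_dom) auto

lemma overlap_subset: "overlap c d \<subseteq> chart_image c"
  by auto

lemma overlapD:
  assumes "c \<in> A" "d \<in> A" "x \<in> overlap c d"
  shows "chart_inv c x \<in> chart_dom c" "chart_inv c x \<in> chart_dom d"
    "chart_map c (chart_inv c x) = x" "chart_map d (chart_inv c x) = transition c d x"
    "transition c d x \<in> chart_image d" "chart_inv d (transition c d x) = chart_inv c x"
  using assms chart[OF assms(1)] chart[OF assms(2)] by (auto simp: transition_def)

lemma smooth_transition: "c \<in> A \<Longrightarrow> d \<in> A \<Longrightarrow> smooth_on (overlap c d) (transition c d)"
  using atlas by (simp add: smooth_atlas_def)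

lemma chart_change:
  assumes c: "c \<in> A" and d: "d \<in> A"
  shows "chart_change (overlap c d) (chart_image d) (g c) (g d) (transition c d)"
proof -
  interpret sc: semi_riemannian_chart "chart_image c" "g c" by (rule chart_metric[OF c])
  interpret sd: semi_riemannian_chart "chart_image d" "g d" by (rule chart_metric[OF d])
  show ?thesis
  proof
    show "open (overlap c d)" by (rule open_overlap[OF c d])
    show "smooth_on (overlap c d) (g c)" by (rule smooth_on_subset[OF sc.smooth_g overlap_subset])
    show "transpose (g c x) = g c x" "det (g c x) \<noteq> 0" if "x \<in> overlap c d" for x
      using sc.sym_g sc.det_g that by auto
    show "smooth_on (overlap c d) (transition c d)" by (rule smooth_transition[OF c d])
    fix x assume x: "x \<in> overlap c d"
    note o = overlapD[OF c d x]
    show "transition c d x \<in> chart_image d" by (rule o)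
    have "\<forall>p\<in>chart_dom c \<inter> chart_dom d. g c (chart_map c p)
        = transpose (jacobian (transition c d) (chart_map c p)) ** g d (chart_map d p) ** jacobian (transition c d) (chart_map c p)"
      using metric c d unfolding semi_riemannian_metric_def bilinear_field_def tensor_field_def by blast
    from bspec[OF this, of "chart_inv c x"] o
    show "g c x = transpose (jacobian (transition c d) x) ** g d (transition c d x) ** jacobian (transition c d) x"
      by simp
  qed
qed

lemma vector_field_smooth: "vector_field A V \<Longrightarrow> c \<in> A \<Longrightarrow> smooth_on (chart_image c) (V c)"
  by (simp add: vector_field_def tensor_field_def)

lemma vector_field_law:
  assumes V: "vector_field A V" and c: "c \<in> A" and d: "d \<in> A" and x: "x \<in> overlap c d"
  shows "V d (transition c d x) = jacobian (transition c d) x *v V c x"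
proof -
  note o = overlapD[OF c d x]
  have "\<forall>p\<in>chart_dom c \<inter> chart_dom d. V d (chart_map d p) = jacobian (transition c d) (chart_map c p) *v V c (chart_map c p)"
    using V c d unfolding vector_field_def tensor_field_def by blast
  from bspec[OF this, of "chart_inv c x"] o show ?thesis by simp
qed

text \<open>\<open>energy_density\<close> evaluates in a chart picked by \<open>SOME\<close>;
  invariance under change of charts frees it from this choice, so that integrals can be computed in
  the charts of a partition of unity.\<close>

lemma energy_density_chart:
  assumes V: "vector_field A V" and c: "c \<in> A" and p: "p \<in> chart_dom c"
  shows "energy_density A g V p = local_energy_density (g c) (V c) (chart_map c p)"
proof -
  define d where "d = (SOME c. c \<in> A \<and> p \<in> chart_dom c)"
  have d: "d \<in> A" "p \<in> chart_dom d"
    unfolding d_def using someI[of "\<lambda>c. c \<in> A \<and> p \<in> chart_dom c" c] c p by auto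
  interpret chart_change "overlap c d" "chart_image d" "g c" "g d" "transition c d"
    by (rule chart_change[OF c d(1)])
  have x: "chart_map c p \<in> overlap c d" using p d by blast
  have t: "transition c d (chart_map c p) = chart_map d p"
    using chart[OF c] p by (simp add: transition_def)
  have "local_energy_density (g c) (V c) (chart_map c p) = local_energy_density (g d) (V d) (transition c d (chart_map c p))"
  proof (rule local_energy_density_change[OF x _ _ vector_field_law[OF V c d(1)]])
    show "V c differentiable at (chart_map c p)"
      by (rule smooth_on_differentiable[OF vector_field_smooth[OF V c] open_chart_image[OF chart[OF c]]]) (use p in auto)
    show "V d differentiable at (transition c d (chart_map c p))"
      by (rule smooth_on_differentiable[OF vector_field_smooth[OF V d(1)] open_chart_image[OF chart[OF d(1)]]]) (use d t in auto)
  qed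
  then show ?thesis unfolding t energy_density_def d_def[symmetric] by (simp add: Let_def)
qed

subsection \<open>Partitions of unity\<close>

definition C1 :: "('m \<Rightarrow> real) \<Rightarrow> bool" where
  "C1 f \<longleftrightarrow> (\<forall>c\<in>A. C_on 1 (chart_image c) (\<lambda>x. f (chart_inv c x)))"

lemma C1_bump:
  assumes c: "c \<in> A" and r: "r > 0" and ball: "cball a (2 * r) \<subseteq> chart_image c"
  shows "C1 (\<lambda>p. if p \<in> chart_dom c then bump a r (chart_map c p) else 0)" (is "C1 ?f")
  unfolding C1_def
proof (intro ballI C_on_local)
  fix d assume d: "d \<in> A"
  show "open (chart_image d)" by (rule open_chart_image[OF chart[OF d]])
  fix x assume x: "x \<in> chart_image d"
  note cd = chart[OF c] chart[OF d]
  show "\<exists>T. open T \<and> x \<in> T \<and> C_on 1 T (\<lambda>x. ?f (chart_inv d x))"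
  proof (cases "chart_inv d x \<in> chart_dom c")
    case True
    then have xo: "x \<in> overlap d c" using x cd by (intro image_eqI[of _ _ "chart_inv d x"]) auto
    have "C_on 1 (overlap d c) (\<lambda>y. bump a r (transition d c y))"
      by (rule C_on_compose[OF open_overlap[OF d c] open_UNIV subset_UNIV C_on_bump smooth_onD[OF smooth_transition[OF d c]]])
    then have "C_on 1 (overlap d c) (\<lambda>x. ?f (chart_inv d x))"
      by (rule C_on_cong[OF open_overlap[OF d c], rotated]) (use overlapD[OF d c] in auto)
    then show ?thesis using xo open_overlap[OF d c] by blast
  next
    case False
    \<comment> \<open>Outside the chart of the bump: the image of the closed ball is compact, hence
      closed in the Hausdorff space, so the function is zero near the point.\<close>
    define C where "C = chart_inv c ` cball a (2 * r)"
    have "closed C" unfolding C_def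
      by (rule compact_imp_closed[OF compact_chart_inv_image[OF cd(1) compact_cball ball]])
    then have oC: "open (chart_dom d - C)" using open_chart_dom[OF cd(2)] by (rule open_Diff[rotated])
    have CD: "C \<subseteq> chart_dom c" using ball cd(1) by (auto simp: C_def)
    define T where "T = chart_map d ` (chart_dom d - C)"
    have oT: "open T" unfolding T_def by (rule open_chart_map_image[OF cd(2) oC]) auto
    have xT: "x \<in> T" unfolding T_def
      by (rule image_eqI[of _ _ "chart_inv d x"]) (use x cd CD False in auto)
    have "?f (chart_inv d y) = 0" if yT: "y \<in> T" for y
    proof -
      obtain q where q: "q \<in> chart_dom d" "q \<notin> C" "y = chart_map d q" using yT unfolding T_def by blast
      have "bump a r (chart_map c q) = 0" if qc: "q \<in> chart_dom c"
      proof (rule bump_outside[OF r], rule ccontr)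
        assume "\<not> 2 * r \<le> dist a (chart_map c q)"
        then have "chart_map c q \<in> cball a (2 * r)" by simp
        then have "chart_inv c (chart_map c q) \<in> C" unfolding C_def by (rule imageI)
        then show False using q(2) qc cd(1) by simp
      qed
      then show ?thesis using q cd by simp
    qed
    then have "C_on 1 T (\<lambda>x. ?f (chart_inv d x))"
      by (intro C_on_cong[OF oT _ C_on_const[of 1 T 0]]) auto
    then show ?thesis using oT xT by blast
  qed
qed

text \<open>By compactness finitely many bumps suffice. The weights add up to 1 on an open
  neighbourhood \<open>Q\<close> of \<open>K\<close>, so that the differential of their sum vanishes
  on \<open>K\<close>.\<close>

lemma partition_of_unity:
  assumes K: "compact K"
  obtains N :: nat and cs :: "nat \<Rightarrow> ('m, 'n) chart" and a b :: "nat \<Rightarrow> real^'n"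
    and \<rho> :: "nat \<Rightarrow> 'm \<Rightarrow> real" and Q
  where "open Q" "K \<subseteq> Q" "\<And>k. k < N \<Longrightarrow> cs k \<in> A"
    "\<And>k. k < N \<Longrightarrow> cbox (a k) (b k) \<subseteq> chart_image (cs k)" "\<And>k. k < N \<Longrightarrow> C1 (\<rho> k)"
    "\<And>k p. k < N \<Longrightarrow> \<rho> k p \<noteq> 0 \<Longrightarrow> p \<in> chart_dom (cs k) \<and> chart_map (cs k) p \<in> cbox (a k) (b k)"
    "\<And>p. p \<in> Q \<Longrightarrow> (\<Sum>k<N. \<rho> k p) = 1"
proof -
  \<comment> \<open>Each point gets a chart, a box in its image over which integrals are taken, and
    a radius whose double still fits into the box, since the bump lives on the doubled ball.\<close>
  have "\<forall>p. \<exists>c a b r. c \<in> A \<and> cbox a b \<subseteq> chart_image c \<and> r > 0 \<and>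
      cball (chart_map c p) (2 * r) \<subseteq> cbox a b \<and> p \<in> chart_dom c"
  proof
    fix p
    obtain c where c: "c \<in> A" "p \<in> chart_dom c" by (rule chart_at)
    obtain a b where ab: "cbox a b \<subseteq> chart_image c" "chart_map c p \<in> box a b"
      using open_contains_cbox[OF open_chart_image[OF chart[OF c(1)]] chart_map_in[OF c(2)]] by metis
    obtain s where s: "s > 0" "cball (chart_map c p) s \<subseteq> box a b"
      using open_contains_cball open_box ab(2) by blast
    show "\<exists>c a b r. c \<in> A \<and> cbox a b \<subseteq> chart_image c \<and> r > 0 \<and>
        cball (chart_map c p) (2 * r) \<subseteq> cbox a b \<and> p \<in> chart_dom c"
      using c ab s box_subset_cbox[of a b]
      by (intro exI[of _ c] exI[of _ a] exI[of _ b] exI[of _ "s/2"]) auto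
  qed
  then obtain c a b r where P0: "\<forall>p. c p \<in> A \<and> cbox (a p) (b p) \<subseteq> chart_image (c p) \<and> r p > 0 \<and>
      cball (chart_map (c p) p) (2 * r p) \<subseteq> cbox (a p) (b p) \<and> p \<in> chart_dom (c p)"
    unfolding choice_iff by blast
  define z where "z p = chart_map (c p) p" for p
  have P: "\<And>p. c p \<in> A" "\<And>p. cbox (a p) (b p) \<subseteq> chart_image (c p)" "\<And>p. r p > 0"
    "\<And>p. cball (z p) (2 * r p) \<subseteq> cbox (a p) (b p)" "\<And>p. p \<in> chart_dom (c p)" "\<And>p. z p = chart_map (c p) p"
    using P0 by (simp_all add: z_def)
  define Op where "Op p = chart_inv (c p) ` ball (z p) (r p)" for p
  have ball_sub: "ball (z p) (r p) \<subseteq> cball (z p) (2 * r p)" for p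
    using P(3)[of p] by (auto simp: less_imp_le)
  have ball_im: "ball (z p) (r p) \<subseteq> chart_image (c p)" for p
    using ball_sub P(4) P(2) by blast
  have opOp: "open (Op p)" for p
    unfolding Op_def by (rule open_chart_inv_image[OF chart[OF P(1)] open_ball ball_im])
  have inOp: "p \<in> Op p" for p
    unfolding Op_def by (rule image_eqI[of _ _ "z p"]) (use P(3)[of p] chart[OF P(1)[of p]] P(5)[of p] in \<open>auto simp: P(6)\<close>)
  obtain F where F: "F \<subseteq> K" "finite F" "K \<subseteq> (\<Union>p\<in>F. Op p)"
    by (rule compactE_image[OF K, of K Op]) (use opOp inOp in auto)
  obtain e where e: "bij_betw e {..<card F} F"
    using ex_bij_betw_nat_finite[OF F(2)] by (auto simp: atLeast0LessThan)
  define N where "N = card F"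
  define \<beta> where "\<beta> k p = (if p \<in> chart_dom (c (e k)) then bump (z (e k)) (r (e k)) (chart_map (c (e k)) p) else 0)" for k p
  \<comment> \<open>Telescoping weights avoid dividing by the sum of the bumps, which may vanish
    away from \<open>Q\<close>.\<close>
  define \<rho> where "\<rho> k p = \<beta> k p * (\<Prod>j<k. 1 - \<beta> j p)" for k p
  define Q where "Q = (\<Union>p\<in>F. Op p)"
  have C1_beta: "C_on 1 (chart_image d) (\<lambda>x. \<beta> k (chart_inv d x))" if "d \<in> A" for k d
    using C1_bump[OF P(1) P(3) order_trans[OF P(4) P(2)], of "e k"] that unfolding C1_def \<beta>_def by blast
  show thesis
  proof (rule that[of Q N "\<lambda>k. c (e k)" "\<lambda>k. a (e k)" "\<lambda>k. b (e k)" \<rho>])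
    show "open Q" unfolding Q_def using opOp by blast
    show "K \<subseteq> Q" unfolding Q_def by (rule F)
    show "c (e k) \<in> A" for k by (rule P)
    show "cbox (a (e k)) (b (e k)) \<subseteq> chart_image (c (e k))" for k by (rule P)
    show "C1 (\<rho> k)" for k
      unfolding C1_def
    proof
      fix d assume d: "d \<in> A"
      note o = open_chart_image[OF chart[OF d]]
      have "C_on 1 (chart_image d) (\<lambda>x. \<Prod>j<k. 1 - \<beta> j (chart_inv d x))"
        by (rule C_on_prod[OF o C_on_diff[OF o C_on_const C1_beta[OF d]]])
      from C_on_mult[OF o C1_beta[OF d] this]
      show "C_on 1 (chart_image d) (\<lambda>x. \<rho> k (chart_inv d x))" unfolding \<rho>_def .
    qed
    show "p \<in> chart_dom (c (e k)) \<and> chart_map (c (e k)) p \<in> cbox (a (e k)) (b (e k))" if "\<rho> k p \<noteq> 0" for k p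
    proof -
      have "\<beta> k p \<noteq> 0" using that by (auto simp: \<rho>_def)
      then have 1: "p \<in> chart_dom (c (e k))" "bump (z (e k)) (r (e k)) (chart_map (c (e k)) p) \<noteq> 0"
        by (auto simp: \<beta>_def split: if_splits)
      then have "chart_map (c (e k)) p \<in> cball (z (e k)) (2 * r (e k))"
        using bump_outside[OF P(3)[of "e k"], of "z (e k)" "chart_map (c (e k)) p"] by fastforce
      then show ?thesis using 1 P(4) by blast
    qed
    show "(\<Sum>k<N. \<rho> k p) = 1" if pQ: "p \<in> Q" for p
    proof -
      obtain q where q: "q \<in> F" "p \<in> Op q" using pQ unfolding Q_def by blast
      obtain j where j: "j < N" "e j = q"
        using e q(1) unfolding bij_betw_def N_def by (metis imageE lessThan_iff)
      obtain x where x: "x \<in> ball (z q) (r q)" "p = chart_inv (c q) x" using q(2) unfolding Op_def by blast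
      have xi: "x \<in> chart_image (c q)" using x(1) ball_im by blast
      then have "p \<in> chart_dom (c q)" "chart_map (c q) p = x" using x(2) chart[OF P(1)[of q]] by auto
      then have "\<beta> j p = 1"
        using bump_inside[OF P(3)[of q], of "z q" x] x(1) by (simp add: \<beta>_def j(2))
      then have "(\<Prod>j<N. 1 - \<beta> j p) = 0" using j(1) by (intro prod_zero) auto
      then show ?thesis using sum_telescoping_prod[of "\<lambda>k. \<beta> k p" N] by (simp add: \<rho>_def)
    qed
  qed
qed

subsection \<open>Integration by parts\<close>

lemma integral_parts_chart:
  assumes c: "c \<in> A" and box: "cbox a b \<subseteq> chart_image c"
    and Y: "C_on 1 (chart_image c) Y" and X: "C_on 1 (chart_image c) X"
    and supp: "\<And>x. x \<in> chart_image c \<Longrightarrow> X x \<noteq> 0 \<Longrightarrow> x \<in> cbox a b"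
  shows "integral (cbox a b) (\<lambda>x. X x * (\<Sum>i\<in>UNIV. pd i (\<lambda>y. sqrt \<bar>det (g c y)\<bar> *\<^sub>R Y y) x $ i))
      = - integral (cbox a b) (\<lambda>x. fderiv X x (Y x) * sqrt \<bar>det (g c x)\<bar>)"
proof -
  interpret semi_riemannian_chart "chart_image c" "g c" by (rule chart_metric[OF c])
  define S where "S = chart_image c"
  have oS: "open S" unfolding S_def by (rule open_S)
  define wY where "wY y = vol y *\<^sub>R Y y" for y
  \<comment> \<open>Extension by zero to the whole space; it stays C1 because it vanishes off a
    closed box inside the chart image.\<close>
  define F where "F x = (if x \<in> S then X x *\<^sub>R wY x else 0)" for x
  have CwY: "C_on 1 S wY"
    unfolding wY_def[abs_def] S_def by (rule C_on_scaleR[OF open_S smooth_onD[OF smooth_vol] Y])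
  have CX: "C_on 1 S X" using X by (simp add: S_def)
  have CXw: "C_on 1 S (\<lambda>x. X x *\<^sub>R wY x)" by (rule C_on_scaleR[OF oS CX CwY])
  have F0: "F x = 0" if "x \<notin> cbox a b" for x
    using supp that by (auto simp: F_def S_def)
  have CF: "C_on 1 UNIV F"
  proof (rule C_on_local[OF open_UNIV])
    fix x
    show "\<exists>T. open T \<and> x \<in> T \<and> C_on 1 T F"
    proof (cases "x \<in> S")
      case True
      have "C_on 1 S F" by (rule C_on_cong[OF oS _ CXw]) (simp add: F_def)
      then show ?thesis using oS True by blast
    next
      case False
      have o: "open (- cbox a b)" using closed_cbox by blast
      have "C_on 1 (- cbox a b) F" by (rule C_on_cong[OF o _ C_on_const[of 1 _ 0]]) (simp add: F0)
      then show ?thesis using o False box by (auto simp: S_def)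
    qed
  qed
  have z: "integral (cbox a b) (pd i (\<lambda>x. F x $ i)) = 0" for i
    by (rule integral_pd_compact_support[OF C_on_vec_nth[OF open_UNIV CF]]) (simp add: F0)
  have cont: "continuous_on (cbox a b) (pd i f)" if "C_on 1 S f" for i and f :: "real^'n \<Rightarrow> 'b::real_normed_vector"
    using continuous_on_subset[OF C_on_continuous[OF C_on_pd[of 0 S f i]] box[folded S_def]] that by simp
  have cX: "continuous_on (cbox a b) X"
    by (rule continuous_on_subset[OF C_on_continuous[OF CX] box[folded S_def]])
  have cwY: "continuous_on (cbox a b) wY"
    by (rule continuous_on_subset[OF C_on_continuous[OF CwY] box[folded S_def]])
  have ppd: "pd i (\<lambda>x. F x $ i) x = X x * pd i wY x $ i + pd i X x * wY x $ i" if "x \<in> cbox a b" for x i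
  proof -
    have x: "x \<in> S" using that box by (auto simp: S_def)
    have d: "X differentiable at x" "wY differentiable at x"
      using C_on_differentiable[OF oS _ x, of 0] CX CwY by auto
    have "pd i (\<lambda>x. F x $ i) x = pd i (\<lambda>x. X x *\<^sub>R wY x $ i) x"
      by (rule pd_cong[OF oS x]) (simp add: F_def)
    also have "\<dots> = X x *\<^sub>R pd i (\<lambda>x. wY x $ i) x + pd i X x *\<^sub>R wY x $ i"
      by (rule pd_bounded_bilinear[OF bounded_bilinear_scaleR d(1)],
          rule C_on_differentiable[OF oS _ x, of 0]) (use C_on_vec_nth[OF oS CwY] in simp)
    finally show ?thesis by (simp add: pd_vec_nth[OF d(2)])
  qed
  have i1: "(\<lambda>x. X x * (\<Sum>i\<in>UNIV. pd i wY x $ i)) integrable_on cbox a b"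
    by (rule integrable_continuous) (intro continuous_intros cX cont[OF CwY])
  have i2: "(\<lambda>x. \<Sum>i\<in>UNIV. pd i X x * wY x $ i) integrable_on cbox a b"
    by (rule integrable_continuous) (intro continuous_intros cwY cont[OF CX])
  have i3: "pd i (\<lambda>x. F x $ i) integrable_on cbox a b" for i
  proof (rule integrable_continuous)
    have "C_on 1 S (\<lambda>x. F x $ i)"
      by (rule C_on_subset[OF C_on_vec_nth[OF open_UNIV CF] subset_UNIV])
    then show "continuous_on (cbox a b) (pd i (\<lambda>x. F x $ i))" by (rule cont)
  qed
  have "0 = (\<Sum>i\<in>UNIV. integral (cbox a b) (pd i (\<lambda>x. F x $ i)))" by (simp add: z)
  also have "\<dots> = integral (cbox a b) (\<lambda>x. \<Sum>i\<in>UNIV. pd i (\<lambda>x. F x $ i) x)"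
    by (rule integral_sum[symmetric]) (use i3 in auto)
  also have "\<dots> = integral (cbox a b) (\<lambda>x. X x * (\<Sum>i\<in>UNIV. pd i wY x $ i) + (\<Sum>i\<in>UNIV. pd i X x * wY x $ i))"
    by (rule integral_cong) (simp add: ppd sum.distrib sum_distrib_left)
  also have "\<dots> = integral (cbox a b) (\<lambda>x. X x * (\<Sum>i\<in>UNIV. pd i wY x $ i)) + integral (cbox a b) (\<lambda>x. \<Sum>i\<in>UNIV. pd i X x * wY x $ i)"
    by (rule integral_add[OF i1 i2])
  also have "integral (cbox a b) (\<lambda>x. \<Sum>i\<in>UNIV. pd i X x * wY x $ i)
      = integral (cbox a b) (\<lambda>x. fderiv X x (Y x) * vol x)"
  proof (rule integral_cong)
    fix x assume "x \<in> cbox a b"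
    then have "x \<in> S" using box by (auto simp: S_def)
    then have "X differentiable at x" using C_on_differentiable[OF oS, of 0 X x] CX by simp
    then show "(\<Sum>i\<in>UNIV. pd i X x * wY x $ i) = fderiv X x (Y x) * vol x"
      by (simp add: frechet_derivative_pd_sum wY_def sum_distrib_right sum_distrib_left mult_ac)
  qed
  finally show ?thesis unfolding wY_def[abs_def] vol_def by simp
qed

text \<open>Integration by parts moves the derivative from \<open>Y\<close> onto the weights. The
  sum becomes minus the integral of the differential of \<Sum>\<rho> applied to \<open>Y\<close>,
  which is zero: the weights sum to 1 near \<open>K\<close>, and \<open>Y\<close> vanishes off
  \<open>K\<close>. The pieces live in different charts and can be added only as integrals over
  \<open>\<mu>\<close>.\<close>

lemma divergence_theorem:
  fixes \<mu> :: "'m measure" and Y :: "('m, 'n, real^'n) components"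
  assumes \<mu>: "volume_measure A g \<mu>"
    and part: "open Q" "K \<subseteq> Q" "\<And>k. k < N \<Longrightarrow> cs k \<in> A"
    "\<And>k. k < N \<Longrightarrow> cbox (a k) (b k) \<subseteq> chart_image (cs k)" "\<And>k. k < N \<Longrightarrow> C1 (\<rho> k)"
    "\<And>k p. k < N \<Longrightarrow> \<rho> k p \<noteq> 0 \<Longrightarrow> p \<in> chart_dom (cs k) \<and> chart_map (cs k) p \<in> cbox (a k) (b k)"
    "\<And>p. p \<in> Q \<Longrightarrow> (\<Sum>k<N. \<rho> k p) = 1"
    and Y: "\<And>c. c \<in> A \<Longrightarrow> C_on 1 (chart_image c) (Y c)"
    and law: "\<And>c d x. c \<in> A \<Longrightarrow> d \<in> A \<Longrightarrow> x \<in> overlap c d \<Longrightarrow>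
      Y d (transition c d x) = jacobian (transition c d) x *v Y c x"
    and Y0: "\<And>c p. c \<in> A \<Longrightarrow> p \<in> chart_dom c \<Longrightarrow> p \<notin> K \<Longrightarrow> Y c (chart_map c p) = 0"
  shows "(\<Sum>k<N. integral (cbox (a k) (b k)) (\<lambda>x. \<rho> k (chart_inv (cs k) x) *
      (\<Sum>i\<in>UNIV. pd i (\<lambda>y. sqrt \<bar>det (g (cs k) y)\<bar> *\<^sub>R Y (cs k) y) x $ i))) = 0"
proof -
  define X where "X k d x = \<rho> k (chart_inv d x)" for k and d :: "('m, 'n) chart" and x
  \<comment> \<open>The differential of \<open>\<rho> k\<close> applied to \<open>Y\<close>,
    computed in the chart that carries \<open>\<rho> k\<close> and set to 0 outside its
    domain.\<close>
  define \<theta> where "\<theta> k p = (if p \<in> chart_dom (cs k) then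
    fderiv (X k (cs k)) (chart_map (cs k) p) (Y (cs k) (chart_map (cs k) p)) else 0)" for k p
  have CX: "C_on 1 (chart_image d) (X k d)" if "k < N" "d \<in> A" for k d
    using part(5)[OF that(1)] that(2) unfolding C1_def X_def[abs_def] by blast
  have dX: "X k d differentiable at x" if "k < N" "d \<in> A" "x \<in> chart_image d" for k d x
    using C_on_differentiable[OF open_chart_image[OF chart[OF that(2)]] _ that(3), of 0] CX[OF that(1,2)] by simp
  have supp: "x \<in> cbox (a k) (b k)" if "k < N" "x \<in> chart_image (cs k)" "X k (cs k) x \<noteq> 0" for k x
    using part(6)[OF that(1), of "chart_inv (cs k) x"] that chart[OF part(3)[OF that(1)]] by (simp add: X_def)
  have parts: "integral (cbox (a k) (b k)) (\<lambda>x. \<rho> k (chart_inv (cs k) x) *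
      (\<Sum>i\<in>UNIV. pd i (\<lambda>y. sqrt \<bar>det (g (cs k) y)\<bar> *\<^sub>R Y (cs k) y) x $ i)) = - integral\<^sup>L \<mu> (\<theta> k)"
    and int: "integrable \<mu> (\<theta> k)" if k: "k < N" for k
  proof -
    let ?c = "cs k"
    have c: "?c \<in> A" by (rule part(3)[OF k])
    note cc = chart[OF c]
    interpret semi_riemannian_chart "chart_image ?c" "g ?c" by (rule chart_metric[OF c])
    have th: "\<theta> k (chart_inv ?c x) = fderiv (X k ?c) x (Y ?c x)" if "x \<in> chart_image ?c" for x
      using that cc by (simp add: \<theta>_def)
    have det: "continuous_on (chart_image ?c) (\<lambda>x. sqrt \<bar>det (g ?c x)\<bar>)"
      using C_on_continuous[OF smooth_onD[OF smooth_vol]] by (simp add: vol_def[abs_def])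
    have s: "p \<in> chart_dom ?c \<and> chart_map ?c p \<in> cbox (a k) (b k)" if "\<theta> k p \<noteq> 0" for p
    proof -
      have p: "p \<in> chart_dom ?c" using that by (auto simp: \<theta>_def split: if_splits)
      have "chart_map ?c p \<in> cbox (a k) (b k)"
      proof (rule ccontr)
        assume n: "chart_map ?c p \<notin> cbox (a k) (b k)"
        have "fderiv (X k ?c) (chart_map ?c p) = fderiv (\<lambda>x. 0) (chart_map ?c p)"
          by (rule frechet_derivative_cong[of "chart_image ?c - cbox (a k) (b k)"])
            (use n p supp[OF k] open_S closed_cbox in \<open>auto intro: open_Diff\<close>)
        then show False using that by (simp add: \<theta>_def frechet_derivative_const split: if_splits)
      qed
      with p show ?thesis by simp
    qed
    have "continuous_on (cbox (a k) (b k)) (\<lambda>x. \<Sum>i\<in>UNIV. Y ?c x $ i *\<^sub>R pd i (X k ?c) x)"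
    proof (intro continuous_intros)
      show "continuous_on (cbox (a k) (b k)) (Y ?c)"
        by (rule continuous_on_subset[OF C_on_continuous[OF Y[OF c]] part(4)[OF k]])
      have "continuous_on (chart_image ?c) (pd i (X k ?c))" for i
        using C_on_pd[of 0] CX[OF k c] by simp
      then show "continuous_on (cbox (a k) (b k)) (pd i (X k ?c))" for i
        using part(4)[OF k] by (rule continuous_on_subset)
    qed
    then have cont: "continuous_on (cbox (a k) (b k)) (\<lambda>x. \<theta> k (chart_inv ?c x))"
      by (rule continuous_on_eq)
        (use part(4)[OF k] th dX[OF k c] in \<open>auto simp: frechet_derivative_pd_sum subset_iff\<close>)
    note ci = chart_integral[OF \<mu> c cc det part(4)[OF k] s cont]
    show "integrable \<mu> (\<theta> k)" by (rule ci)
    have "integral\<^sup>L \<mu> (\<theta> k) = integral (cbox (a k) (b k)) (\<lambda>x. \<theta> k (chart_inv ?c x) * sqrt \<bar>det (g ?c x)\<bar>)"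
      by (rule ci)
    also have "\<dots> = integral (cbox (a k) (b k)) (\<lambda>x. fderiv (X k ?c) x (Y ?c x) * sqrt \<bar>det (g ?c x)\<bar>)"
      by (rule integral_cong) (use th part(4)[OF k] in auto)
    finally show "integral (cbox (a k) (b k)) (\<lambda>x. \<rho> k (chart_inv (cs k) x) *
      (\<Sum>i\<in>UNIV. pd i (\<lambda>y. sqrt \<bar>det (g (cs k) y)\<bar> *\<^sub>R Y (cs k) y) x $ i)) = - integral\<^sup>L \<mu> (\<theta> k)"
      using integral_parts_chart[OF c part(4)[OF k] Y[OF c] CX[OF k c] supp[OF k]] by (simp add: X_def)
  qed
  have zero: "(\<Sum>k<N. \<theta> k p) = 0" for p
  proof (cases "p \<in> K")
    case False
    have "\<theta> k p = 0" if k: "k < N" for k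
    proof (cases "p \<in> chart_dom (cs k)")
      case True
      have "linear (fderiv (X k (cs k)) (chart_map (cs k) p))"
        by (rule has_derivative_linear[OF dX[OF k part(3)[OF k] chart_map_in[OF True], unfolded frechet_derivative_works]])
      then show ?thesis using Y0[OF part(3)[OF k] True False] by (simp add: \<theta>_def linear_0)
    qed (simp add: \<theta>_def)
    then show ?thesis by simp
  next
    case True
    obtain d where d: "d \<in> A" "p \<in> chart_dom d" by (rule chart_at)
    note dd = chart[OF d(1)]
    define y where "y = chart_map d p"
    have y: "y \<in> chart_image d" using d(2) by (simp add: y_def)
    \<comment> \<open>All summands are moved to one chart \<open>d\<close> around \<open>p\<close>:
      by the chain rule if \<open>p\<close> lies in the \<open>k\<close>-th domain; otherwise both
      sides vanish, because a closed set containing the support of \<open>\<rho> k\<close> misses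
      \<open>p\<close>.\<close>
    have "\<theta> k p = fderiv (X k d) y (Y d y)" if k: "k < N" for k
    proof (cases "p \<in> chart_dom (cs k)")
      case True
      let ?c = "cs k" and ?\<psi> = "transition (cs k) d"
      have c: "?c \<in> A" by (rule part(3)[OF k])
      define x where "x = chart_map ?c p"
      have x: "x \<in> overlap ?c d" using True d by (auto simp: x_def)
      have t: "?\<psi> x = y" using chart[OF c] True by (simp add: x_def y_def transition_def)
      have dp: "?\<psi> differentiable at x"
        by (rule smooth_on_differentiable[OF smooth_transition[OF c d(1)] open_overlap[OF c d(1)] x])
      have dXy: "X k d differentiable at (?\<psi> x)" unfolding t by (rule dX[OF k d(1) y])
      have "fderiv (X k ?c) x = fderiv (X k d \<circ> ?\<psi>) x"
        by (rule frechet_derivative_cong[OF open_overlap[OF c d(1)] x])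
          (use overlapD[OF c d(1)] in \<open>auto simp: X_def\<close>)
      also have "\<dots> = fderiv (X k d) y \<circ> fderiv ?\<psi> x"
        using frechet_derivative_compose[OF dp dXy] by (simp only: t)
      finally have "fderiv (X k ?c) x (Y ?c x)
          = fderiv (X k d) y (fderiv ?\<psi> x (Y ?c x))" by simp
      also have "fderiv ?\<psi> x (Y ?c x) = jacobian ?\<psi> x *v Y ?c x"
        by (simp add: frechet_derivative_pd_sum[OF dp] vec_eq_iff mv_nth jacobian_nth sum_component mult.commute)
      also have "\<dots> = Y d y" using law[OF c d(1) x] t by simp
      finally show ?thesis using True by (simp add: \<theta>_def x_def)
    next
      case False
      have c: "cs k \<in> A" by (rule part(3)[OF k])
      define C where "C = chart_inv (cs k) ` cbox (a k) (b k)"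
      have "closed C" unfolding C_def
        by (rule compact_imp_closed[OF compact_chart_inv_image[OF chart[OF c] compact_cbox part(4)[OF k]]])
      then have oC: "open (chart_dom d - C)" using open_chart_dom[OF dd] by (rule open_Diff[rotated])
      have CD: "C \<subseteq> chart_dom (cs k)" using part(4)[OF k] chart[OF c] by (auto simp: C_def)
      define T where "T = chart_map d ` (chart_dom d - C)"
      have oT: "open T" unfolding T_def by (rule open_chart_map_image[OF dd oC]) auto
      have yT: "y \<in> T" unfolding T_def y_def using d(2) False CD by blast
      have "X k d x = 0" if xT: "x \<in> T" for x
      proof (rule ccontr)
        assume n: "X k d x \<noteq> 0"
        obtain q where q: "q \<in> chart_dom d" "q \<notin> C" "x = chart_map d q" using xT unfolding T_def by blast
        then have "\<rho> k q \<noteq> 0" using n dd by (simp add: X_def)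
        from part(6)[OF k this] have "q \<in> chart_dom (cs k)" "chart_inv (cs k) (chart_map (cs k) q) \<in> C"
          unfolding C_def by auto
        then show False using q(2) chart[OF c] by simp
      qed
      then have "fderiv (X k d) y = fderiv (\<lambda>x. 0) y"
        by (rule frechet_derivative_cong[OF oT yT])
      then show ?thesis using False by (simp add: \<theta>_def frechet_derivative_const)
    qed
    then have "(\<Sum>k<N. \<theta> k p) = (\<Sum>k<N. fderiv (X k d) y (Y d y))" by simp
    also have "\<dots> = fderiv (\<lambda>x. \<Sum>k<N. X k d x) y (Y d y)"
    proof -
      have "((\<lambda>x. \<Sum>k<N. X k d x) has_derivative (\<lambda>v. \<Sum>k<N. fderiv (X k d) y v)) (at y)"
        by (rule has_derivative_sum) (use dX[OF _ d(1) y] in \<open>simp add: frechet_derivative_works\<close>)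
      from frechet_derivative_at[OF this] show ?thesis by metis
    qed
    \<comment> \<open>A derivative is compared, so the sum has to be 1 on an open set and not just
      on \<open>K\<close>.\<close>
    also have "fderiv (\<lambda>x. \<Sum>k<N. X k d x) y = fderiv (\<lambda>x. 1) y"
    proof (rule frechet_derivative_cong)
      show "open (chart_map d ` (chart_dom d \<inter> Q))"
        by (rule open_chart_map_image[OF dd]) (use part(1) open_chart_dom[OF dd] in auto)
      show "y \<in> chart_map d ` (chart_dom d \<inter> Q)" using True part(2) d(2) by (auto simp: y_def)
      show "(\<Sum>k<N. X k d x) = 1" if "x \<in> chart_map d ` (chart_dom d \<inter> Q)" for x
        using that part(7) dd by (auto simp: X_def)
    qed
    finally show ?thesis by (simp add: frechet_derivative_const)
  qed
  have "(\<Sum>k<N. integral\<^sup>L \<mu> (\<theta> k)) = integral\<^sup>L \<mu> (\<lambda>p. \<Sum>k<N. \<theta> k p)"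
    by (rule Bochner_Integration.integral_sum[symmetric]) (use int in auto)
  also have "\<dots> = 0" by (simp add: zero)
  finally show ?thesis by (simp add: parts sum_negf)
qed

end

section \<open>Paracontact Ricci solitons\<close>

lemma nab_cong:
  assumes "open S" "x \<in> S" "\<And>y. y \<in> S \<Longrightarrow> V y = V' y"
  shows "nab g V x = nab g V' x"
  using pd_cong[OF assms] assms(3)[OF assms(2)] by (simp add: nab_def)

context paracontact_soliton_chart
begin

lemma nadj_xi: "nadj g xi = Nadj"
  by (rule ext) (simp add: nadj_def Nadj_def)

text \<open>Harmonicity enters here: the divergence of the adjoint is a multiple of \<eta> and so
  annihilates \<open>U x\<close>, which leaves a pure divergence in the Leibniz rule.\<close>

lemma trace_nadj_nab:
  assumes x: "x \<in> S" and U: "U differentiable at x" and orth: "U x \<bullet> (g x *v xi x) = 0"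
  shows "trace (Nadj x ** nab g U x) = trace (nab g (\<lambda>y. Nadj y *v U y) x)"
proof -
  have "eta x \<bullet> U x = 0" using orth by (simp add: eta_eq[OF x] inner_commute)
  then have "div_endo g Nadj x \<bullet> U x = 0" by (simp add: div_Nadj[OF x])
  then show ?thesis using div_endo_mv[OF smooth_Nadj U x] by simp
qed

end

locale paracontact_soliton_manifold = semi_riemannian_manifold A g
  for A :: "('m::{t2_space,second_countable_topology}, 'n::finite) chart set" and g +
  fixes n :: nat and \<phi> and \<xi> \<eta> :: "('m, 'n, real^'n) components" and lam :: real
  assumes paracontact: "paracontact_metric n A \<phi> \<xi> \<eta> g" and soliton: "ricci_soliton A g \<xi> lam"
begin

lemma vector_field_xi: "vector_field A \<xi>"
  using soliton by (simp add: ricci_soliton_def)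

lemma soliton_chart:
  assumes c: "c \<in> A"
  shows "paracontact_soliton_chart (chart_image c) (g c) (\<phi> c) (\<xi> c) (\<eta> c) lam"
proof -
  interpret semi_riemannian_chart "chart_image c" "g c" by (rule chart_metric[OF c])
  note p = paracontact[unfolded paracontact_metric_def contact_form_def reeb_field_def]
  show ?thesis
  proof
    show "smooth_on (chart_image c) (\<phi> c)"
      using p c by (auto simp: endomorphism_field_def tensor_field_def)
    show "smooth_on (chart_image c) (\<eta> c)"
      using p c by (auto simp: one_form_def tensor_field_def)
    show "smooth_on (chart_image c) (\<xi> c)"
      by (rule vector_field_smooth[OF vector_field_xi c])
    fix x u v assume x: "x \<in> chart_image c"
    show "\<eta> c x \<bullet> \<xi> c x = 1" "\<xi> c x \<bullet> (ext_deriv (\<eta> c) x *v v) = 0"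
      "\<eta> c x \<bullet> v = \<xi> c x \<bullet> (g c x *v v)"
      "u \<bullet> (ext_deriv (\<eta> c) x *v v) = u \<bullet> (g c x *v (\<phi> c x *v v))"
      "\<phi> c x *v (\<phi> c x *v v) = v - (\<eta> c x \<bullet> v) *\<^sub>R \<xi> c x"
      using p c x by blast+
    show "ricci (g c) x + (1/2) *\<^sub>R lie_deriv_form (\<xi> c) (g c) x = lam *\<^sub>R g c x"
      using soliton c x unfolding ricci_soliton_def by blast
  qed
qed

lemma has_length_xi: "has_length A g \<xi> 1"
  unfolding has_length_def
proof (intro ballI)
  fix c x assume c: "c \<in> A" and x: "x \<in> chart_image c"
  interpret paracontact_soliton_chart "chart_image c" "g c" "\<phi> c" "\<xi> c" "\<eta> c" lam by (rule soliton_chart[OF c])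
  show "\<xi> c x \<bullet> (g c x *v \<xi> c x) = 1" using eta_inner[OF x, of "\<xi> c x"] eta_xi[OF x] by simp
qed

text \<open>What is differentiated is the difference to the energy at time 0: the densities of
  \<open>W t\<close> and \<open>W 0\<close> differ only on the compact \<open>K\<close>, so this is
  a finite sum of chart integrals \<open>\<Phi> k t\<close>. Differentiation under the integral
  turns them into the terms of \<open>divergence_theorem\<close>.\<close>

lemma first_variation:
  assumes \<mu>: "volume_measure A g \<mu>" and D: "open D" and eps: "\<epsilon> > 0"
    and var: "length_preserving_variation A g \<xi> 1 D \<epsilon> W"
  shows "((\<lambda>t. energy A g \<mu> D (W t)) has_real_derivative 0) (at 0)"
proof -
  have V: "vector_field A (W t)" and len: "has_length A g (W t) 1" if "\<bar>t\<bar> < \<epsilon>" for t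
    using var that by (auto simp: length_preserving_variation_def)
  have W0: "W 0 c x = \<xi> c x" if "c \<in> A" "x \<in> chart_image c" for c x
    using var that unfolding length_preserving_variation_def by blast
  obtain K where K: "K \<subseteq> D" "compact K" and
    KW: "\<And>t c p. \<bar>t\<bar> < \<epsilon> \<Longrightarrow> c \<in> A \<Longrightarrow> p \<in> chart_dom c \<Longrightarrow> p \<notin> K \<Longrightarrow> W t c (chart_map c p) = \<xi> c (chart_map c p)"
    using var unfolding length_preserving_variation_def by blast
  have e0: "\<bar>0::real\<bar> < \<epsilon>" using eps by simp
  have cv: "chart_variation (chart_image c) (g c) \<epsilon> (\<lambda>t. W t c)" if c: "c \<in> A" for c
  proof -
    interpret semi_riemannian_chart "chart_image c" "g c" by (rule chart_metric[OF c])
    show ?thesis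
    proof
      show "\<epsilon> > 0" by (rule eps)
      have "smooth_on ({-\<epsilon><..<\<epsilon>} \<times> chart_image c) (\<lambda>(t, x). W t c x)"
        using var c unfolding length_preserving_variation_def by blast
      then show "smooth_on ({-\<epsilon><..<\<epsilon>} \<times> chart_image c) (\<lambda>z. W (fst z) c (snd z))"
        by (simp only: case_prod_unfold)
    qed
  qed
  define U where "U c = chart_variation.U (\<lambda>t. W t c)" for c
  \<comment> \<open>The adjoint of \<nabla>\<xi> applied to the variation field; its divergence is
    the first variation of the energy density.\<close>
  define Y where "Y c x = nadj (g c) (\<xi> c) x *v U c x" for c x
  define eh where "eh c = chart_variation.eh (g c) (\<lambda>t. W t c)" for c
  define eh' where "eh' c = chart_variation.eh' (g c) (\<lambda>t. W t c)" for c
  have smooth_U: "smooth_on (chart_image c) (U c)" if c: "c \<in> A" for c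
    unfolding U_def by (rule chart_variation.smooth_U[OF cv[OF c]])
  have dU: "U c differentiable at x" if "c \<in> A" "x \<in> chart_image c" for c x
    by (rule smooth_on_differentiable[OF smooth_U[OF that(1)] open_chart_image[OF chart[OF that(1)]] that(2)])
  have smooth_Y: "smooth_on (chart_image c) (Y c)" if c: "c \<in> A" for c
  proof -
    interpret paracontact_soliton_chart "chart_image c" "g c" "\<phi> c" "\<xi> c" "\<eta> c" lam by (rule soliton_chart[OF c])
    show ?thesis
      unfolding Y_def[abs_def] nadj_xi
      by (rule smooth_on_bounded_bilinear[OF open_S bounded_bilinear_matrix_vector_mult smooth_Nadj smooth_U[OF c]])
  qed
  have U_law: "U d (transition c d x) = jacobian (transition c d) x *v U c x"
    if c: "c \<in> A" and d: "d \<in> A" and x: "x \<in> overlap c d" for c d x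
  proof -
    let ?y = "transition c d x" and ?J = "jacobian (transition c d) x"
    have xi: "x \<in> chart_image c" "?y \<in> chart_image d" using x overlapD[OF c d x] by auto
    have 1: "((\<lambda>t. W t d ?y) has_vector_derivative U d ?y) (at 0)"
      unfolding U_def by (rule chart_variation.U_derivative[OF cv[OF d] xi(2)])
    have "((\<lambda>t. ?J *v W t c x) has_vector_derivative ?J *v U c x) (at 0)"
      unfolding U_def by (rule bounded_linear.has_vector_derivative[OF mv.bounded_linear_right
            chart_variation.U_derivative[OF cv[OF c] xi(1)]])
    then have "((\<lambda>t. W t d ?y) has_vector_derivative ?J *v U c x) (at 0)"
      by (rule has_vector_derivative_transform_within_open[where S = "{-\<epsilon><..<\<epsilon>}"])
        (use eps vector_field_law[OF V c d x] in auto)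
    with 1 show ?thesis by (rule vector_derivative_unique_at)
  qed
  have Y_law: "Y d (transition c d x) = jacobian (transition c d) x *v Y c x"
    if c: "c \<in> A" and d: "d \<in> A" and x: "x \<in> overlap c d" for c d x
  proof -
    interpret chart_change "overlap c d" "chart_image d" "g c" "g d" "transition c d"
      by (rule chart_change[OF c d])
    have "jacobian (transition c d) x ** nadj (g c) (\<xi> c) x
        = nadj (g d) (\<xi> d) (transition c d x) ** jacobian (transition c d) x"
    proof (rule nadj_change[OF x _ _ vector_field_law[OF vector_field_xi c d]])
      show "\<xi> c differentiable at x"
        by (rule smooth_on_differentiable[OF vector_field_smooth[OF vector_field_xi c] open_chart_image[OF chart[OF c]]])
          (use x in auto)
      show "\<xi> d differentiable at (transition c d x)"
        by (rule smooth_on_differentiable[OF vector_field_smooth[OF vector_field_xi d] open_chart_image[OF chart[OF d]]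
              overlapD(5)[OF c d x]])
    qed
    then show ?thesis
      unfolding Y_def U_law[OF c d x] matrix_vector_mul_assoc by simp
  qed
  have Y0: "Y c (chart_map c p) = 0" if c: "c \<in> A" and p: "p \<in> chart_dom c" "p \<notin> K" for c p
  proof -
    have "U c (chart_map c p) = 0"
      unfolding U_def
      by (rule chart_variation.U_zero[OF cv[OF c] chart_map_in[OF p(1)]]) (rule KW[OF _ c p])
    then show ?thesis by (simp add: Y_def)
  qed
  define dens where "dens t p = energy_density A g (W t) p" for t p
  have dens_chart: "dens t p = eh c (t, chart_map c p)" if "\<bar>t\<bar> < \<epsilon>" "c \<in> A" "p \<in> chart_dom c" for t c p
    unfolding dens_def eh_def energy_density_chart[OF V[OF that(1)] that(2,3)]
    by (rule chart_variation.eh_eq[OF cv[OF that(2)] that(1) chart_map_in[OF that(3)]])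
  have dens_off: "dens t p = dens 0 p" if t: "\<bar>t\<bar> < \<epsilon>" and p: "p \<notin> K" for t p
  proof -
    obtain c where c: "c \<in> A" "p \<in> chart_dom c" by (rule chart_at)
    \<comment> \<open>The density involves derivatives, so the fields must agree near
      \<open>p\<close> and not only at \<open>p\<close>; \<open>K\<close> is closed because the
      manifold is Hausdorff.\<close>
    define T where "T = chart_map c ` (chart_dom c - K)"
    have oT: "open T" unfolding T_def
      by (rule open_chart_map_image[OF chart[OF c(1)]])
        (use open_chart_dom[OF chart[OF c(1)]] compact_imp_closed[OF K(2)] in auto)
    have pT: "chart_map c p \<in> T" using c p by (auto simp: T_def)
    have eq: "W t c y = W 0 c y" if "y \<in> T" for y
      using that KW[OF t c(1)] KW[OF e0 c(1)] unfolding T_def by auto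
    have pd_eq: "pd i (W t c) (chart_map c p) = pd i (W 0 c) (chart_map c p)" for i
      by (rule pd_cong[OF oT pT]) (rule eq)
    have "local_energy_density (g c) (W t c) (chart_map c p) = local_energy_density (g c) (W 0 c) (chart_map c p)"
      unfolding local_energy_density_def pd_eq eq[OF pT] ..
    then show ?thesis
      unfolding dens_def energy_density_chart[OF V[OF t] c] energy_density_chart[OF V[OF e0] c] .
  qed
  obtain N :: nat and cs :: "nat \<Rightarrow> ('m, 'n) chart" and a b \<rho> Q where part: "open Q" "K \<subseteq> Q"
    "\<And>k. k < N \<Longrightarrow> cs k \<in> A" "\<And>k. k < N \<Longrightarrow> cbox (a k) (b k) \<subseteq> chart_image (cs k)"
    "\<And>k. k < N \<Longrightarrow> C1 (\<rho> k)"
    "\<And>k p. k < N \<Longrightarrow> \<rho> k p \<noteq> 0 \<Longrightarrow> p \<in> chart_dom (cs k) \<and> chart_map (cs k) p \<in> cbox (a k) (b k)"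
    "\<And>p. p \<in> Q \<Longrightarrow> (\<Sum>k<N. \<rho> k p) = 1"
    by (rule partition_of_unity[OF K(2)]) (rule that, assumption+)
  define w where "w c x = sqrt \<bar>det (g c x)\<bar>" for c x
  define \<Phi> where "\<Phi> k t = integral (cbox (a k) (b k)) (\<lambda>x. \<rho> k (chart_inv (cs k) x) *
    (eh (cs k) (t, x) - eh (cs k) (0, x)) * w (cs k) x)" for k t
  have w_cont: "continuous_on (chart_image c) (w c)" if c: "c \<in> A" for c
  proof -
    interpret semi_riemannian_chart "chart_image c" "g c" by (rule chart_metric[OF c])
    show ?thesis using C_on_continuous[OF smooth_onD[OF smooth_vol]] by (simp add: vol_def[abs_def] w_def[abs_def])
  qed
  have rho_cont: "continuous_on (cbox (a k) (b k)) (\<lambda>x. \<rho> k (chart_inv (cs k) x))" if k: "k < N" for k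
  proof -
    have "C_on 1 (chart_image (cs k)) (\<lambda>x. \<rho> k (chart_inv (cs k) x))"
      using part(5)[OF k] part(3)[OF k] unfolding C1_def by blast
    from continuous_on_subset[OF C_on_continuous[OF this] part(4)[OF k]] show ?thesis .
  qed
  have sub: "{-\<epsilon><..<\<epsilon>} \<times> cbox (a k) (b k) \<subseteq> {-\<epsilon><..<\<epsilon>} \<times> chart_image (cs k)" if k: "k < N" for k
    using part(4)[OF k] by auto
  have eh_cont: "continuous_on ({-\<epsilon><..<\<epsilon>} \<times> cbox (a k) (b k)) (eh (cs k))"
    and eh'_cont: "continuous_on ({-\<epsilon><..<\<epsilon>} \<times> cbox (a k) (b k)) (eh' (cs k))" if k: "k < N" for k
    unfolding eh_def eh'_def
    by (rule continuous_on_subset[OF chart_variation.continuous_eh[OF cv[OF part(3)[OF k]]] sub[OF k]]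
        continuous_on_subset[OF chart_variation.continuous_eh'[OF cv[OF part(3)[OF k]]] sub[OF k]])+
  have eh_cont1: "continuous_on (cbox (a k) (b k)) (\<lambda>x. eh (cs k) (t, x))" if k: "k < N" and t: "\<bar>t\<bar> < \<epsilon>" for k t
    by (rule continuous_on_compose2[OF eh_cont[OF k]]) (use t in \<open>auto intro!: continuous_intros\<close>)
  have diff_cont: "continuous_on (cbox (a k) (b k)) (\<lambda>x. \<rho> k (chart_inv (cs k) x) * (eh (cs k) (t, x) - eh (cs k) (0, x)))"
    if k: "k < N" and t: "\<bar>t\<bar> < \<epsilon>" for k t
    by (intro continuous_intros rho_cont[OF k] eh_cont1[OF k t] eh_cont1[OF k e0])
  have piece: "integrable \<mu> (\<lambda>p. \<rho> k p * (dens t p - dens 0 p))"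
    "integral\<^sup>L \<mu> (\<lambda>p. \<rho> k p * (dens t p - dens 0 p)) = \<Phi> k t" if k: "k < N" and t: "\<bar>t\<bar> < \<epsilon>" for k t
  proof -
    let ?c = "cs k" and ?f = "\<lambda>p. \<rho> k p * (dens t p - dens 0 p)"
    have c: "?c \<in> A" by (rule part(3)[OF k])
    have f_eq: "?f (chart_inv ?c x) = \<rho> k (chart_inv ?c x) * (eh ?c (t, x) - eh ?c (0, x))"
      if "x \<in> cbox (a k) (b k)" for x
    proof -
      have "x \<in> chart_image ?c" using that part(4)[OF k] by auto
      then show ?thesis
        using dens_chart[OF t c, of "chart_inv ?c x"] dens_chart[OF e0 c, of "chart_inv ?c x"] chart[OF c] by simp
    qed
    have cont: "continuous_on (cbox (a k) (b k)) (\<lambda>x. ?f (chart_inv ?c x))"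
      by (rule continuous_on_eq[OF diff_cont[OF k t]]) (rule f_eq[symmetric])
    have s: "p \<in> chart_dom ?c \<and> chart_map ?c p \<in> cbox (a k) (b k)" if "?f p \<noteq> 0" for p
      using part(6)[OF k] that by auto
    note ci = chart_integral[where f = ?f, OF \<mu> c chart[OF c] w_cont[OF c, unfolded w_def[abs_def]] part(4)[OF k] s cont]
    show "integrable \<mu> ?f" by (rule ci(1))
    have "integral\<^sup>L \<mu> ?f = integral (cbox (a k) (b k)) (\<lambda>x. ?f (chart_inv ?c x) * sqrt \<bar>det (g ?c x)\<bar>)"
      by (rule ci(2))
    also have "\<dots> = \<Phi> k t"
      unfolding \<Phi>_def w_def by (rule integral_cong) (simp only: f_eq)
    finally show "integral\<^sup>L \<mu> ?f = \<Phi> k t" .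
  qed
  have diff_sum: "(\<lambda>p. dens t p - dens 0 p) = (\<lambda>p. \<Sum>k<N. \<rho> k p * (dens t p - dens 0 p))" if t: "\<bar>t\<bar> < \<epsilon>" for t
  proof
    fix p
    show "dens t p - dens 0 p = (\<Sum>k<N. \<rho> k p * (dens t p - dens 0 p))"
    proof (cases "p \<in> K")
      case True
      then show ?thesis using part(7)[of p] part(2) by (auto simp: sum_distrib_right[symmetric])
    next
      case False
      then show ?thesis using dens_off[OF t False] by simp
    qed
  qed
  have diff_int: "integrable \<mu> (\<lambda>p. dens t p - dens 0 p)"
    "integral\<^sup>L \<mu> (\<lambda>p. dens t p - dens 0 p) = (\<Sum>k<N. \<Phi> k t)" if t: "\<bar>t\<bar> < \<epsilon>" for t
  proof -
    show "integrable \<mu> (\<lambda>p. dens t p - dens 0 p)"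
      unfolding diff_sum[OF t] by (rule Bochner_Integration.integrable_sum) (use piece(1)[OF _ t] in auto)
    have "integral\<^sup>L \<mu> (\<lambda>p. dens t p - dens 0 p) = (\<Sum>k<N. integral\<^sup>L \<mu> (\<lambda>p. \<rho> k p * (dens t p - dens 0 p)))"
      unfolding diff_sum[OF t] by (rule Bochner_Integration.integral_sum) (use piece(1)[OF _ t] in auto)
    then show "integral\<^sup>L \<mu> (\<lambda>p. dens t p - dens 0 p) = (\<Sum>k<N. \<Phi> k t)"
      using piece(2)[OF _ t] by simp
  qed
  define h where "h t p = indicator D p *\<^sub>R dens t p" for t p
  have energy_h: "energy A g \<mu> D (W t) = integral\<^sup>L \<mu> (h t)" for t
    by (simp add: energy_def set_lebesgue_integral_def h_def[abs_def] dens_def)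
  \<comment> \<open>Since \<open>K \<subseteq> D\<close>, the difference of densities vanishes off
    \<open>D\<close> and carries no indicator.\<close>
  have h_eq: "h t = (\<lambda>p. h 0 p + (dens t p - dens 0 p))" if t: "\<bar>t\<bar> < \<epsilon>" for t
  proof
    fix p show "h t p = h 0 p + (dens t p - dens 0 p)"
    proof (cases "p \<in> D")
      case False
      then have "dens t p = dens 0 p" using K(1) dens_off[OF t] by blast
      then show ?thesis using False by (simp add: h_def)
    qed (simp add: h_def)
  qed
  have Phi_deriv: "(\<Phi> k has_real_derivative integral (cbox (a k) (b k)) (\<lambda>x. \<rho> k (chart_inv (cs k) x) *
      (\<Sum>i\<in>UNIV. pd i (\<lambda>y. sqrt \<bar>det (g (cs k) y)\<bar> *\<^sub>R Y (cs k) y) x $ i))) (at 0)" if k: "k < N" for k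
  proof -
    let ?c = "cs k" and ?r = "\<lambda>x. \<rho> k (chart_inv (cs k) x)"
    have c: "?c \<in> A" by (rule part(3)[OF k])
    have "((\<lambda>t. integral (cbox (a k) (b k)) (\<lambda>x. ?r x * (eh ?c (t, x) - eh ?c (0, x)) * w ?c x)) has_real_derivative
        integral (cbox (a k) (b k)) (\<lambda>x. ?r x * eh' ?c (0, x) * w ?c x)) (at 0 within {-\<epsilon><..<\<epsilon>})"
    proof (rule leibniz_rule_field_derivative)
      show "((\<lambda>t. ?r x * (eh ?c (t, x) - eh ?c (0, x)) * w ?c x) has_real_derivative ?r x * eh' ?c (t, x) * w ?c x)
          (at t within {-\<epsilon><..<\<epsilon>})" if t: "t \<in> {-\<epsilon><..<\<epsilon>}" and x: "x \<in> cbox (a k) (b k)" for t x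
      proof -
        have "((\<lambda>t. eh ?c (t, x)) has_real_derivative eh' ?c (t, x)) (at t)"
          unfolding eh_def eh'_def
          by (rule chart_variation.eh_derivative[OF cv[OF c]]) (use t x part(4)[OF k] in auto)
        then have "((\<lambda>t. eh ?c (t, x)) has_real_derivative eh' ?c (t, x)) (at t within {-\<epsilon><..<\<epsilon>})"
          by (rule has_field_derivative_at_within)
        then show ?thesis by (auto intro!: derivative_eq_intros)
      qed
      show "(\<lambda>x. ?r x * (eh ?c (t, x) - eh ?c (0, x)) * w ?c x) integrable_on cbox (a k) (b k)"
        if t: "t \<in> {-\<epsilon><..<\<epsilon>}" for t
        by (rule integrable_continuous, rule continuous_on_mult[OF diff_cont[OF k]])
          (use t continuous_on_subset[OF w_cont[OF c] part(4)[OF k]] in auto)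
      have "continuous_on ({-\<epsilon><..<\<epsilon>} \<times> cbox (a k) (b k)) (\<lambda>z. ?r (snd z) * eh' ?c z * w ?c (snd z))"
        by (intro continuous_on_mult eh'_cont[OF k] continuous_on_compose2[OF rho_cont[OF k]]
            continuous_on_compose2[OF w_cont[OF c]] continuous_on_snd continuous_on_id) (use part(4)[OF k] in auto)
      then show "continuous_on ({-\<epsilon><..<\<epsilon>} \<times> cbox (a k) (b k)) (\<lambda>(t, x). ?r x * eh' ?c (t, x) * w ?c x)"
        by (simp add: case_prod_beta)
    qed (use eps in auto)
    then have "(\<Phi> k has_real_derivative integral (cbox (a k) (b k)) (\<lambda>x. ?r x * eh' ?c (0, x) * w ?c x)) (at 0)"
      using at_within_open[of 0 "{-\<epsilon><..<\<epsilon>}"] eps by (simp add: \<Phi>_def[abs_def])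
    moreover have "integral (cbox (a k) (b k)) (\<lambda>x. ?r x * eh' ?c (0, x) * w ?c x)
        = integral (cbox (a k) (b k)) (\<lambda>x. ?r x * (\<Sum>i\<in>UNIV. pd i (\<lambda>y. sqrt \<bar>det (g ?c y)\<bar> *\<^sub>R Y ?c y) x $ i))"
    proof (rule integral_cong)
      fix x assume "x \<in> cbox (a k) (b k)"
      then have x: "x \<in> chart_image ?c" using part(4)[OF k] by auto
      interpret paracontact_soliton_chart "chart_image ?c" "g ?c" "\<phi> ?c" "\<xi> ?c" "\<eta> ?c" lam by (rule soliton_chart[OF c])
      have W0x: "W 0 ?c y = \<xi> ?c y" if "y \<in> chart_image ?c" for y by (rule W0[OF c that])
      have nab_W0: "nab (g ?c) (W 0 ?c) x = nab (g ?c) (\<xi> ?c) x"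
        by (rule nab_cong[OF open_S x]) (rule W0x)
      have "eh' ?c (0, x) = trace (nadj (g ?c) (W 0 ?c) x ** nab (g ?c) (U ?c) x)"
        unfolding eh'_def U_def by (rule chart_variation.eh'_0[OF cv[OF c] x])
      also have "nadj (g ?c) (W 0 ?c) x = Nadj x"
        by (simp only: nadj_def Nadj_def nab_W0)
      also have "trace (Nadj x ** nab (g ?c) (U ?c) x) = trace (nab (g ?c) (\<lambda>y. Nadj y *v U ?c y) x)"
      proof (rule trace_nadj_nab[OF x dU[OF c x]])
        have "U ?c x \<bullet> (g ?c x *v W 0 ?c x) = 0"
          unfolding U_def
          by (rule chart_variation.U_orthogonal[OF cv[OF c] x, where r = 1])
            (use len c x in \<open>auto simp: has_length_def\<close>)
        then show "U ?c x \<bullet> (g ?c x *v \<xi> ?c x) = 0" by (simp only: W0x[OF x])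
      qed
      also have "(\<lambda>y. Nadj y *v U ?c y) = Y ?c" by (simp add: Y_def[abs_def] nadj_xi)
      finally have "eh' ?c (0, x) = trace (nab (g ?c) (Y ?c) x)" .
      moreover have "(\<Sum>i\<in>UNIV. pd i (\<lambda>y. vol y *\<^sub>R Y ?c y) x $ i) = vol x * trace (nab (g ?c) (Y ?c) x)"
        by (rule divergence_vol[OF x smooth_on_differentiable[OF smooth_Y[OF c] open_S x]])
      ultimately show "?r x * eh' ?c (0, x) * w ?c x
          = ?r x * (\<Sum>i\<in>UNIV. pd i (\<lambda>y. sqrt \<bar>det (g ?c y)\<bar> *\<^sub>R Y ?c y) x $ i)"
        by (simp add: vol_def[abs_def] w_def)
    qed
    ultimately show ?thesis by simp
  qed
  have "((\<lambda>t. \<Sum>k<N. \<Phi> k t) has_real_derivative (\<Sum>k<N. integral (cbox (a k) (b k)) (\<lambda>x. \<rho> k (chart_inv (cs k) x) *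
      (\<Sum>i\<in>UNIV. pd i (\<lambda>y. sqrt \<bar>det (g (cs k) y)\<bar> *\<^sub>R Y (cs k) y) x $ i)))) (at 0)"
    by (rule DERIV_sum) (use Phi_deriv in auto)
  moreover have "(\<Sum>k<N. integral (cbox (a k) (b k)) (\<lambda>x. \<rho> k (chart_inv (cs k) x) *
      (\<Sum>i\<in>UNIV. pd i (\<lambda>y. sqrt \<bar>det (g (cs k) y)\<bar> *\<^sub>R Y (cs k) y) x $ i))) = 0"
    by (rule divergence_theorem[OF \<mu> part smooth_onD[OF smooth_Y] Y_law Y0])
  ultimately have Phi0: "((\<lambda>t. \<Sum>k<N. \<Phi> k t) has_real_derivative 0) (at 0)" by simp
  \<comment> \<open>\<open>h t\<close> and \<open>h 0\<close> differ by an integrable function, so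
    for small \<open>t\<close> either all of them are integrable or none is.\<close>
  have int_iff: "integrable \<mu> (h t) \<longleftrightarrow> integrable \<mu> (h 0)" if t: "\<bar>t\<bar> < \<epsilon>" for t
  proof
    assume "integrable \<mu> (h t)"
    then have "integrable \<mu> (\<lambda>p. h t p - (dens t p - dens 0 p))"
      by (rule Bochner_Integration.integrable_diff) (rule diff_int(1)[OF t])
    then show "integrable \<mu> (h 0)" unfolding h_eq[OF t] by simp
  next
    assume "integrable \<mu> (h 0)"
    then show "integrable \<mu> (h t)" unfolding h_eq[OF t]
      by (rule Bochner_Integration.integrable_add) (rule diff_int(1)[OF t])
  qed
  have transform: "((\<lambda>t. energy A g \<mu> D (W t)) has_real_derivative 0) (at 0)"
    if F: "(F has_real_derivative 0) (at 0)" and eq: "\<And>t. \<bar>t\<bar> < \<epsilon> \<Longrightarrow> energy A g \<mu> D (W t) = F t" for F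
  proof (rule has_field_derivative_transform_within_open[OF F, of "{-\<epsilon><..<\<epsilon>}"])
    show "F t = energy A g \<mu> D (W t)" if "t \<in> {-\<epsilon><..<\<epsilon>}" for t
      by (rule eq[symmetric]) (use that in auto)
  qed (use eps in auto)
  show ?thesis
  proof (cases "integrable \<mu> (h 0)")
    case True
    have "((\<lambda>t. integral\<^sup>L \<mu> (h 0) + (\<Sum>k<N. \<Phi> k t)) has_real_derivative 0) (at 0)"
      using DERIV_add[OF DERIV_const Phi0] by simp
    then show ?thesis
    proof (rule transform)
      show "energy A g \<mu> D (W t) = integral\<^sup>L \<mu> (h 0) + (\<Sum>k<N. \<Phi> k t)" if t: "\<bar>t\<bar> < \<epsilon>" for t
        unfolding energy_h h_eq[OF t] diff_int(2)[OF t, symmetric]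
        by (rule Bochner_Integration.integral_add[OF True diff_int(1)[OF t]])
    qed
  next
    case False
    text \<open>In this case the Bochner integral takes its default value \<open>0\<close> along the whole variation.\<close>
    show ?thesis
    proof (rule transform[OF DERIV_const])
      show "energy A g \<mu> D (W t) = 0" if t: "\<bar>t\<bar> < \<epsilon>" for t
        unfolding energy_h by (rule not_integrable_integral_eq) (simp add: int_iff[OF t] False)
    qed
  qed
qed

lemma harmonic_xi: "harmonic_vector_field A g \<xi>"
  unfolding harmonic_vector_field_def
proof (intro conjI exI[of _ 1] allI impI)
  show "vector_field A \<xi>" by (rule vector_field_xi)
  show "has_length A g \<xi> 1" by (rule has_length_xi)
  fix \<mu> D \<epsilon> W
  assume "volume_measure A g \<mu> \<and> relatively_compact_domain D \<and> \<epsilon> > 0 \<and> length_preserving_variation A g \<xi> 1 D \<epsilon> W"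
  then show "((\<lambda>t. energy A g \<mu> D (W t)) has_real_derivative 0) (at 0)"
    by (intro first_variation) (auto simp: relatively_compact_domain_def)
qed simp

lemma lam_value: "lam = - 2 * real n"
proof -
  \<comment> \<open>Types are inhabited, so \<open>undefined\<close> is a point of the manifold; the
    constant can be read off at any point.\<close>
  obtain c where c: "c \<in> A" "(undefined :: 'm) \<in> chart_dom c" by (rule chart_at)
  interpret paracontact_soliton_chart "chart_image c" "g c" "\<phi> c" "\<xi> c" "\<eta> c" lam by (rule soliton_chart[OF c(1)])
  have "CARD('n) = 2 * n + 1" using paracontact by (simp add: paracontact_metric_def contact_form_def)
  then show ?thesis using lam_eq[OF chart_map_in[OF c(2)]] by simp
qed

end

theorem theorem5p6:
  fixes A :: "('m::{t2_space,second_countable_topology}, 'n::finite) chart set"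
    and \<phi> g :: "('m, 'n, real^'n^'n) components"
    and \<xi> \<eta> :: "('m, 'n, real^'n) components"
    and n :: nat and lam :: real
  assumes "n \<ge> 1"
    and "connected_smooth_manifold A"
    and "paracontact_ricci_soliton n A \<phi> \<xi> \<eta> g lam"
  shows "H_paracontact n A \<phi> \<xi> \<eta> g \<and> expanding lam"
proof -
  interpret paracontact_soliton_manifold A g n \<phi> \<xi> \<eta> lam
    using assms(2,3)
    by unfold_locales
      (auto simp: connected_smooth_manifold_def paracontact_ricci_soliton_def ricci_soliton_def)
  show ?thesis
    using paracontact harmonic_xi lam_value assms(1) by (simp add: H_paracontact_def expanding_def)
qed

end
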